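(* $\mathsf{AM}(k)=\mathsf{AM}$ for all $k=\mathrm{poly}(n)$.
   Context: For a number of provers $k=k(n)$, $\mathsf{AM}(k)$ is the class of languages $L\subseteq\{0,1\}^*$ for which there exist a polynomial $q$ and a probabilistic polynomial-time verifier $V$ such that for all inputs $x\in\{0,1\}^n$: if $x\in L$ there exist functions $b_1,\dots,b_k:\{0,1\}^{q(n)}\to\{0,1\}^{q(n)}$ (depending on $x$) with $\Pr[V(x,y_1,\dots,y_k,b_1(y_1),\dots,b_k(y_k))\text{ accepts}]\ge2/3$, where $y_1,\dots,y_k$ are independent uniformly random strings in $\{0,1\}^{q(n)}$; if $x\notin L$, then for all such functions this probability is at most $1/3$. (Prover $i$ sees only $y_i$; the provers cannot communicate.) $\mathsf{AM}=\mathsf{AM}(1)$ is the usual single-prover Arthur–Merlin class.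
   Formalization: Here k=poly(n) means k is polynomially bounded, k(n) is computable in time poly(n), and k(n)≥1 for n≥1; for uncomputable k with values in {1,2} the equality fails, since the verifier sees the number of provers. *)

theory Defs
  imports
    "HOL-Probability.Probability"
    "HOL-Computational_Algebra.Polynomial"
begin

datatype move = MoveLeft | MoveRight | Stay

text \<open>
  A tape is infinite in both directions and comes with a head position. Symbol \<open>0\<close> is the blank.
\<close>

type_synonym tape = "(int \<Rightarrow> nat) \<times> int"

type_synonym config = "nat \<times> tape list"

text \<open>
  States are \<open>0, \<dots>, num_states - 1\<close>, with start state \<open>0\<close>; the additional state
  \<open>num_states\<close> is the halting state. The transition function maps a state and the list of symbols
  under the heads to the next state and, for each tape, a symbol to write and a head movement.
\<close>

record machine =
  num_tapes :: nat
  num_symbols :: nat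
  num_states :: nat
  trans :: "nat \<Rightarrow> nat list \<Rightarrow> nat \<times> (nat \<times> move) list"

text \<open>
  Tape 0 is the input tape, tape 1 the output tape. The symbols 1, 2, 3 are the separator and
  the two bits; see \<open>bit_symbol\<close> and \<open>encode\<close> below.
\<close>

definition turing_machine :: "machine \<Rightarrow> bool" where
  "turing_machine M \<longleftrightarrow>
     num_tapes M \<ge> 2 \<and> num_symbols M \<ge> 4 \<and>
     (\<forall>s < num_states M. \<forall>as. length as = num_tapes M \<and> set as \<subseteq> {..<num_symbols M} \<longrightarrow>
        fst (trans M s as) \<le> num_states M \<and>
        length (snd (trans M s as)) = num_tapes M \<and>
        fst ` set (snd (trans M s as)) \<subseteq> {..<num_symbols M})"

fun move_head :: "move \<Rightarrow> int \<Rightarrow> int" where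
  "move_head MoveLeft i = i - 1"
| "move_head MoveRight i = i + 1"
| "move_head Stay i = i"

fun read_tape :: "tape \<Rightarrow> nat" where
  "read_tape (f, i) = f i"

fun act_tape :: "nat \<times> move \<Rightarrow> tape \<Rightarrow> tape" where
  "act_tape (a, m) (f, i) = (f(i := a), move_head m i)"

fun step :: "machine \<Rightarrow> config \<Rightarrow> config" where
  "step M (s, ts) =
     (if s < num_states M then
        let (s', acts) = trans M s (map read_tape ts) in (s', map2 act_tape acts ts)
      else (s, ts))"

text \<open>The symbols of a word occupy the cells \<open>0, 1, 2, \<dots>\<close>; all other cells are blank.\<close>

definition contents :: "nat list \<Rightarrow> int \<Rightarrow> nat" where
  "contents w i = (if 0 \<le> i \<and> nat i < length w then w ! nat i else 0)"

definition initial_config :: "machine \<Rightarrow> nat list \<Rightarrow> config" where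
  "initial_config M w = (0, (contents w, 0) # replicate (num_tapes M - 1) (contents [], 0))"

definition bit_symbol :: "bool \<Rightarrow> nat" where
  "bit_symbol b = (if b then 3 else 2)"

text \<open>A tuple of bit strings is written on the tape with a separator after each component.\<close>

definition encode :: "bool list list \<Rightarrow> nat list" where
  "encode ws = concat (map (\<lambda>w. map bit_symbol w @ [1]) ws)"

definition polytime :: "(bool list list \<Rightarrow> bool list) \<Rightarrow> bool" where
  "polytime f \<longleftrightarrow>
     (\<exists>M (p :: nat poly). turing_machine M \<and>
        (\<forall>ws. \<exists>ts. (step M ^^ poly p (length (encode ws))) (initial_config M (encode ws))
                     = (num_states M, ts) \<and>
                   fst (ts ! 1) = contents (map bit_symbol (f ws))))"

definition polytime_predicate :: "(bool list list \<Rightarrow> bool) \<Rightarrow> bool" where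
  "polytime_predicate V \<longleftrightarrow> polytime (\<lambda>ws. [V ws])"

definition polynomially_bounded :: "(nat \<Rightarrow> nat) \<Rightarrow> bool" where
  "polynomially_bounded k \<longleftrightarrow> (\<exists>p :: nat poly. \<forall>n. k n \<le> poly p n)"

text \<open>\<open>1\<^sup>n \<mapsto> 1\<^bsup>k(n)\<^esup>\<close> is computable in polynomial time.\<close>

definition unary_polytime :: "(nat \<Rightarrow> nat) \<Rightarrow> bool" where
  "unary_polytime k \<longleftrightarrow>
     (\<exists>f. polytime f \<and> (\<forall>n. f [replicate n True] = replicate (k n) True))"

definition bitstrings :: "nat \<Rightarrow> bool list set" where
  "bitstrings m = {w. length w = m}"

definition strategies :: "nat \<Rightarrow> nat \<Rightarrow> (bool list \<Rightarrow> bool list) list set" where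
  "strategies k m = {bs. length bs = k \<and> set bs \<subseteq> (bitstrings m \<rightarrow> bitstrings m)}"

text \<open>
  The questions \<open>ys\<close> are \<open>k\<close> independent uniform strings of length \<open>m\<close>. The probabilistic verifier
  is a deterministic predicate that receives its own coin tosses \<open>r\<close>, a uniform string of
  length \<open>l\<close>, as a last argument; they are independent of the questions and unknown to the provers.
\<close>

definition accept_prob ::
    "(bool list list \<Rightarrow> bool) \<Rightarrow> bool list \<Rightarrow> nat \<Rightarrow> nat \<Rightarrow> (bool list \<Rightarrow> bool list) list \<Rightarrow> real" where
  "accept_prob V x m l bs =
     measure_pmf.prob
       (pair_pmf (replicate_pmf (length bs) (pmf_of_set (bitstrings m))) (pmf_of_set (bitstrings l)))
       {(ys, r). V (x # ys @ map2 (\<lambda>b y. b y) bs ys @ [r])}"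

definition AM_provers :: "(nat \<Rightarrow> nat) \<Rightarrow> bool list set set" where
  "AM_provers k =
     {L. \<exists>(q :: nat poly) (c :: nat poly) V. polytime_predicate V \<and>
        (\<forall>x. let n = length x in
           (x \<in> L \<longrightarrow>
              (\<exists>bs \<in> strategies (k n) (poly q n). accept_prob V x (poly q n) (poly c n) bs \<ge> 2 / 3)) \<and>
           (x \<notin> L \<longrightarrow>
              (\<forall>bs \<in> strategies (k n) (poly q n). accept_prob V x (poly q n) (poly c n) bs \<le> 1 / 3)))}"

definition AM :: "bool list set set" where
  "AM = AM_provers (\<lambda>n. 1)"

end

theory Submission
  imports Defs
begin

text \<open>
  Arthur sends a whole block of independent questions for each of the \<open>k\<close> provers to a single
  Merlin, who answers all of them. Arthur's private coins then pick one question of each block, and the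
  original verifier is run on the picked questions and answers; three independent rounds are
  decided by majority. An honest Merlin applies the strategies of the \<open>k\<close> provers to each
  question separately.

  For soundness, fix the blocks. The provers can be replaced one after the other, at a small loss each,
  by a best response to a short list of sampled moves of the others. So up to a small error Merlin
  uses a strategy from a small net which does not depend on the blocks. The value of a fixed
  strategy on random blocks is concentrated around its value in the original game by the method of
  bounded differences, and a union bound over the net shows that no answers of Merlin do
  much better than independent provers.

  The new verifier is a structured multi-tape program that is compiled to a single machine; a given
  machine is run inside it by a loop that keeps its state on a tape. If only the first of \<open>k'\<close>
  provers is used, the same construction turns \<open>k\<close> provers into \<open>k'\<close> provers, so it gives both
  inclusions.
\<close>

section \<open>Programs on head-relative tapes and their compilation\<close>

text \<open>Merlin sees all questions at once, so his answers may be correlated across the provers.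
  What he cannot do is let the answer to a record depend on which records are picked from the other
  blocks: one answer per record has to serve every combination of picks. For fixed blocks a round is
  therefore again a game of \<open>k\<close> provers, whose questions are positions in the blocks. A
  union bound over all strategies of the provers would be useless: there are doubly exponentially
  many of them, while a block has polynomially many records. A best response to sampled moves is
  determined by the sample and the question alone, which brings the number of strategies down to 2
  to a polynomial. All errors are measured in expectation, through exponential moments rather than
  tail probabilities, so that they simply add up. They lift the soundness bound above 1 / 3, which
  is why a single round is not enough; completeness suffers no such loss.\<close>

type_synonym rtape = "int \<Rightarrow> nat"

text \<open>Actions and tests are HOL functions of the symbols under the heads, and tapes are
  indexed by all of \<open>nat\<close>; \<open>wf_com\<close> cuts this down to a finite machine.
  Programs can thus be verified before the number of tapes and the alphabet are fixed.\<close>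

datatype com =
    Act "(nat \<Rightarrow> nat) \<Rightarrow> nat \<Rightarrow> nat \<times> move"
  | Seq com com  (infixr ";;" 60)
  | Cond nat "nat \<Rightarrow> bool" com com
  | Loop nat "nat \<Rightarrow> bool" com

text \<open>The head stays at cell 0 and the tape is shifted instead. Forgetting the absolute
  position lets a tape used as a stack be described by \<open>contents\<close> of the stack alone,
  wherever its top has wandered.\<close>

definition rel_act :: "nat \<times> move \<Rightarrow> rtape \<Rightarrow> rtape" where
  "rel_act am f = (\<lambda>p. (f(0 := fst am)) (p + move_head (snd am) 0))"

text \<open>The costs are those of the compiled code: a test is one jump, and a then-branch or a
  loop body is followed by a second one.\<close>

inductive run :: "com \<Rightarrow> (nat \<Rightarrow> rtape) \<Rightarrow> nat \<Rightarrow> (nat \<Rightarrow> rtape) \<Rightarrow> bool" where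
  run_Act: "run (Act g) ts 1 (\<lambda>i. rel_act (g (\<lambda>j. ts j 0) i) (ts i))"
| run_Seq: "run c ts t ts' \<Longrightarrow> run d ts' t' ts'' \<Longrightarrow> run (c ;; d) ts (t + t') ts''"
| run_CondT: "P (ts i 0) \<Longrightarrow> run c ts t ts' \<Longrightarrow> run (Cond i P c d) ts (t + 2) ts'"
| run_CondF: "\<not> P (ts i 0) \<Longrightarrow> run d ts t ts' \<Longrightarrow> run (Cond i P c d) ts (t + 1) ts'"
| run_LoopT: "P (ts i 0) \<Longrightarrow> run c ts t ts' \<Longrightarrow> run (Loop i P c) ts' t' ts'' \<Longrightarrow>
    run (Loop i P c) ts (t + t' + 2) ts''"
| run_LoopF: "\<not> P (ts i 0) \<Longrightarrow> run (Loop i P c) ts 1 ts"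

type_synonym instr = "(nat \<Rightarrow> nat) \<Rightarrow> nat \<times> (nat \<Rightarrow> nat \<times> move)"

definition jump :: "((nat \<Rightarrow> nat) \<Rightarrow> nat) \<Rightarrow> instr" where
  "jump s rd = (s rd, \<lambda>i. (rd i, Stay))"

fun code_size :: "com \<Rightarrow> nat" where
  "code_size (Act g) = 1"
| "code_size (c ;; d) = code_size c + code_size d"
| "code_size (Cond i P c d) = code_size c + code_size d + 2"
| "code_size (Loop i P c) = code_size c + 2"

fun code :: "nat \<Rightarrow> com \<Rightarrow> instr list" where
  "code b (Act g) = [\<lambda>rd. (b + 1, g rd)]"
| "code b (c ;; d) = code b c @ code (b + code_size c) d"
| "code b (Cond i P c d) =
     jump (\<lambda>rd. if P (rd i) then b + 1 else b + 2 + code_size c) # code (b + 1) c @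
     jump (\<lambda>_. b + 2 + code_size c + code_size d) # code (b + 2 + code_size c) d"
| "code b (Loop i P c) =
     jump (\<lambda>rd. if P (rd i) then b + 1 else b + 2 + code_size c) # code (b + 1) c @
     [jump (\<lambda>_. b)]"

lemma length_code [simp]: "length (code b c) = code_size c"
  by (induction b c rule: code.induct) auto

text \<open>The head of tape 1 must never move: \<open>polytime\<close> asks for the output at
  absolute cells, and the head-relative view determines these only if that head is still at its
  initial position 0.\<close>

fun wf_com :: "nat \<Rightarrow> nat \<Rightarrow> com \<Rightarrow> bool" where
  "wf_com N G (Act g) \<longleftrightarrow>
     (\<forall>rd rd'. (\<forall>j<N. rd j = rd' j) \<longrightarrow> (\<forall>i<N. g rd i = g rd' i)) \<and>
     (\<forall>rd. (\<forall>j<N. rd j < G) \<longrightarrow> (\<forall>i<N. fst (g rd i) < G)) \<and>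
     (\<forall>rd. snd (g rd 1) = Stay)"
| "wf_com N G (c ;; d) \<longleftrightarrow> wf_com N G c \<and> wf_com N G d"
| "wf_com N G (Cond i P c d) \<longleftrightarrow> i < N \<and> wf_com N G c \<and> wf_com N G d"
| "wf_com N G (Loop i P c) \<longleftrightarrow> i < N \<and> wf_com N G c"

definition code_machine :: "nat \<Rightarrow> nat \<Rightarrow> instr list \<Rightarrow> machine" where
  "code_machine N G is = \<lparr>num_tapes = N, num_symbols = G, num_states = length is,
     trans = (\<lambda>s as. let (s', g) = (is ! s) (\<lambda>i. if i < N then as ! i else 0)
                     in (s', map g [0..<N]))\<rparr>"

lemma code_machine_simps [simp]:
  "num_tapes (code_machine N G is) = N"
  "num_symbols (code_machine N G is) = G"
  "num_states (code_machine N G is) = length is"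
  by (simp_all add: code_machine_def)

definition represents :: "nat \<Rightarrow> tape list \<Rightarrow> (nat \<Rightarrow> rtape) \<Rightarrow> bool" where
  "represents N cs ts \<longleftrightarrow> length cs = N \<and> 1 < N \<and> snd (cs ! 1) = 0 \<and>
     (\<forall>i<N. ts i = (\<lambda>p. fst (cs ! i) (p + snd (cs ! i))))"

definition segment :: "'a list \<Rightarrow> nat \<Rightarrow> 'a list \<Rightarrow> bool" where
  "segment xs b ys \<longleftrightarrow> (\<exists>us vs. xs = us @ ys @ vs \<and> length us = b)"

lemma segment_nth: "segment xs b ys \<Longrightarrow> j < length ys \<Longrightarrow> b + j < length xs \<and> xs ! (b + j) = ys ! j"
  by (auto simp: segment_def nth_append)

lemma segment_appendI1: "segment xs b (ys @ zs) \<Longrightarrow> segment xs b ys"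
  unfolding segment_def by auto

lemma segment_appendI2: "segment xs b (ys @ zs) \<Longrightarrow> b' = b + length ys \<Longrightarrow> segment xs b' zs"
  unfolding segment_def by (metis append.assoc length_append)

lemma segment_ConsI: "segment xs b (y # zs) \<Longrightarrow> segment xs (b + 1) zs"
  using segment_appendI2 [of xs b "[y]" zs] by simp

lemma act_tape_rel:
  "(\<lambda>p. fst (act_tape am c) (p + snd (act_tape am c))) = rel_act am (\<lambda>p. fst c (p + snd c))"
proof -
  obtain a m f h where "am = (a, m)" "c = (f, h)" by (cases am, cases c) auto
  then show ?thesis
    by (cases m) (auto simp: rel_act_def fun_eq_iff algebra_simps)
qed

lemma read_tape_eq: "read_tape c = fst c (snd c)"
  by (cases c) auto

lemma step_code_machine:
  assumes "represents N cs ts" "b < length is"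
    and "\<And>rd. (is ! b) rd = (s' rd, g rd)"
    and "\<And>rd rd'. (\<forall>j<N. rd j = rd' j) \<Longrightarrow> s' rd = s' rd' \<and> (\<forall>i<N. g rd i = g rd' i)"
    and "\<And>rd. snd (g rd 1) = Stay"
  shows "\<exists>cs'. step (code_machine N G is) (b, cs) = (s' (\<lambda>j. ts j 0), cs') \<and>
     represents N cs' (\<lambda>i. rel_act (g (\<lambda>j. ts j 0) i) (ts i))"
proof -
  define rd where "rd = (\<lambda>i. if i < N then map read_tape cs ! i else 0)"
  have len: "length cs = N" and N: "1 < N" and z: "snd (cs ! 1) = 0"
    and r: "\<And>i. i < N \<Longrightarrow> ts i = (\<lambda>p. fst (cs ! i) (p + snd (cs ! i)))"
    using assms(1) by (auto simp: represents_def)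
  have rd: "\<forall>j<N. rd j = ts j 0"
    using len r by (auto simp: rd_def read_tape_eq)
  define cs' where "cs' = map2 act_tape (map (g rd) [0..<N]) cs"
  have st: "step (code_machine N G is) (b, cs) = (s' rd, cs')"
    using assms(2,3) by (simp add: code_machine_def rd_def cs'_def)
  have nth: "cs' ! i = act_tape (g rd i) (cs ! i)" if "i < N" for i
    using that len by (simp add: cs'_def)
  have g: "g rd i = g (\<lambda>j. ts j 0) i" if "i < N" for i
    using assms(4)[OF rd] that by auto
  have s: "s' rd = s' (\<lambda>j. ts j 0)" using assms(4)[OF rd] by auto
  have "represents N cs' (\<lambda>i. rel_act (g (\<lambda>j. ts j 0) i) (ts i))"
    unfolding represents_def
  proof (intro conjI allI impI)
    show "length cs' = N" using len by (simp add: cs'_def)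
    show "1 < N" by fact
    show "snd (cs' ! 1) = 0"
      using assms(5)[of rd] z nth[OF N] by (cases "g rd 1"; cases "cs ! 1") auto
    fix i assume i: "i < N"
    show "rel_act (g (\<lambda>j. ts j 0) i) (ts i) = (\<lambda>p. fst (cs' ! i) (p + snd (cs' ! i)))"
      using act_tape_rel[of "g rd i" "cs ! i"] nth[OF i] g[OF i] r[OF i] by simp
  qed
  then show ?thesis using st s by auto
qed

lemma rel_act_keep: "rel_act (f 0, Stay) f = f"
  by (auto simp: rel_act_def fun_eq_iff)

lemma step_jump:
  assumes "represents N cs ts" "segment is b (jump s # js)"
    and "\<And>rd rd'. (\<forall>j<N. rd j = rd' j) \<Longrightarrow> s rd = s rd'"
  shows "\<exists>cs'. step (code_machine N G is) (b, cs) = (s (\<lambda>j. ts j 0), cs') \<and> represents N cs' ts"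
proof -
  have b: "b < length is" "is ! b = jump s" using segment_nth[OF assms(2), of 0] by auto
  have "\<exists>cs'. step (code_machine N G is) (b, cs) = (s (\<lambda>j. ts j 0), cs') \<and>
     represents N cs' (\<lambda>i. rel_act ((\<lambda>rd i. (rd i, Stay)) (\<lambda>j. ts j 0) i) (ts i))"
    by (rule step_code_machine[OF assms(1) b(1)]) (use b assms(3) in \<open>auto simp: jump_def\<close>)
  then show ?thesis by (simp add: rel_act_keep)
qed

text \<open>Control leaves the code at the address just behind it, after exactly the number of steps
  counted by \<open>run\<close>. For the whole program, placed at address 0, this address is the
  halting state.\<close>

lemma run_code_machine:
  assumes "run c ts t ts'" "wf_com N G c" "represents N cs ts" "segment is b (code b c)"
  shows "\<exists>cs'. (step (code_machine N G is) ^^ t) (b, cs) = (b + code_size c, cs') \<and>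
     represents N cs' ts'"
  using assms
proof (induction arbitrary: cs b rule: run.induct)
  case (run_Act g ts)
  have b: "b < length is" "is ! b = (\<lambda>rd. (b + 1, g rd))"
    using segment_nth[OF run_Act(3), of 0] by auto
  have "\<exists>cs'. step (code_machine N G is) (b, cs) = ((\<lambda>_. b + 1) (\<lambda>j. ts j 0), cs') \<and>
     represents N cs' (\<lambda>i. rel_act (g (\<lambda>j. ts j 0) i) (ts i))"
    by (rule step_code_machine[OF run_Act(2) b(1)]) (use b run_Act(1) in auto)
  then show ?case by simp
next
  case (run_Seq c ts t ts' d t' ts'')
  from run_Seq.IH(1)[of cs b] run_Seq.prems obtain cs1 where
    1: "(step (code_machine N G is) ^^ t) (b, cs) = (b + code_size c, cs1)" "represents N cs1 ts'"
    by (auto dest: segment_appendI1)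
  have "segment is (b + code_size c) (code (b + code_size c) d)"
    using run_Seq.prems(3) by (auto intro: segment_appendI2)
  with run_Seq.IH(2)[of cs1 "b + code_size c"] run_Seq.prems(1) 1 obtain cs2 where
    2: "(step (code_machine N G is) ^^ t') (b + code_size c, cs1) = (b + code_size c + code_size d, cs2)"
       "represents N cs2 ts''"
    by auto
  show ?case using 1 2 by (auto simp: add.commute[of t t'] funpow_add algebra_simps)
next
  case (run_CondT P ts i c t ts' d)
  let ?M = "code_machine N G is"
  note seg = run_CondT.prems(3)[simplified]
  from step_jump[OF run_CondT.prems(2) seg, of G] run_CondT.prems(1) run_CondT.hyps obtain cs1 where
    1: "step ?M (b, cs) = (b + 1, cs1)" "represents N cs1 ts" by auto
  have seg1: "segment is (b + 1) (code (b + 1) c @ jump (\<lambda>_. b + 2 + code_size c + code_size d) #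
      code (b + 2 + code_size c) d)"
    using segment_ConsI[OF seg] by simp
  from run_CondT.IH[of cs1 "b + 1"] 1 run_CondT.prems(1) segment_appendI1[OF seg1] obtain cs2 where
    2: "(step ?M ^^ t) (b + 1, cs1) = (b + 1 + code_size c, cs2)" "represents N cs2 ts'"
    by auto
  have seg2: "segment is (b + 1 + code_size c) (jump (\<lambda>_. b + 2 + code_size c + code_size d) #
      code (b + 2 + code_size c) d)"
    using segment_appendI2[OF seg1] by simp
  from step_jump[OF 2(2) seg2, of G] obtain cs3 where
    3: "step ?M (b + 1 + code_size c, cs2) = (b + 2 + code_size c + code_size d, cs3)"
       "represents N cs3 ts'" by auto
  have "(step ?M ^^ (t + 2)) (b, cs) = step ?M ((step ?M ^^ t) (step ?M (b, cs)))"
    by (simp add: funpow_swap1)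
  then show ?case using 1 2 3 by auto
next
  case (run_CondF P ts i d t ts' c)
  let ?M = "code_machine N G is"
  note seg = run_CondF.prems(3)[simplified]
  from step_jump[OF run_CondF.prems(2) seg, of G] run_CondF.prems(1) run_CondF.hyps obtain cs1 where
    1: "step ?M (b, cs) = (b + 2 + code_size c, cs1)" "represents N cs1 ts" by auto
  have seg1: "segment is (b + 1) (code (b + 1) c @ jump (\<lambda>_. b + 2 + code_size c + code_size d) #
      code (b + 2 + code_size c) d)"
    using segment_ConsI[OF seg] by simp
  have seg2: "segment is (b + 1 + code_size c) (jump (\<lambda>_. b + 2 + code_size c + code_size d) #
      code (b + 2 + code_size c) d)"
    using segment_appendI2[OF seg1] by simp
  have seg3: "segment is (b + 2 + code_size c) (code (b + 2 + code_size c) d)"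
    using segment_ConsI[OF seg2] by simp
  from run_CondF.IH[of cs1 "b + 2 + code_size c"] 1 run_CondF.prems(1) seg3 obtain cs2 where
    2: "(step ?M ^^ t) (b + 2 + code_size c, cs1) = (b + 2 + code_size c + code_size d, cs2)"
       "represents N cs2 ts'"
    by auto
  have "(step ?M ^^ (t + 1)) (b, cs) = ((step ?M ^^ t) (step ?M (b, cs)))"
    by (simp add: funpow_swap1)
  then show ?case using 1 2 by (auto simp: algebra_simps)
next
  case (run_LoopT P ts i c t ts' t' ts'')
  let ?M = "code_machine N G is"
  note seg = run_LoopT.prems(3)[simplified]
  from step_jump[OF run_LoopT.prems(2) seg, of G] run_LoopT.prems(1) run_LoopT.hyps obtain cs1 where
    1: "step ?M (b, cs) = (b + 1, cs1)" "represents N cs1 ts" by auto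
  have seg1: "segment is (b + 1) (code (b + 1) c @ [jump (\<lambda>_. b)])"
    using segment_ConsI[OF seg] by simp
  from run_LoopT.IH(1)[of cs1 "b + 1"] 1 run_LoopT.prems(1) segment_appendI1[OF seg1] obtain cs2 where
    2: "(step ?M ^^ t) (b + 1, cs1) = (b + 1 + code_size c, cs2)" "represents N cs2 ts'"
    by auto
  have seg2: "segment is (b + 1 + code_size c) [jump (\<lambda>_. b)]"
    using segment_appendI2[OF seg1] by simp
  from step_jump[OF 2(2) seg2, of G] obtain cs3 where
    3: "step ?M (b + 1 + code_size c, cs2) = (b, cs3)" "represents N cs3 ts'" by auto
  from run_LoopT.IH(2)[OF run_LoopT.prems(1) 3(2) run_LoopT.prems(3)] obtain cs4 where
    4: "(step ?M ^^ t') (b, cs3) = (b + code_size (Loop i P c), cs4)" "represents N cs4 ts''"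
    by auto
  have "t + t' + 2 = t' + (1 + (t + 1))" by simp
  then have "(step ?M ^^ (t + t' + 2)) (b, cs) =
     (step ?M ^^ t') ((step ?M ^^ 1) ((step ?M ^^ t) ((step ?M ^^ 1) (b, cs))))"
    by (simp only: funpow_add comp_apply)
  then show ?case using 1 2 3 4 by auto
next
  case (run_LoopF P ts i c)
  let ?M = "code_machine N G is"
  note seg = run_LoopF.prems(3)[simplified]
  from step_jump[OF run_LoopF.prems(2) seg, of G] run_LoopF.prems(1) run_LoopF.hyps show ?case
    by auto
qed

section \<open>From compiled programs to polynomial-time functions\<close>

lemma code_targets:
  assumes "j < code_size c"
  shows "fst ((code b c ! j) rd) \<le> b + code_size c"
  using assms
proof (induction b c arbitrary: j rule: code.induct)
  case (1 b g) then show ?case by simp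
next
  case (2 b c d)
  show ?case
  proof (cases "j < code_size c")
    case True with 2(1)[of j] show ?thesis by (simp add: nth_append)
  next
    case False with 2(2)[of "j - code_size c"] 2(3) show ?thesis by (simp add: nth_append algebra_simps)
  qed
next
  case (3 b i P c d)
  consider "j = 0" | "0 < j" "j < 1 + code_size c" | "j = 1 + code_size c" | "1 + code_size c < j" by linarith
  then show ?case
  proof cases
    case 1 then show ?thesis by (simp add: jump_def)
  next
    case 2
    then have "j - 1 < code_size c" by simp
    from 3(1)[OF this] 2 this show ?thesis by (simp add: nth_append nth_Cons')
  next
    case 3 then show ?thesis by (simp add: nth_append nth_Cons' jump_def)
  next
    case 4
    then have "j - 2 - code_size c < code_size d" "\<not> j - 1 < code_size c" using 3(3) by simp_all
    from 3(2)[OF this(1)] this(2) 4 show ?thesis by (simp add: nth_append nth_Cons' algebra_simps numeral_2_eq_2)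
  qed
next
  case (4 b i P c)
  consider "j = 0" | "0 < j" "j < 1 + code_size c" | "j = 1 + code_size c" using 4(2) by fastforce
  then show ?case
  proof cases
    case 1 then show ?thesis by (simp add: jump_def)
  next
    case 2
    then have "j - 1 < code_size c" by simp
    from 4(1)[OF this] 2 this show ?thesis by (simp add: nth_append nth_Cons')
  next
    case 3 then show ?thesis by (simp add: nth_append nth_Cons' jump_def)
  qed
qed

lemma code_symbols:
  assumes "wf_com N G c" "inst \<in> set (code b c)" "\<forall>j<N. rd j < G" "i < N"
  shows "fst (snd (inst rd) i) < G"
  using assms by (induction b c rule: code.induct) (auto simp: jump_def)

lemma turing_machine_code:
  assumes "wf_com N G c" "2 \<le> N" "4 \<le> G"
  shows "turing_machine (code_machine N G (code 0 c))"
  unfolding turing_machine_def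
proof (intro conjI allI impI)
  fix s as
  assume s: "s < num_states (code_machine N G (code 0 c))"
    and as: "length as = num_tapes (code_machine N G (code 0 c)) \<and>
      set as \<subseteq> {..<num_symbols (code_machine N G (code 0 c))}"
  define rd where "rd = (\<lambda>i. if i < N then as ! i else 0)"
  have tr: "trans (code_machine N G (code 0 c)) s as =
      (fst ((code 0 c ! s) rd), map (snd ((code 0 c ! s) rd)) [0..<N])"
    by (simp add: code_machine_def rd_def split_beta)
  have rd: "\<forall>j<N. rd j < G" using as by (auto simp: rd_def subset_iff)
  show "fst (trans (code_machine N G (code 0 c)) s as) \<le> num_states (code_machine N G (code 0 c))"
    using code_targets[of s c 0 rd] s by (simp add: tr)
  show "length (snd (trans (code_machine N G (code 0 c)) s as)) = num_tapes (code_machine N G (code 0 c))"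
    by (simp add: tr)
  show "fst ` set (snd (trans (code_machine N G (code 0 c)) s as)) \<subseteq>
      {..<num_symbols (code_machine N G (code 0 c))}"
    using code_symbols[OF assms(1) nth_mem[of s "code 0 c"] rd] s by (auto simp: tr)
qed (use assms in auto)

lemma step_halted: "fst cf = num_states M \<Longrightarrow> (step M ^^ t) cf = cf"
  by (induction t) (cases cf; simp)+

definition input_tapes :: "nat list \<Rightarrow> nat \<Rightarrow> rtape" where
  "input_tapes w i = (if i = 0 then contents w else contents [])"

lemma polytime_run:
  fixes p :: "nat poly"
  assumes "wf_com N G c" "2 \<le> N" "4 \<le> G"
    and "\<And>ws. \<exists>t ts. run c (input_tapes (encode ws)) t ts \<and> t \<le> poly p (length (encode ws)) \<and>
           ts 1 = contents (map bit_symbol (f ws))"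
  shows "polytime f"
proof -
  define M where "M = code_machine N G (code 0 c)"
  have ns: "num_states M = code_size c" and nt: "num_tapes M = N" by (simp_all add: M_def)
  have "\<exists>ts. (step M ^^ poly p (length (encode ws))) (initial_config M (encode ws)) = (num_states M, ts) \<and>
          fst (ts ! 1) = contents (map bit_symbol (f ws))" for ws
  proof -
    define w where "w = encode ws"
    obtain t ts where r: "run c (input_tapes w) t ts" and t: "t \<le> poly p (length w)"
      and o: "ts 1 = contents (map bit_symbol (f ws))" using assms(4)[of ws] unfolding w_def by blast
    define cs where "cs = (contents w, 0::int) # replicate (N - 1) (contents [], 0)"
    have rep: "represents N cs (input_tapes w)"
      using assms(2) by (auto simp: represents_def cs_def input_tapes_def nth_Cons')
    have seg: "segment (code 0 c) 0 (code 0 c)" unfolding segment_def by force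
    from run_code_machine[OF r assms(1) rep seg] obtain cs' where
      1: "(step M ^^ t) (0, cs) = (code_size c, cs')" "represents N cs' ts"
      unfolding M_def by auto
    have ini: "initial_config M w = (0, cs)" by (simp add: initial_config_def nt cs_def)
    \<comment> \<open>\<open>polytime\<close> prescribes the exact number of steps; a machine that
      halts earlier idles in its halting state for the rest.\<close>
    have "(step M ^^ poly p (length w)) (0, cs) = (step M ^^ (poly p (length w) - t)) ((step M ^^ t) (0, cs))"
      using t by (metis comp_apply funpow_add le_add_diff_inverse2)
    also have "\<dots> = (num_states M, cs')" using 1 by (simp add: step_halted ns)
    finally have "(step M ^^ poly p (length w)) (initial_config M w) = (num_states M, cs')" using ini by simp
    moreover have "fst (cs' ! 1) = contents (map bit_symbol (f ws))"
      using 1(2) o unfolding represents_def by simp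
    ultimately show ?thesis unfolding w_def by blast
  qed
  then show ?thesis unfolding polytime_def
    using turing_machine_code[OF assms(1-3)] M_def by blast
qed

section \<open>Stack operations\<close>

text \<open>Upper bounds replace exact step counts, so that branches of different length and all
  passes of a loop can share one bound.\<close>

definition runs :: "com \<Rightarrow> (nat \<Rightarrow> rtape) \<Rightarrow> nat \<Rightarrow> (nat \<Rightarrow> rtape) \<Rightarrow> bool" where
  "runs c ts n ts' \<longleftrightarrow> (\<exists>t\<le>n. run c ts t ts')"

lemma runs_mono: "runs c ts n ts' \<Longrightarrow> n \<le> n' \<Longrightarrow> runs c ts n' ts'"
  unfolding runs_def by (meson order_trans)

lemma runs_conv: "runs c ts n ts' \<Longrightarrow> ts' = ts'' \<Longrightarrow> n \<le> n' \<Longrightarrow> runs c ts n' ts''"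
  using runs_mono by blast

lemma runs_Act: "runs (Act g) ts 1 (\<lambda>i. rel_act (g (\<lambda>j. ts j 0) i) (ts i))"
  unfolding runs_def using run_Act by blast

lemma runs_Seq: "runs c ts n ts' \<Longrightarrow> runs d ts' n' ts'' \<Longrightarrow> runs (c ;; d) ts (n + n') ts''"
  unfolding runs_def using run_Seq add_mono by blast

lemma runs_Cond:
  assumes "P (ts i 0) \<Longrightarrow> runs c ts n ts'" "\<not> P (ts i 0) \<Longrightarrow> runs d ts n ts'"
  shows "runs (Cond i P c d) ts (n + 2) ts'"
proof (cases "P (ts i 0)")
  case True
  with assms(1) obtain t where "t \<le> n" "run c ts t ts'" unfolding runs_def by blast
  with run_CondT[where P = P and i = i and ts = ts, OF True] show ?thesis unfolding runs_def by (meson add_le_mono1)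
next
  case False
  with assms(2) obtain t where t: "t \<le> n" "run d ts t ts'" unfolding runs_def by blast
  have "t + 1 \<le> n + 2" using t(1) by simp
  with run_CondF[where P = P and i = i and ts = ts, OF False t(2)] show ?thesis unfolding runs_def by blast
qed

text \<open>The invariant is an explicit sequence \<open>S\<close> of tape contents, one for each
  pass, so the result of a loop is computed rather than described by a predicate.\<close>

lemma runs_Loop:
  assumes "\<And>j. j < n \<Longrightarrow> P (S j i 0)" "\<not> P (S n i 0)"
    and "\<And>j. j < n \<Longrightarrow> runs c (S j) b (S (Suc j))"
  shows "runs (Loop i P c) (S 0) (n * (b + 2) + 1) (S n)"
  using assms
proof (induction n arbitrary: S)
  case 0
  then show ?case unfolding runs_def using run_LoopF[where P = P and ts = "S 0" and i = i and c = c]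
    by (intro exI[of _ 1]) simp
next
  case (Suc n)
  have "runs (Loop i P c) (S (Suc 0)) (n * (b + 2) + 1) (S (Suc n))"
    by (rule Suc.IH[of "\<lambda>j. S (Suc j)"]) (use Suc.prems in auto)
  then obtain t where t: "t \<le> n * (b + 2) + 1" "run (Loop i P c) (S (Suc 0)) t (S (Suc n))"
    unfolding runs_def by blast
  obtain t' where t': "t' \<le> b" "run c (S 0) t' (S (Suc 0))"
    using Suc.prems(3)[of 0] unfolding runs_def by auto
  have "run (Loop i P c) (S 0) (t' + t + 2) (S (Suc n))"
    by (rule run_LoopT[where P = P, OF _ t'(2) t(2)]) (use Suc.prems(1) in auto)
  moreover have "t' + t + 2 \<le> Suc n * (b + 2) + 1" using t t' by simp
  ultimately show ?case unfolding runs_def by blast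
qed

definition SKIP :: com where
  "SKIP = Act (\<lambda>rd j. (rd j, Stay))"

definition ACT :: "nat \<Rightarrow> (nat \<Rightarrow> nat \<times> move) \<Rightarrow> com" where
  "ACT i g = Act (\<lambda>rd j. if j = i then g (rd i) else (rd j, Stay))"

text \<open>A stack has its top under the head and extends to the right. Overwriting the popped
  symbol by a blank makes the tape again equal to \<open>contents\<close> of what remains, with
  nothing left behind to the left of the head.\<close>

definition POP :: "nat \<Rightarrow> com" where
  "POP i = ACT i (\<lambda>_. (0, MoveRight))"

definition PUSH :: "nat \<Rightarrow> nat \<Rightarrow> com" where
  "PUSH i a = ACT i (\<lambda>s. (s, MoveLeft)) ;; ACT i (\<lambda>_. (a, Stay))"

definition XFER :: "nat \<Rightarrow> nat \<Rightarrow> com" where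
  "XFER i j = ACT j (\<lambda>s. (s, MoveLeft)) ;;
     Act (\<lambda>rd l. if l = j then (rd i, Stay) else if l = i then (0, MoveRight) else (rd l, Stay))"

definition DUP :: "nat \<Rightarrow> nat \<Rightarrow> nat \<Rightarrow> com" where
  "DUP i j k = (ACT k (\<lambda>s. (s, MoveLeft)) ;;
     Act (\<lambda>rd l. if l = k then (rd i, Stay) else (rd l, Stay))) ;; XFER i j"

definition MOVE :: "nat \<Rightarrow> nat \<Rightarrow> com" where
  "MOVE i j = Loop i (\<lambda>s. s \<noteq> 0) (XFER i j)"

text \<open>The unary counter is parked on \<open>i'\<close> while it is used up and is moved back
  at the end, so the same number can drive many loops.\<close>

definition FOR :: "nat \<Rightarrow> nat \<Rightarrow> com \<Rightarrow> com" where
  "FOR i i' c = Loop i (\<lambda>s. s \<noteq> 0) (XFER i i' ;; c) ;; MOVE i' i"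

text \<open>The test for a blank makes the command agree with \<open>take\<close> and
  \<open>drop\<close> also when the stack is shorter than the counter, which happens on malformed
  inputs.\<close>

definition TAKE :: "nat \<Rightarrow> nat \<Rightarrow> nat \<Rightarrow> nat \<Rightarrow> com" where
  "TAKE c c' i j = FOR c c' (Cond i (\<lambda>s. s \<noteq> 0) (XFER i j) SKIP)"

lemma wf_macros [simp]:
  "wf_com N G SKIP"
  "i \<noteq> 1 \<Longrightarrow> 0 < G \<Longrightarrow> wf_com N G (POP i)"
  "i \<noteq> 1 \<Longrightarrow> a < G \<Longrightarrow> wf_com N G (PUSH i a)"
  "i \<noteq> 1 \<Longrightarrow> j \<noteq> 1 \<Longrightarrow> i < N \<Longrightarrow> 0 < G \<Longrightarrow> wf_com N G (XFER i j)"
  "i \<noteq> 1 \<Longrightarrow> j \<noteq> 1 \<Longrightarrow> k \<noteq> 1 \<Longrightarrow> i < N \<Longrightarrow> 0 < G \<Longrightarrow> wf_com N G (DUP i j k)"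
  "i \<noteq> 1 \<Longrightarrow> j \<noteq> 1 \<Longrightarrow> i < N \<Longrightarrow> 0 < G \<Longrightarrow> wf_com N G (MOVE i j)"
  "i \<noteq> 1 \<Longrightarrow> j \<noteq> 1 \<Longrightarrow> i < N \<Longrightarrow> j < N \<Longrightarrow> 0 < G \<Longrightarrow> wf_com N G c \<Longrightarrow> wf_com N G (FOR i j c)"
  by (auto simp: SKIP_def ACT_def POP_def PUSH_def XFER_def DUP_def MOVE_def FOR_def)

lemma wf_TAKE [simp]:
  "c \<noteq> 1 \<Longrightarrow> c' \<noteq> 1 \<Longrightarrow> i \<noteq> 1 \<Longrightarrow> j \<noteq> 1 \<Longrightarrow> c < N \<Longrightarrow> c' < N \<Longrightarrow> i < N \<Longrightarrow> 0 < G \<Longrightarrow>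
    wf_com N G (TAKE c c' i j)"
  by (simp add: TAKE_def)

lemma contents_head: "contents xs 0 = (if xs = [] then 0 else hd xs)"
  by (cases xs) (auto simp: contents_def)

lemma contents_Nil: "contents [] = (\<lambda>_. 0)"
  by (simp add: contents_def fun_eq_iff)

lemma rel_act_pop: "rel_act (0, MoveRight) (contents xs) = contents (tl xs)"
proof
  fix p show "rel_act (0, MoveRight) (contents xs) p = contents (tl xs) p"
    by (cases "p \<ge> 0"; cases xs) (auto simp: rel_act_def contents_def nat_add_distrib)
qed

lemma rel_act_push: "s = contents xs 0 \<Longrightarrow>
  rel_act (a, Stay) (rel_act (s, MoveLeft) (contents xs)) = contents (a # xs)"
proof
  fix p assume "s = contents xs 0"
  then show "rel_act (a, Stay) (rel_act (s, MoveLeft) (contents xs)) p = contents (a # xs) p"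
    by (cases "p > 0") (auto simp: rel_act_def contents_def nth_Cons' nat_diff_distrib nat_less_iff)
qed

lemma runs_SKIP: "runs SKIP ts 1 ts"
  using runs_Act[of "\<lambda>rd j. (rd j, Stay)" ts] by (simp add: SKIP_def rel_act_keep)

lemma runs_ACT: "runs (ACT i g) ts 1 (ts(i := rel_act (g (ts i 0)) (ts i)))"
  unfolding ACT_def
  by (rule runs_conv[OF runs_Act]) (auto simp: fun_eq_iff rel_act_keep)

lemma runs_POP: "ts i = contents xs \<Longrightarrow> runs (POP i) ts 1 (ts(i := contents (tl xs)))"
  unfolding POP_def by (rule runs_conv[OF runs_ACT]) (auto simp: rel_act_pop)

lemma runs_PUSH: "ts i = contents xs \<Longrightarrow> runs (PUSH i a) ts 2 (ts(i := contents (a # xs)))"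
  unfolding PUSH_def
  by (rule runs_conv[OF runs_Seq[OF runs_ACT runs_ACT]]) (auto simp: rel_act_push)

lemma runs_XFER:
  assumes "ts i = contents (x # xs)" "ts j = contents ys" "i \<noteq> j"
  shows "runs (XFER i j) ts 2 (ts(i := contents xs, j := contents (x # ys)))"
  unfolding XFER_def
  by (rule runs_conv[OF runs_Seq[OF runs_ACT runs_Act]])
     (use assms in \<open>auto intro!: ext simp: rel_act_push rel_act_pop rel_act_keep contents_head\<close>)

lemma runs_DUP:
  assumes "ts i = contents (x # xs)" "ts j = contents ys" "ts k = contents zs" "i \<noteq> j" "i \<noteq> k" "j \<noteq> k"
  shows "runs (DUP i j k) ts 4 (ts(i := contents xs, j := contents (x # ys), k := contents (x # zs)))"
proof -
  have 1: "runs (ACT k (\<lambda>s. (s, MoveLeft)) ;;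
     Act (\<lambda>rd l. if l = k then (rd i, Stay) else (rd l, Stay))) ts 2 (ts(k := contents (x # zs)))"
    by (rule runs_conv[OF runs_Seq[OF runs_ACT runs_Act]])
       (use assms in \<open>auto intro!: ext simp: rel_act_push rel_act_pop rel_act_keep contents_head\<close>)
  have 2: "runs (XFER i j) (ts(k := contents (x # zs))) 2
     ((ts(k := contents (x # zs)))(i := contents xs, j := contents (x # ys)))"
    by (rule runs_XFER) (use assms in auto)
  show ?thesis unfolding DUP_def
    by (rule runs_conv[OF runs_Seq[OF 1 2]]) (use assms in auto)
qed

lemma runs_MOVE:
  assumes "ts i = contents xs" "ts j = contents ys" "i \<noteq> j" "0 \<notin> set xs"
  shows "runs (MOVE i j) ts (4 * length xs + 1) (ts(i := contents [], j := contents (rev xs @ ys)))"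
proof -
  let ?S = "\<lambda>l. ts(i := contents (drop l xs), j := contents (rev (take l xs) @ ys))"
  have "runs (Loop i (\<lambda>s. s \<noteq> 0) (XFER i j)) (?S 0) (length xs * (2 + 2) + 1) (?S (length xs))"
  proof (rule runs_Loop)
    fix l assume l: "l < length xs"
    then have d: "drop l xs = xs ! l # drop (Suc l) xs" by (simp add: Cons_nth_drop_Suc)
    have "xs ! l \<noteq> 0" using assms(4) l by (metis nth_mem)
    then show "?S l i 0 \<noteq> 0" using assms l by (auto simp: contents_head hd_drop_conv_nth)
    show "runs (XFER i j) (?S l) 2 (?S (Suc l))"
      by (rule runs_conv[OF runs_XFER[of _ _ "xs ! l" "drop (Suc l) xs" _ "rev (take l xs) @ ys"]])
         (use assms l d in \<open>auto simp: take_Suc_conv_app_nth\<close>)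
  qed (use assms in \<open>auto simp: contents_head\<close>)
  moreover have "?S 0 = ts" using assms by auto
  ultimately show ?thesis by (simp add: MOVE_def mult.commute)
qed

definition ones :: "nat \<Rightarrow> rtape" where
  "ones n = contents (replicate n 1)"

lemma ones_head: "ones n 0 = (if n = 0 then 0 else 1)"
  by (simp add: ones_def contents_head hd_replicate)

text \<open>The body is assumed correct for arbitrary contents \<open>u\<close> and \<open>v\<close>
  of the two counter tapes. This expresses that it leaves the counter alone, and it keeps the
  counter out of the invariant \<open>S\<close>.\<close>

lemma runs_FOR:
  assumes "\<And>j u v. j < n \<Longrightarrow> runs c ((S j)(i := u, i' := v)) b ((S (Suc j))(i := u, i' := v))"
    and "i \<noteq> i'" "ts = (S 0)(i := ones n, i' := ones 0)"
  shows "runs (FOR i i' c) ts (n * (b + 8) + 2) ((S n)(i := ones n, i' := ones 0))"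
proof -
  let ?S = "\<lambda>j. (S j)(i := ones (n - j), i' := ones j)"
  have 1: "runs (Loop i (\<lambda>s. s \<noteq> 0) (XFER i i' ;; c)) (?S 0) (n * ((2 + b) + 2) + 1) (?S n)"
  proof (rule runs_Loop)
    fix j assume j: "j < n"
    then have e: "n - j = Suc (n - Suc j)" by simp
    show "?S j i 0 \<noteq> 0" using j assms(2) by (auto simp: ones_head)
    have "runs (XFER i i') (?S j) 2 ((S j)(i := ones (n - Suc j), i' := ones (Suc j)))"
      by (rule runs_conv[OF runs_XFER[of _ _ 1 "replicate (n - Suc j) 1" _ "replicate j 1"]])
         (use assms(2) e in \<open>auto simp: ones_def\<close>)
    from runs_Seq[OF this assms(1)[OF j]] show "runs (XFER i i' ;; c) (?S j) (2 + b) (?S (Suc j))"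
      by simp
  qed (use assms(2) in \<open>auto simp: ones_head\<close>)
  have 2: "runs (MOVE i' i) (?S n) (4 * n + 1) ((S n)(i := ones n, i' := ones 0))"
    by (rule runs_conv[OF runs_MOVE[of _ _ "replicate n 1" _ "[]"]])
       (use assms(2) in \<open>auto simp: ones_def\<close>)
  have "ts = ?S 0" using assms(3) by simp
  then show ?thesis unfolding FOR_def
    using runs_conv[OF runs_Seq[OF 1 2], where n' = "n * (b + 8) + 2"] by (simp add: algebra_simps)
qed

lemma runs_TAKE:
  assumes "ts c = ones n" "ts c' = ones 0" "ts i = contents xs" "ts j = contents ys" "0 \<notin> set xs"
    and "distinct [c, c', i, j]"
  shows "runs (TAKE c c' i j) ts (n * 12 + 2)
     (ts(i := contents (drop n xs), j := contents (rev (take n xs) @ ys)))"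
proof -
  let ?S = "\<lambda>l. ts(i := contents (drop l xs), j := contents (rev (take l xs) @ ys))"
  have "runs (TAKE c c' i j) ts (n * (4 + 8) + 2) ((?S n)(c := ones n, c' := ones 0))"
    unfolding TAKE_def
  proof (rule runs_FOR)
    fix l u v
    have "runs (Cond i (\<lambda>s. s \<noteq> 0) (XFER i j) SKIP) ((?S l)(c := u, c' := v)) (2 + 2)
        ((?S (Suc l))(c := u, c' := v))"
    proof (rule runs_Cond)
      assume "((?S l)(c := u, c' := v)) i 0 \<noteq> 0"
      then have l: "l < length xs" using assms(6) by (auto simp: contents_head split: if_splits)
      then have d: "drop l xs = xs ! l # drop (Suc l) xs" by (simp add: Cons_nth_drop_Suc)
      show "runs (XFER i j) ((?S l)(c := u, c' := v)) 2 ((?S (Suc l))(c := u, c' := v))"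
        by (rule runs_conv[OF runs_XFER[of _ _ "xs ! l" "drop (Suc l) xs" _ "rev (take l xs) @ ys"]])
           (use assms l d in \<open>auto simp: take_Suc_conv_app_nth\<close>)
    next
      assume *: "\<not> ((?S l)(c := u, c' := v)) i 0 \<noteq> 0"
      have "l \<ge> length xs"
      proof (rule ccontr)
        assume "\<not> l \<ge> length xs"
        then have "hd (drop l xs) \<in> set xs" "drop l xs \<noteq> []" by (auto simp: hd_drop_conv_nth)
        with * assms show False by (auto simp: contents_head)
      qed
      then show "runs SKIP ((?S l)(c := u, c' := v)) 2 ((?S (Suc l))(c := u, c' := v))"
        by (intro runs_conv[OF runs_SKIP]) auto
    qed
    then show "runs (Cond i (\<lambda>s. s \<noteq> 0) (XFER i j) SKIP) ((?S l)(c := u, c' := v)) 4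
        ((?S (Suc l))(c := u, c' := v))" by simp
  qed (use assms in auto)
  then show ?thesis by (rule runs_conv) (use assms in auto)
qed

section \<open>Running a given machine as a subprogram\<close>

definition rel :: "tape \<Rightarrow> rtape" where
  "rel c = (\<lambda>p. fst c (p + snd c))"

text \<open>\<open>turing_machine\<close> constrains \<open>trans\<close> only on admissible states
  and symbols. On any other reading the action does nothing, so the symbol bound required by
  \<open>wf_com\<close> holds for all readings.\<close>

definition step_act :: "machine \<Rightarrow> nat \<Rightarrow> (nat \<Rightarrow> nat) \<Rightarrow> nat \<Rightarrow> nat \<times> move" where
  "step_act M b rd j = (let s = rd (b + num_tapes M); as = map (\<lambda>j. rd (b + j)) [0..<num_tapes M] in
     if s < num_states M \<and> set as \<subseteq> {..<num_symbols M} then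
       if j = b + num_tapes M then (fst (trans M s as), Stay)
       else if b \<le> j \<and> j < b + num_tapes M then snd (trans M s as) ! (j - b)
       else (rd j, Stay)
     else (rd j, Stay))"

definition MSTEP :: "machine \<Rightarrow> nat \<Rightarrow> com" where
  "MSTEP M b = Act (step_act M b)"

text \<open>Counting the symbols 3, that is, the ones of the output, serves both uses of a
  subroutine: a predicate yields 0 or 1, a unary number yields its value. It also needs no knowledge
  of where the output begins.\<close>

definition SCAN :: "nat \<Rightarrow> nat \<Rightarrow> com" where
  "SCAN i dest = Cond i (\<lambda>s. s = 3) (PUSH dest 1) SKIP ;; ACT i (\<lambda>s. (s, MoveLeft))"

text \<open>
  The state of \<open>M\<close> is kept as a symbol on the tape after its own tapes, and a clock records
  the number \<open>n\<close> of steps. The final head position \<open>h\<close> on the output tape is unknown but \<open>\<bar>h\<bar> \<le> n\<close>: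
  moving \<open>2 n\<close> cells to the right and then scanning \<open>3 n + 1\<close> cells leftwards visits all of the output.
\<close>

definition CALL :: "machine \<Rightarrow> nat \<Rightarrow> nat \<Rightarrow> com" where
  "CALL M b dest =
    (let ck = b + num_tapes M + 1; ck' = b + num_tapes M + 2;
         right = FOR ck ck' (ACT (b + 1) (\<lambda>s. (s, MoveRight)));
         scan = FOR ck ck' (SCAN (b + 1) dest)
     in Loop (b + num_tapes M) (\<lambda>s. s \<noteq> num_states M) (MSTEP M b ;; PUSH ck 1) ;;
        right ;; right ;; scan ;; scan ;; scan ;; SCAN (b + 1) dest)"

lemma wf_MSTEP:
  assumes "turing_machine M" "2 \<le> b" "b + num_tapes M < N" "num_symbols M \<le> G" "num_states M < G"
  shows "wf_com N G (MSTEP M b)"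
proof -
  have *: "fst (trans M s as) \<le> num_states M" "length (snd (trans M s as)) = num_tapes M"
    "fst ` set (snd (trans M s as)) \<subseteq> {..<num_symbols M}"
    if "s < num_states M" "length as = num_tapes M" "set as \<subseteq> {..<num_symbols M}" for s as
    using assms(1) that by (auto simp: turing_machine_def)
  show ?thesis
    unfolding MSTEP_def wf_com.simps
  proof (intro conjI allI impI)
    fix rd rd' :: "nat \<Rightarrow> nat" and i assume "\<forall>j<N. rd j = rd' j" "i < N"
    then have "rd (b + num_tapes M) = rd' (b + num_tapes M)" "rd i = rd' i"
      "map (\<lambda>j. rd (b + j)) [0..<num_tapes M] = map (\<lambda>j. rd' (b + j)) [0..<num_tapes M]"
      using assms(3) by auto
    then show "step_act M b rd i = step_act M b rd' i" by (simp only: step_act_def)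
  next
    fix rd :: "nat \<Rightarrow> nat" and i assume rd: "\<forall>j<N. rd j < G" "i < N"
    define s where "s = rd (b + num_tapes M)"
    define as where "as = map (\<lambda>j. rd (b + j)) [0..<num_tapes M]"
    show "fst (step_act M b rd i) < G"
    proof -
      have l: "length as = num_tapes M" by (simp add: as_def)
      have 1: "fst (snd (trans M s as) ! (i - b)) < G"
        if a: "s < num_states M" "set as \<subseteq> {..<num_symbols M}" and i: "b \<le> i" "i < b + num_tapes M"
      proof -
        note * = *[OF a(1) l a(2)]
        have "snd (trans M s as) ! (i - b) \<in> set (snd (trans M s as))" using i *(2) by simp
        with *(3) have "fst (snd (trans M s as) ! (i - b)) < num_symbols M" by blast
        then show ?thesis using assms(4) by simp
      qed
      have 2: "fst (trans M s as) < G" if "s < num_states M" "set as \<subseteq> {..<num_symbols M}"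
        using *(1)[OF that(1) l that(2)] assms(5) by simp
      show ?thesis using 1 2 rd unfolding step_act_def s_def[symmetric] as_def[symmetric] Let_def
        by (cases "s < num_states M \<and> set as \<subseteq> {..<num_symbols M}") auto
    qed
  qed (use assms(2) in \<open>auto simp: step_act_def Let_def\<close>)
qed

lemma wf_CALL [simp]:
  assumes "turing_machine M" "2 \<le> b" "b + num_tapes M + 2 < N" "num_symbols M \<le> G" "num_states M < G"
    "dest \<noteq> 1"
  shows "wf_com N G (CALL M b dest)"
proof -
  have "4 \<le> num_symbols M" "2 \<le> num_tapes M" using assms(1) by (auto simp: turing_machine_def)
  with assms wf_MSTEP[of M b N G] show ?thesis
    by (auto simp: CALL_def SCAN_def ACT_def Let_def)
qed

section \<open>Reachable configurations of a given machine\<close>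

definition valid_config :: "machine \<Rightarrow> config \<Rightarrow> bool" where
  "valid_config M c \<longleftrightarrow> fst c \<le> num_states M \<and> length (snd c) = num_tapes M \<and>
     (\<forall>i<num_tapes M. \<forall>p. fst (snd c ! i) p < num_symbols M)"

lemma fst_act_tape: "fst (act_tape a c) = (fst c)(snd c := fst a)"
  by (cases a; cases c) auto

lemma snd_act_tape: "snd (act_tape a c) = move_head (snd a) (snd c)"
  by (cases a; cases c) auto

lemma valid_step_facts:
  assumes "turing_machine M" "valid_config M (s, ts)" "s < num_states M"
  shows "fst (trans M s (map read_tape ts)) \<le> num_states M"
    "length (snd (trans M s (map read_tape ts))) = num_tapes M"
    "\<And>i. i < num_tapes M \<Longrightarrow> fst (snd (trans M s (map read_tape ts)) ! i) < num_symbols M"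
    "set (map read_tape ts) \<subseteq> {..<num_symbols M}"
    "step M (s, ts) = (fst (trans M s (map read_tape ts)), map2 act_tape (snd (trans M s (map read_tape ts))) ts)"
proof -
  show r: "set (map read_tape ts) \<subseteq> {..<num_symbols M}"
  proof -
    have "read_tape (ts ! i) < num_symbols M" if "i < length ts" for i
      using that assms(2) by (simp add: valid_config_def read_tape_eq)
    then show ?thesis by (metis (no_types, lifting) image_subset_iff in_set_conv_nth lessThan_iff list.set_map)
  qed
  have l: "length (map read_tape ts) = num_tapes M" using assms(2) by (simp add: valid_config_def)
  show 1: "fst (trans M s (map read_tape ts)) \<le> num_states M"
    "length (snd (trans M s (map read_tape ts))) = num_tapes M"
    using assms(1,3) r l by (auto simp: turing_machine_def)
  show "fst (snd (trans M s (map read_tape ts)) ! i) < num_symbols M" if "i < num_tapes M" for i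
  proof -
    have "snd (trans M s (map read_tape ts)) ! i \<in> set (snd (trans M s (map read_tape ts)))"
      using that 1 by simp
    moreover have "fst ` set (snd (trans M s (map read_tape ts))) \<subseteq> {..<num_symbols M}"
      using assms(1,3) r l by (auto simp: turing_machine_def)
    ultimately show ?thesis by blast
  qed
  show "step M (s, ts) = (fst (trans M s (map read_tape ts)), map2 act_tape (snd (trans M s (map read_tape ts))) ts)"
    using assms(3) by (simp add: split_beta)
qed

lemma valid_step:
  assumes "turing_machine M" "valid_config M c"
  shows "valid_config M (step M c)"
proof -
  obtain s ts where c: "c = (s, ts)" by (cases c)
  show ?thesis
  proof (cases "s < num_states M")
    case True
    note f = valid_step_facts[OF assms(1) assms(2)[unfolded c] True]
    show ?thesis using f(1-3) assms(2) unfolding c f(5)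
      by (auto simp: valid_config_def fst_act_tape)
  next
    case False then show ?thesis using assms(2) by (simp add: c)
  qed
qed

lemma valid_steps:
  assumes "turing_machine M" "valid_config M c"
  shows "valid_config M ((step M ^^ n) c)"
  using valid_step[OF assms(1)] assms(2) by (induction n) auto

lemma valid_initial:
  assumes "turing_machine M" "set w \<subseteq> {..<num_symbols M}"
  shows "valid_config M (initial_config M w)"
proof -
  have "contents w p < num_symbols M" for p
    using assms by (auto simp: contents_def turing_machine_def subset_iff)
  then show ?thesis using assms
    by (auto simp: valid_config_def initial_config_def nth_Cons' contents_Nil turing_machine_def)
qed

text \<open>A head moves by at most one cell per step and writes only where it stands. The bound
  \<open>0\<close> on the initial nonblank cells is met by the output tape, which starts
  blank.\<close>

lemma head_range:
  assumes "turing_machine M" "valid_config M c" "i < num_tapes M"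
    "snd (snd c ! i) = 0" "\<And>p. fst (snd c ! i) p \<noteq> 0 \<Longrightarrow> \<bar>p\<bar> \<le> 0"
  shows "\<bar>snd (snd ((step M ^^ n) c) ! i)\<bar> \<le> int n \<and>
    (\<forall>p. fst (snd ((step M ^^ n) c) ! i) p \<noteq> 0 \<longrightarrow> \<bar>p\<bar> \<le> int n)"
proof (induction n)
  case 0 then show ?case using assms by auto
next
  case (Suc n)
  obtain s ts where c: "(step M ^^ n) c = (s, ts)" by (cases "(step M ^^ n) c")
  have v: "valid_config M (s, ts)" using valid_steps[OF assms(1,2), of n] c by simp
  show ?case
  proof (cases "s < num_states M")
    case True
    note f = valid_step_facts[OF assms(1) v True]
    have len: "length ts = num_tapes M" using v by (simp add: valid_config_def)
    define a where "a = snd (trans M s (map read_tape ts)) ! i"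
    have e: "snd ((step M ^^ Suc n) c) ! i = act_tape a (ts ! i)"
      using f(2,5) c assms(3) len by (simp add: a_def)
    have "\<bar>move_head (snd a) h\<bar> \<le> \<bar>h\<bar> + 1" for h by (cases "snd a") auto
    with Suc c show ?thesis unfolding e snd_act_tape fst_act_tape
      by (smt (verit, ccfv_threshold) fun_upd_apply of_nat_Suc snd_conv)
  next
    case False
    then have "(step M ^^ Suc n) c = (step M ^^ n) c" using c by simp
    then show ?thesis using Suc by (smt (verit) of_nat_Suc)
  qed
qed

definition config_tapes :: "machine \<Rightarrow> nat \<Rightarrow> config \<Rightarrow> nat \<Rightarrow> (nat \<Rightarrow> rtape) \<Rightarrow> nat \<Rightarrow> rtape" where
  "config_tapes M b c l ts = (\<lambda>j.
     if b \<le> j \<and> j < b + num_tapes M then rel (snd c ! (j - b))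
     else if j = b + num_tapes M then contents [fst c]
     else if j = b + num_tapes M + 1 then ones l else ts j)"

lemma runs_MSTEP:
  assumes "turing_machine M" "valid_config M c" "fst c < num_states M"
  shows "runs (MSTEP M b) (config_tapes M b c l ts) 1 (config_tapes M b (step M c) l ts)"
proof -
  obtain s tp where c: "c = (s, tp)" by (cases c)
  have s: "s < num_states M" using assms(3) c by simp
  note f = valid_step_facts[OF assms(1) assms(2)[unfolded c] s]
  have len: "length tp = num_tapes M" using assms(2) by (simp add: valid_config_def c)
  let ?T = "config_tapes M b c l ts"
  have 1: "?T (b + num_tapes M) 0 = s" by (simp add: config_tapes_def c contents_head)
  have 2: "map (\<lambda>j. ?T (b + j) 0) [0..<num_tapes M] = map read_tape tp"
    by (rule nth_equalityI) (auto simp: config_tapes_def c len rel_def read_tape_eq)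
  have st: "rel_act (a, Stay) (contents [x]) = contents [a]" for a x
    by (auto simp: rel_act_def contents_def fun_eq_iff)
  have rl: "rel_act a (rel t) = rel (act_tape a t)" for a t
    using act_tape_rel[of a t] by (simp add: rel_def)
  have cond: "(s < num_states M \<and> set (map read_tape tp) \<subseteq> {..<num_symbols M}) = True"
    using s f(4) by simp
  show ?thesis unfolding MSTEP_def
  proof (rule runs_conv[OF runs_Act _ order_refl], rule ext)
    fix j
    show "rel_act (step_act M b (\<lambda>j. ?T j 0) j) (?T j) = config_tapes M b (step M c) l ts j"
      unfolding step_act_def 1 2 Let_def cond if_True using f(2,5) len
      by (auto simp: config_tapes_def c rel_act_keep st rl simp del: step.simps)
  qed
qed

lemma runs_SCAN:
  assumes "ts i = (\<lambda>p. g (p + H))" "ts dest = ones d" "i \<noteq> dest"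
  shows "runs (SCAN i dest) ts 5
     (ts(i := (\<lambda>p. g (p + (H - 1))), dest := ones (if g H = 3 then Suc d else d)))"
proof -
  have 1: "runs (Cond i (\<lambda>s. s = 3) (PUSH dest 1) SKIP) ts (2 + 2)
      (ts(dest := ones (if g H = 3 then Suc d else d)))"
  proof (rule runs_Cond)
    assume "ts i 0 = 3"
    then show "runs (PUSH dest 1) ts 2 (ts(dest := ones (if g H = 3 then Suc d else d)))"
      using assms by (intro runs_conv[OF runs_PUSH[of _ _ "replicate d 1"]]) (auto simp: ones_def)
  next
    assume "\<not> ts i 0 = 3"
    then show "runs SKIP ts 2 (ts(dest := ones (if g H = 3 then Suc d else d)))"
      using assms by (intro runs_conv[OF runs_SKIP]) auto
  qed
  show ?thesis unfolding SCAN_def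
    by (rule runs_conv[OF runs_Seq[OF 1 runs_ACT]])
       (use assms in \<open>auto simp: rel_act_def fun_eq_iff algebra_simps\<close>)
qed

lemma encode_symbols: "set (encode ws) \<subseteq> {1, 2, 3}"
  by (auto simp: encode_def bit_symbol_def)

lemma runs_CALL:
  assumes M: "turing_machine M"
    and halt: "(step M ^^ t) (initial_config M w) = (num_states M, tps)"
    and out: "fst (tps ! 1) = contents (map bit_symbol f)"
    and w: "set w \<subseteq> {1, 2, 3}"
    and ts: "ts b = contents w" "\<And>j. b < j \<Longrightarrow> j < b + num_tapes M + 3 \<Longrightarrow> ts j = contents []"
    and dest: "ts dest = ones d" "dest < b \<or> b + num_tapes M + 3 \<le> dest"
  shows "\<exists>ts'. runs (CALL M b dest) ts (62 * t + 16) ts' \<and> ts' dest = ones (d + count_list f True) \<and>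
     (\<forall>j. j \<noteq> dest \<longrightarrow> j < b \<or> b + num_tapes M + 3 \<le> j \<longrightarrow> ts' j = ts j) \<and> count_list f True \<le> 3 * t + 1"
proof -
  define nt where "nt = num_tapes M"
  have nt2: "2 \<le> nt" and sy: "4 \<le> num_symbols M" using M by (auto simp: turing_machine_def nt_def)
  define cf where "cf = (\<lambda>n. (step M ^^ n) (initial_config M w))"
  have v: "valid_config M (cf n)" for n
    unfolding cf_def using valid_steps[OF M valid_initial[OF M]] w sy by fastforce
  \<comment> \<open>The simulation loop stops at the first halting configuration, so the clock shows
    \<open>n\<close> rather than the prescribed number \<open>t\<close> of steps.\<close>
  define n where "n = (LEAST n. fst (cf n) = num_states M)"
  have "fst (cf t) = num_states M" using halt by (simp add: cf_def)
  then have n: "fst (cf n) = num_states M" "n \<le> t"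
    unfolding n_def by (rule LeastI, rule Least_le)
  have lt: "fst (cf l) < num_states M" if "l < n" for l
    using that v[of l] not_less_Least[of l "\<lambda>n. fst (cf n) = num_states M"]
    by (fastforce simp: n_def valid_config_def)
  have "cf t = cf n"
  proof -
    have "cf t = (step M ^^ (t - n)) (cf n)"
      using n(2) by (simp add: cf_def flip: funpow_add[THEN fun_cong, unfolded comp_apply])
    then show ?thesis using n(1) by (simp add: step_halted)
  qed
  moreover have "cf t = (num_states M, tps)" using halt by (simp add: cf_def)
  ultimately have cfn: "snd (cf n) = tps" by (metis snd_conv)
  have i1: "1 < num_tapes M" using nt2 by (simp add: nt_def)
  have ini1: "snd (initial_config M w) ! 1 = (contents [], 0)"
    using i1 by (simp add: initial_config_def)
  define h where "h = snd (tps ! 1)"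
  define g where "g = fst (tps ! 1)"
  have hr: "\<bar>h\<bar> \<le> int n" and gr: "\<And>p. g p \<noteq> 0 \<Longrightarrow> \<bar>p\<bar> \<le> int n"
  proof -
    have "\<bar>snd (snd (cf n) ! 1)\<bar> \<le> int n \<and> (\<forall>p. fst (snd (cf n) ! 1) p \<noteq> 0 \<longrightarrow> \<bar>p\<bar> \<le> int n)"
      unfolding cf_def by (rule head_range[OF M _ i1])
        (use v[of 0] ini1 in \<open>auto simp: cf_def contents_Nil\<close>)
    then show "\<bar>h\<bar> \<le> int n" "\<And>p. g p \<noteq> 0 \<Longrightarrow> \<bar>p\<bar> \<le> int n" by (auto simp: h_def g_def cfn)
  qed
  define st ck ck' where "st = b + nt" and "ck = b + nt + 1" and "ck' = b + nt + 2"
  have ds: "distinct [dest, b + 1, st, ck, ck']"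
    using dest(2) nt2 by (auto simp: st_def ck_def ck'_def nt_def)
  define T where "T = (\<lambda>l. config_tapes M b (cf l) l ts)"
  have T0: "T 0 = ts"
  proof
    fix j
    \<comment> \<open>The start state 0 is also the blank symbol, so a blank state tape already
      holds the start state and needs no initialisation.\<close>
    have z: "contents [0] = contents []" by (auto simp: contents_def fun_eq_iff)
    have "ts j = contents []" if "b < j" "j < b + num_tapes M + 3" using ts(2) that by simp
    then show "T 0 j = ts j"
      using ts(1) i1 by (cases "j = b")
        (auto simp: T_def config_tapes_def cf_def initial_config_def rel_def nth_Cons' ones_def z)
  qed
  have L: "runs (Loop st (\<lambda>s. s \<noteq> num_states M) (MSTEP M b ;; PUSH ck 1)) (T 0) (n * ((1 + 2) + 2) + 1) (T n)"
  proof (rule runs_Loop)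
    fix l assume l: "l < n"
    show "T l st 0 \<noteq> num_states M"
      using lt[OF l] by (simp add: T_def config_tapes_def st_def nt_def contents_head)
    have 1: "runs (MSTEP M b) (T l) 1 (config_tapes M b (cf (Suc l)) l ts)"
      using runs_MSTEP[OF M v lt[OF l], of b l ts] by (simp add: T_def cf_def)
    have 2: "runs (PUSH ck 1) (config_tapes M b (cf (Suc l)) l ts) 2 (T (Suc l))"
      by (rule runs_conv[OF runs_PUSH[of _ _ "replicate l 1"]])
         (auto simp: T_def config_tapes_def ck_def nt_def ones_def fun_eq_iff)
    show "runs (MSTEP M b ;; PUSH ck 1) (T l) (1 + 2) (T (Suc l))"
      by (rule runs_Seq[OF 1 2])
  next
    show "\<not> T n st 0 \<noteq> num_states M"
      using n(1) by (simp add: T_def config_tapes_def st_def nt_def contents_head)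
  qed
  have Tn: "T n (b + 1) = (\<lambda>p. g (p + h))" "T n ck = ones n" "T n ck' = ones 0" "T n dest = ones d"
    using ts(2)[of ck'] dest i1 cfn
    by (auto simp: T_def config_tapes_def ck_def ck'_def nt_def rel_def g_def h_def ones_def)
  define R where "R = (\<lambda>x l. (T n)(b + 1 := (\<lambda>p. g (p + x)), dest := ones (d + l)))"
  have R0: "T n = R h 0" using Tn by (auto simp: R_def)
  have Rr: "runs (FOR ck ck' (ACT (b + 1) (\<lambda>s. (s, MoveRight)))) (R x l) (n * (1 + 8) + 2) (R (x + int n) l)" for x l
  proof -
    have "runs (FOR ck ck' (ACT (b + 1) (\<lambda>s. (s, MoveRight)))) (R x l) (n * (1 + 8) + 2)
       ((R (x + int n) l)(ck := ones n, ck' := ones 0))"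
    proof (rule runs_FOR)
      fix j u v
      show "runs (ACT (b + 1) (\<lambda>s. (s, MoveRight))) ((R (x + int j) l)(ck := u, ck' := v)) 1
         ((R (x + int (Suc j)) l)(ck := u, ck' := v))"
        by (rule runs_conv[OF runs_ACT]) (use ds in \<open>auto simp: R_def rel_act_def fun_eq_iff algebra_simps\<close>)
    qed (use ds Tn in \<open>auto simp: R_def fun_eq_iff\<close>)
    then show ?thesis by (rule runs_conv) (use ds Tn in \<open>auto simp: R_def fun_eq_iff\<close>)
  qed
  \<comment> \<open>\<open>H\<close> is the cell where scanning starts. From
    \<open>\<bar>h\<bar> \<le> n\<close> it lies between \<open>n\<close> and \<open>3 n\<close>, so
    the cells \<open>H\<close>, \<open>H - 1\<close>, ..., \<open>H - 3 n\<close> include all of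
    \<open>0\<close>, ..., \<open>n\<close>, the only nonnegative cells that can be
    nonblank.\<close>
  define H where "H = h + int n + int n"
  define cn where "cn = (\<lambda>l. card {i. i < l \<and> g (H - int i) = 3})"
  have cnS: "cn (Suc l) = (if g (H - int l) = 3 then Suc (cn l) else cn l)" for l
  proof -
    have "{i. i < Suc l \<and> g (H - int i) = 3} =
       (if g (H - int l) = 3 then insert l {i. i < l \<and> g (H - int i) = 3} else {i. i < l \<and> g (H - int i) = 3})"
      by (auto simp: less_Suc_eq)
    then show ?thesis by (simp add: cn_def)
  qed
  have Sc: "runs (SCAN (b + 1) dest) ((R (H - int l) (cn l))(ck := u, ck' := v)) 5
     ((R (H - int (Suc l)) (cn (Suc l)))(ck := u, ck' := v))" for l u v
  proof -
    have "runs (SCAN (b + 1) dest) ((R (H - int l) (cn l))(ck := u, ck' := v)) 5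
      (((R (H - int l) (cn l))(ck := u, ck' := v))(b + 1 := (\<lambda>p. g (p + (H - int l - 1))),
        dest := ones (if g (H - int l) = 3 then Suc (d + cn l) else d + cn l)))"
      by (rule runs_SCAN) (use ds in \<open>auto simp: R_def\<close>)
    then show ?thesis by (rule runs_conv) (use ds in \<open>auto simp: R_def fun_eq_iff cnS algebra_simps\<close>)
  qed
  have Rs: "runs (FOR ck ck' (SCAN (b + 1) dest)) (R (H - int l) (cn l)) (n * (5 + 8) + 2)
     (R (H - int (l + n)) (cn (l + n)))" for l
  proof -
    have "runs (FOR ck ck' (SCAN (b + 1) dest)) (R (H - int l) (cn l)) (n * (5 + 8) + 2)
       ((R (H - int (l + n)) (cn (l + n)))(ck := ones n, ck' := ones 0))"
    proof (rule runs_FOR)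
      fix j u v
      show "runs (SCAN (b + 1) dest) ((R (H - int (l + j)) (cn (l + j)))(ck := u, ck' := v)) 5
         ((R (H - int (l + Suc j)) (cn (l + Suc j)))(ck := u, ck' := v))"
        using Sc[of "l + j" u v] by simp
    qed (use ds Tn in \<open>auto simp: R_def fun_eq_iff\<close>)
    then show ?thesis by (rule runs_conv) (use ds Tn in \<open>auto simp: R_def fun_eq_iff\<close>)
  qed
  define F where "F = R (H - int (Suc (n + n + n))) (cn (Suc (n + n + n)))"
  have S1: "runs (SCAN (b + 1) dest) (R (H - int (n + n + n)) (cn (n + n + n))) 5 F"
  proof -
    let ?R = "R (H - int (n + n + n)) (cn (n + n + n))"
    have "?R = ?R(ck := ?R ck, ck' := ?R ck')" by simp
    moreover have "F = F(ck := ?R ck, ck' := ?R ck')" using ds by (auto simp: F_def R_def fun_eq_iff)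
    ultimately show ?thesis using Sc[of "n + n + n" "?R ck" "?R ck'"] unfolding F_def by metis
  qed
  have cn0: "cn 0 = 0" by (simp add: cn_def)
  have Rr2: "runs (FOR ck ck' (ACT (b + 1) (\<lambda>s. (s, MoveRight)))) (R (h + int n) 0) (n * (1 + 8) + 2) (R H 0)"
    using Rr[of "h + int n" 0] by (simp add: H_def)
  have Rs0: "runs (FOR ck ck' (SCAN (b + 1) dest)) (R H 0) (n * (5 + 8) + 2) (R (H - int n) (cn n))"
    using Rs[of 0] cn0 by simp
  have L': "runs (Loop st (\<lambda>s. s \<noteq> num_states M) (MSTEP M b ;; PUSH ck 1)) ts (n * ((1 + 2) + 2) + 1) (R h 0)"
    using L R0 T0 by simp
  have eqs: "b + num_tapes M = st" "st + 1 = ck" "st + 2 = ck'"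
    by (simp_all add: st_def ck_def ck'_def nt_def)
  \<comment> \<open>The simulation costs \<open>5 n + 1\<close>, each of the two moves to the right
    \<open>9 n + 2\<close>, each of the three scanning loops \<open>13 n + 2\<close>, and the last
    cell 5.\<close>
  have run: "runs (CALL M b dest) ts (62 * n + 16) F"
    unfolding CALL_def Let_def eqs
    by (rule runs_mono[OF runs_Seq[OF L' runs_Seq[OF Rr runs_Seq[OF Rr2 runs_Seq[OF Rs0
        runs_Seq[OF Rs[of n] runs_Seq[OF Rs[of "n + n"] S1]]]]]]]) simp
  have cnt: "cn (Suc (n + n + n)) = count_list f True"
  proof -
    have gf: "g p = contents (map bit_symbol f) p" for p using out by (simp add: g_def)
    have "count_list f True = length (filter (\<lambda>s. s = 3) (map bit_symbol f))"
      by (induction f) (auto simp: bit_symbol_def)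
    also have "\<dots> = card {q. q < length f \<and> map bit_symbol f ! q = 3}"
      by (simp add: length_filter_conv_card)
    also have "\<dots> = card {i. i < Suc (n + n + n) \<and> g (H - int i) = 3}"
    proof (rule bij_betw_same_card[of "\<lambda>q. nat (H - int q)"], rule bij_betw_byWitness[where f' = "\<lambda>i. nat (H - int i)"])
      have up: "int q \<le> H \<and> H - int q \<le> 3 * int n" if "q < length f" for q
      proof -
        have "g (int q) \<noteq> 0" using that by (simp add: gf contents_def bit_symbol_def)
        then have "int q \<le> int n" using gr[of "int q"] by simp
        then show ?thesis using hr unfolding H_def by linarith
      qed
      show "\<forall>a\<in>{q. q < length f \<and> map bit_symbol f ! q = 3}. nat (H - int (nat (H - int a))) = a"
        using up by auto
      show "(\<lambda>q. nat (H - int q)) ` {q. q < length f \<and> map bit_symbol f ! q = 3} \<subseteq>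
         {i. i < Suc (n + n + n) \<and> g (H - int i) = 3}"
      proof (intro image_subsetI CollectI)
        fix q assume q: "q \<in> {q. q < length f \<and> map bit_symbol f ! q = 3}"
        then have "g (int q) = 3" by (simp add: gf contents_def)
        then show "nat (H - int q) < Suc (n + n + n) \<and> g (H - int (nat (H - int q))) = 3"
          using up[of q] q by auto
      qed
      have dn: "0 \<le> H - int i \<and> nat (H - int i) < length f \<and> map bit_symbol f ! nat (H - int i) = 3"
        if "g (H - int i) = 3" for i
        using that unfolding gf contents_def by (auto split: if_splits)
      show "\<forall>a'\<in>{i. i < Suc (n + n + n) \<and> g (H - int i) = 3}. nat (H - int (nat (H - int a'))) = a'"
        using dn by auto
      show "(\<lambda>i. nat (H - int i)) ` {i. i < Suc (n + n + n) \<and> g (H - int i) = 3} \<subseteq>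
         {q. q < length f \<and> map bit_symbol f ! q = 3}"
        using dn by auto
    qed
    finally show ?thesis by (simp add: cn_def)
  qed
  have "cn (Suc (n + n + n)) \<le> card {..<Suc (n + n + n)}"
    unfolding cn_def by (rule card_mono) auto
  then have le: "count_list f True \<le> 3 * t + 1" using cnt n(2) by simp
  have "F j = ts j" if "j \<noteq> dest" "j < b \<or> b + num_tapes M + 3 \<le> j" for j
    using that i1 by (auto simp: F_def R_def T_def config_tapes_def)
  moreover have "F dest = ones (d + count_list f True)" by (simp add: F_def R_def cnt)
  ultimately show ?thesis using runs_mono[OF run, of "62 * t + 16"] n(2) le by auto
qed

section \<open>Parsing and polynomial evaluation\<close>

abbreviation bits :: "bool list \<Rightarrow> nat list" where
  "bits w \<equiv> map bit_symbol w"

text \<open>The verifier has to be computed on every list of strings. On an exhausted input the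
  parser meets a blank at once and delivers the empty word, which fixes the default value.\<close>

definition component :: "bool list list \<Rightarrow> bool list" where
  "component ws = (if ws = [] then [] else hd ws)"

lemma encode_simps [simp]:
  "encode [] = []"
  "encode (w # ws) = bits w @ 1 # encode ws"
  "encode (us @ vs) = encode us @ encode vs"
  by (simp_all add: encode_def)

lemma zero_notin_bits [simp]: "0 \<notin> set (bits w)"
  by (auto simp: bit_symbol_def)

lemma zero_notin_encode [simp]: "0 \<notin> set (encode ws)"
  using encode_symbols[of ws] by auto

lemma bit_symbol_neq [simp]: "bit_symbol b \<noteq> 0" "0 < bit_symbol b" "bit_symbol b \<noteq> Suc 0"
  by (simp_all add: bit_symbol_def)

text \<open>The final \<open>POP\<close> removes the separator. At the end of the input it meets a
  blank and has no effect, in accordance with \<open>tl [] = []\<close>.\<close>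

definition SKIPC :: "nat \<Rightarrow> com" where
  "SKIPC i = Loop i (\<lambda>s. s \<noteq> 0 \<and> s \<noteq> 1) (POP i) ;; POP i"

text \<open>The passage through \<open>tmp\<close> reverses the word, and \<open>MOVE\<close>
  reverses it back.\<close>

definition PARSE :: "nat \<Rightarrow> nat \<Rightarrow> nat \<Rightarrow> com" where
  "PARSE i tmp j = Loop i (\<lambda>s. s \<noteq> 0 \<and> s \<noteq> 1) (XFER i tmp) ;; POP i ;; MOVE tmp j"

lemma wf_parse [simp]:
  "i \<noteq> 1 \<Longrightarrow> i < N \<Longrightarrow> 0 < G \<Longrightarrow> wf_com N G (SKIPC i)"
  "i \<noteq> 1 \<Longrightarrow> tmp \<noteq> 1 \<Longrightarrow> j \<noteq> 1 \<Longrightarrow> i < N \<Longrightarrow> tmp < N \<Longrightarrow> 0 < G \<Longrightarrow> wf_com N G (PARSE i tmp j)"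
  by (simp_all add: SKIPC_def PARSE_def)

lemma length_component: "length (component ws) \<le> length (encode ws)"
  by (cases ws) (auto simp: component_def)

lemma length_encode_tl: "length (encode (tl ws)) \<le> length (encode ws)"
  by (cases ws) auto

lemma length_encode_drop: "length (encode (drop n ws)) \<le> length (encode ws)"
proof (induction n arbitrary: ws)
  case (Suc n)
  have "length (encode (drop n (tl ws))) \<le> length (encode ws)"
    using Suc[of "tl ws"] length_encode_tl[of ws] by linarith
  then show ?case by (simp add: drop_Suc)
qed simp

lemma encode_split:
  "encode ws = bits (component ws) @ (if ws = [] then [] else 1 # encode (tl ws))"
  by (cases ws) (auto simp: component_def)

lemma runs_SKIPC:
  assumes "ts i = contents (encode ws)"
  shows "runs (SKIPC i) ts (3 * length (encode ws) + 2) (ts(i := contents (encode (tl ws))))"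
proof -
  define w where "w = bits (component ws)"
  define e where "e = (if ws = [] then [] else 1 # encode (tl ws))"
  have we: "encode ws = w @ e" unfolding w_def e_def by (rule encode_split)
  have e: "contents e 0 = 0 \<or> contents e 0 = 1" "tl e = encode (tl ws)"
    by (auto simp: e_def contents_head)
  let ?S = "\<lambda>l. ts(i := contents (drop l w @ e))"
  have 1: "runs (Loop i (\<lambda>s. s \<noteq> 0 \<and> s \<noteq> 1) (POP i)) (?S 0) (length w * (1 + 2) + 1) (?S (length w))"
  proof (rule runs_Loop)
    fix l assume l: "l < length w"
    then have d: "drop l w = w ! l # drop (Suc l) w" by (simp add: Cons_nth_drop_Suc)
    show "?S l i 0 \<noteq> 0 \<and> ?S l i 0 \<noteq> 1"
      using l by (simp add: contents_head d) (simp add: w_def)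
    show "runs (POP i) (?S l) 1 (?S (Suc l))"
      by (rule runs_conv[OF runs_POP[of _ _ "drop l w @ e"]]) (use d in auto)
  qed (use e in auto)
  have 2: "runs (POP i) (?S (length w)) 1 (ts(i := contents (encode (tl ws))))"
    by (rule runs_conv[OF runs_POP[of _ _ e]]) (use e in auto)
  have "?S 0 = ts" using assms we by auto
  with runs_Seq[OF 1 2] show ?thesis unfolding SKIPC_def
    using we by (auto intro: runs_mono)
qed

lemma runs_PARSE:
  assumes "ts i = contents (encode ws)" "ts tmp = contents []" "ts j = contents ys" "distinct [i, tmp, j]"
  shows "runs (PARSE i tmp j) ts (8 * length (encode ws) + 3)
    (ts(i := contents (encode (tl ws)), j := contents (bits (component ws) @ ys)))"
proof -
  define w where "w = bits (component ws)"
  define e where "e = (if ws = [] then [] else 1 # encode (tl ws))"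
  have we: "encode ws = w @ e" unfolding w_def e_def by (rule encode_split)
  have e: "contents e 0 = 0 \<or> contents e 0 = 1" "tl e = encode (tl ws)"
    by (auto simp: e_def contents_head)
  let ?S = "\<lambda>l. ts(i := contents (drop l w @ e), tmp := contents (rev (take l w)))"
  have 1: "runs (Loop i (\<lambda>s. s \<noteq> 0 \<and> s \<noteq> 1) (XFER i tmp)) (?S 0) (length w * (2 + 2) + 1) (?S (length w))"
  proof (rule runs_Loop)
    fix l assume l: "l < length w"
    then have d: "drop l w = w ! l # drop (Suc l) w" by (simp add: Cons_nth_drop_Suc)
    show "?S l i 0 \<noteq> 0 \<and> ?S l i 0 \<noteq> 1"
      using l assms(4) by (simp add: contents_head d) (simp add: w_def)
    show "runs (XFER i tmp) (?S l) 2 (?S (Suc l))"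
      by (rule runs_conv[OF runs_XFER[of _ _ "w ! l" "drop (Suc l) w @ e" _ "rev (take l w)"]])
         (use d l assms(4) in \<open>auto simp: take_Suc_conv_app_nth\<close>)
  qed (use e assms(4) in auto)
  have 2: "runs (POP i) (?S (length w)) 1 (ts(i := contents (encode (tl ws)), tmp := contents (rev w)))"
    by (rule runs_conv[OF runs_POP[of _ _ e]]) (use e assms(4) in auto)
  have 3: "runs (MOVE tmp j) (ts(i := contents (encode (tl ws)), tmp := contents (rev w))) (4 * length (rev w) + 1)
     (ts(i := contents (encode (tl ws)), j := contents (bits (component ws) @ ys)))"
    by (rule runs_conv[OF runs_MOVE[of _ _ "rev w" _ ys]])
       (use assms in \<open>auto simp: fun_eq_iff w_def simp del: set_map\<close>)
  have "?S 0 = ts" using assms we by auto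
  with runs_Seq[OF 1 runs_Seq[OF 2 3]] show ?thesis unfolding PARSE_def
    using we by (auto intro: runs_mono)
qed

lemma runs_FOR_SKIPC:
  assumes "ts i = contents (encode ws)" "ts c = ones n" "ts c' = ones 0" "distinct [i, c, c']"
  shows "runs (FOR c c' (SKIPC i)) ts (n * (3 * length (encode ws) + 10) + 2)
    (ts(i := contents (encode (drop n ws))))"
proof -
  let ?S = "\<lambda>j. ts(i := contents (encode (drop j ws)))"
  have "runs (FOR c c' (SKIPC i)) ts (n * ((3 * length (encode ws) + 2) + 8) + 2) ((?S n)(c := ones n, c' := ones 0))"
  proof (rule runs_FOR)
    fix j u v
    show "runs (SKIPC i) ((?S j)(c := u, c' := v)) (3 * length (encode ws) + 2) ((?S (Suc j))(c := u, c' := v))"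
      by (rule runs_conv[OF runs_SKIPC[of _ _ "drop j ws"]])
         (use assms(4) length_encode_drop[of j ws] in \<open>auto simp: drop_Suc drop_tl\<close>)
  qed (use assms in auto)
  then show ?thesis by (rule runs_conv) (use assms in auto)
qed

section \<open>Unary evaluation of polynomials\<close>

fun PUSHES :: "nat \<Rightarrow> nat \<Rightarrow> com" where
  "PUSHES i 0 = SKIP"
| "PUSHES i (Suc c) = PUSH i 1 ;; PUSHES i c"

text \<open>Horner's rule: the value of the tail is moved from \<open>D\<close> to \<open>E\<close>,
  and each unit of it is replaced by one pass over the counter \<open>N\<close>, which multiplies it
  by the argument.\<close>

fun PEVAL :: "nat \<Rightarrow> nat \<Rightarrow> nat \<Rightarrow> nat \<Rightarrow> nat list \<Rightarrow> com" where
  "PEVAL N N' E D [] = SKIP"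
| "PEVAL N N' E D (c # cs) =
     PEVAL N N' E D cs ;; MOVE D E ;;
     Loop E (\<lambda>s. s \<noteq> 0) (POP E ;; FOR N N' (PUSH D 1)) ;; PUSHES D c"

fun horner :: "nat list \<Rightarrow> nat \<Rightarrow> nat" where
  "horner [] n = 0"
| "horner (c # cs) n = c + n * horner cs n"

lemma horner_coeffs: "horner (coeffs p) n = poly p n"
  by (induction p) (auto simp: cCons_def)

fun peval_time :: "nat list \<Rightarrow> nat \<Rightarrow> nat" where
  "peval_time [] n = 1"
| "peval_time (c # cs) n = peval_time cs n + (4 * horner cs n + 1) +
     (horner cs n * ((1 + (n * 10 + 2)) + 2) + 1) + (2 * c + 1)"

lemma wf_PUSHES [simp]: "i \<noteq> 1 \<Longrightarrow> 1 < G \<Longrightarrow> wf_com N G (PUSHES i c)"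
  by (induction c) auto

lemma wf_PEVAL [simp]:
  "N \<noteq> 1 \<Longrightarrow> N' \<noteq> 1 \<Longrightarrow> E \<noteq> 1 \<Longrightarrow> D \<noteq> 1 \<Longrightarrow> N < NN \<Longrightarrow> N' < NN \<Longrightarrow> E < NN \<Longrightarrow> D < NN \<Longrightarrow> 1 < G \<Longrightarrow>
    wf_com NN G (PEVAL N N' E D cs)"
  by (induction cs) auto

lemma runs_PUSH_ones: "ts i = ones d \<Longrightarrow> runs (PUSH i 1) ts 2 (ts(i := ones (Suc d)))"
  using runs_PUSH[of ts i "replicate d 1" 1] by (simp add: ones_def)

lemma runs_POP_ones: "ts i = ones d \<Longrightarrow> runs (POP i) ts 1 (ts(i := ones (d - 1)))"
  using runs_POP[of ts i "replicate d 1"] by (cases d) (simp_all add: ones_def)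

lemma runs_PUSHES: "ts i = ones d \<Longrightarrow> runs (PUSHES i c) ts (2 * c + 1) (ts(i := ones (c + d)))"
proof (induction c arbitrary: ts d)
  case 0
  then show ?case unfolding PUSHES.simps by (intro runs_conv[OF runs_SKIP]) auto
next
  case (Suc c)
  have "runs (PUSHES i c) (ts(i := ones (Suc d))) (2 * c + 1) (ts(i := ones (Suc c + d)))"
    by (rule runs_conv[OF Suc.IH[of _ "Suc d"]]) auto
  from runs_Seq[OF runs_PUSH_ones[where ts = ts and i = i, OF Suc.prems] this] show ?case
    unfolding PUSHES.simps by (rule runs_mono) simp
qed

lemma runs_PEVAL:
  assumes "ts N = ones n" "ts N' = ones 0" "ts E = ones 0" "ts D = ones 0" "distinct [N, N', E, D]"
  shows "runs (PEVAL N N' E D cs) ts (peval_time cs n) (ts(D := ones (horner cs n)))"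
proof (induction cs)
  case Nil
  show ?case unfolding PEVAL.simps by (rule runs_conv[OF runs_SKIP]) (use assms in auto)
next
  case (Cons c cs)
  let ?h = "horner cs n"
  have 2: "runs (MOVE D E) (ts(D := ones ?h)) (4 * ?h + 1) (ts(E := ones ?h, D := ones 0))"
    by (rule runs_conv[OF runs_MOVE[of _ _ "replicate ?h 1" _ "[]"]])
       (use assms in \<open>auto simp: ones_def fun_eq_iff\<close>)
  let ?S = "\<lambda>l. ts(E := ones (?h - l), D := ones (n * l))"
  have 3: "runs (Loop E (\<lambda>s. s \<noteq> 0) (POP E ;; FOR N N' (PUSH D 1))) (?S 0)
      (?h * ((1 + (n * (2 + 8) + 2)) + 2) + 1) (?S ?h)"
  proof (rule runs_Loop[where S = ?S])
    fix l assume l: "l < ?h"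
    show "?S l E 0 \<noteq> 0" using l assms(5) by (auto simp: ones_head)
    have a: "runs (POP E) (?S l) 1 (ts(E := ones (?h - Suc l), D := ones (n * l)))"
      by (rule runs_conv[OF runs_POP_ones[of _ _ "?h - l"]]) (use assms(5) in auto)
    let ?T = "\<lambda>j. ts(E := ones (?h - Suc l), D := ones (n * l + j))"
    have "runs (FOR N N' (PUSH D 1)) (?T 0) (n * (2 + 8) + 2) ((?T n)(N := ones n, N' := ones 0))"
    proof (rule runs_FOR[where S = ?T])
      fix j u v
      show "runs (PUSH D 1) ((?T j)(N := u, N' := v)) 2 ((?T (Suc j))(N := u, N' := v))"
        by (rule runs_conv[OF runs_PUSH_ones[of _ _ "n * l + j"]]) (use assms(5) in auto)
    qed (use assms in \<open>auto simp: fun_eq_iff\<close>)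
    then have b: "runs (FOR N N' (PUSH D 1)) (?T 0) (n * (2 + 8) + 2) (?S (Suc l))"
      by (rule runs_conv) (use assms in \<open>auto simp: fun_eq_iff algebra_simps\<close>)
    show "runs (POP E ;; FOR N N' (PUSH D 1)) (?S l) (1 + (n * (2 + 8) + 2)) (?S (Suc l))"
      by (rule runs_Seq[OF a]) (use b in simp)
  qed (use assms(5) in \<open>auto simp: ones_head\<close>)
  have h3: "runs (Loop E (\<lambda>s. s \<noteq> 0) (POP E ;; FOR N N' (PUSH D 1))) (ts(E := ones ?h, D := ones 0))
      (?h * ((1 + (n * 10 + 2)) + 2) + 1) (ts(D := ones (n * ?h)))"
  proof -
    have S0: "?S 0 = ts(E := ones ?h, D := ones 0)" by simp
    have Sn: "?S ?h = ts(D := ones (n * ?h))" using assms by (auto simp: fun_eq_iff)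
    from 3 show ?thesis unfolding S0 Sn by (rule runs_mono) simp
  qed
  have 4: "runs (PUSHES D c) (ts(D := ones (n * ?h))) (2 * c + 1) (ts(D := ones (horner (c # cs) n)))"
    by (rule runs_conv[OF runs_PUSHES[of _ _ "n * ?h"]]) auto
  show ?case
    unfolding PEVAL.simps by (rule runs_conv[OF runs_Seq[OF Cons runs_Seq[OF 2 runs_Seq[OF h3 4]]]]) auto
qed

section \<open>Sampling one record per block\<close>

abbreviation (input) inT :: nat where "inT \<equiv> 0"
abbreviation (input) xT :: nat where "xT \<equiv> 2"
abbreviation (input) nT :: nat where "nT \<equiv> 3"
abbreviation (input) tmpT :: nat where "tmpT \<equiv> 4"
abbreviation (input) kT :: nat where "kT \<equiv> 5"
abbreviation (input) skipT :: nat where "skipT \<equiv> 6"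
abbreviation (input) yT :: nat where "yT \<equiv> 7"
abbreviation (input) aT :: nat where "aT \<equiv> 8"
abbreviation (input) rT :: nat where "rT \<equiv> 9"
abbreviation (input) mT :: nat where "mT \<equiv> 10"
abbreviation (input) sT :: nat where "sT \<equiv> 11"
abbreviation (input) lT :: nat where "lT \<equiv> 12"
abbreviation (input) c1T :: nat where "c1T \<equiv> 13"
abbreviation (input) c2T :: nat where "c2T \<equiv> 14"
abbreviation (input) zT :: nat where "zT \<equiv> 15"
abbreviation (input) uT :: nat where "uT \<equiv> 16"
abbreviation (input) vT :: nat where "vT \<equiv> 17"
abbreviation (input) accT :: nat where "accT \<equiv> 18"
abbreviation (input) eT :: nat where "eT \<equiv> 19"
abbreviation (input) c3T :: nat where "c3T \<equiv> 20"

definition DROP :: com where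
  "DROP = FOR mT c3T (POP yT ;; POP aT)"

text \<open>A one among the coins drops a record, a zero leaves a mark on \<open>zT\<close>. After
  the picked record has been taken, every mark drops one more record. So a block of
  \<open>s + 1\<close> records is always consumed in full, and the index is never computed.\<close>

definition PICK :: com where
  "PICK = FOR sT c2T (Cond rT (\<lambda>s. s = 3) DROP (PUSH zT 1) ;; POP rT) ;;
     TAKE mT c3T yT uT ;; TAKE mT c3T aT vT ;; PUSH uT 1 ;; PUSH vT 1 ;;
     Loop zT (\<lambda>s. s \<noteq> 0) (POP zT ;; DROP)"

text \<open>The query is assembled back to front on the stack \<open>w\<close>: coins, answers, and
  finally the questions with the input. \<open>uT\<close> and \<open>vT\<close> collect the
  questions and the answers in reversed form during a single pass over the blocks.\<close>

definition QUERY :: "nat \<Rightarrow> com" where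
  "QUERY w = Loop xT (\<lambda>s. s \<noteq> 0) (DUP xT tmpT uT) ;; MOVE tmpT xT ;; PUSH uT 1 ;;
     FOR kT c1T PICK ;;
     TAKE lT c3T rT tmpT ;; PUSH w 1 ;; MOVE tmpT w ;; MOVE vT w ;; MOVE uT w"

text \<open>
  A question consists of blocks of \<open>s + 1\<close> records of \<open>m\<close> bits, one block for each prover. The number
  of ones among \<open>s\<close> coins is the index of the record that is used; binomial weights are as good
  as uniform ones for the concentration argument and need no arithmetic on the tapes.
\<close>

definition pick :: "nat \<Rightarrow> nat \<Rightarrow> bool list \<Rightarrow> bool list \<Rightarrow> nat \<Rightarrow> bool list" where
  "pick m s y r j =
     take m (drop ((j * (s + 1) + count_list (take s (drop (j * s) r)) True) * m) y)"

definition query :: "bool list \<Rightarrow> nat \<Rightarrow> nat \<Rightarrow> nat \<Rightarrow> nat \<Rightarrow> bool list \<Rightarrow> bool list \<Rightarrow> bool list \<Rightarrow> bool list list" where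
  "query x k m s l y a r =
     x # map (pick m s y r) [0..<k] @ map (pick m s a r) [0..<k] @ [take l (drop (k * s) r)]"

lemma wf_query [simp]:
  "21 \<le> N \<Longrightarrow> 1 < G \<Longrightarrow> wf_com N G DROP"
  "21 \<le> N \<Longrightarrow> 1 < G \<Longrightarrow> wf_com N G PICK"
  "21 \<le> N \<Longrightarrow> 1 < G \<Longrightarrow> 21 \<le> w \<Longrightarrow> wf_com N G (QUERY w)"
  by (simp_all add: DROP_def PICK_def QUERY_def)

lemma runs_DROP:
  assumes "ts mT = ones m" "ts c3T = ones 0" "ts yT = contents ys" "ts aT = contents as"
  shows "runs DROP ts (m * 10 + 2) (ts(yT := contents (drop m ys), aT := contents (drop m as)))"
proof -
  let ?S = "\<lambda>j. ts(yT := contents (drop j ys), aT := contents (drop j as))"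
  have "runs DROP ts (m * (2 + 8) + 2) ((?S m)(mT := ones m, c3T := ones 0))"
    unfolding DROP_def
  proof (rule runs_FOR[where S = ?S])
    fix j u v
    have 1: "runs (POP yT) ((?S j)(mT := u, c3T := v)) 1
        ((?S j)(mT := u, c3T := v, yT := contents (drop (Suc j) ys)))"
      by (rule runs_conv[OF runs_POP[of _ _ "drop j ys"]]) (auto simp: drop_Suc tl_drop)
    have 2: "runs (POP aT) ((?S j)(mT := u, c3T := v, yT := contents (drop (Suc j) ys))) 1
        ((?S (Suc j))(mT := u, c3T := v))"
      by (rule runs_conv[OF runs_POP[of _ _ "drop j as"]]) (auto simp: drop_Suc tl_drop fun_eq_iff)
    show "runs (POP yT ;; POP aT) ((?S j)(mT := u, c3T := v)) 2 ((?S (Suc j))(mT := u, c3T := v))"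
      using runs_Seq[OF 1 2] by (rule runs_mono) simp
  qed (use assms in \<open>auto simp: fun_eq_iff\<close>)
  then show ?thesis by (rule runs_conv) (use assms in \<open>auto simp: fun_eq_iff\<close>)
qed

lemma count_list_le_length: "count_list xs x \<le> length xs"
  by (induction xs) auto

lemma count_take_le: "count_list (take n xs) x \<le> n"
  by (rule order_trans[OF count_list_le_length]) simp

lemma runs_PICK:
  assumes "ts mT = ones m" "ts c3T = ones 0" "ts sT = ones s" "ts c2T = ones 0" "ts zT = ones 0"
    and "ts yT = contents (bits y)" "ts aT = contents (bits a)" "ts rT = contents (bits r)"
    and "ts uT = contents us" "ts vT = contents vs"
  defines "c \<equiv> count_list (take s r) True"
  shows "runs PICK ts (s * (20 * m + 18) + 24 * m + 11)
    (ts(yT := contents (bits (drop ((s + 1) * m) y)), aT := contents (bits (drop ((s + 1) * m) a)),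
        rT := contents (bits (drop s r)),
        uT := contents (1 # rev (bits (take m (drop (c * m) y))) @ us),
        vT := contents (1 # rev (bits (take m (drop (c * m) a))) @ vs)))"
proof -
  \<comment> \<open>The number of records dropped after \<open>j\<close> coins; the other
    \<open>j - d j\<close> coins are the marks on \<open>zT\<close>.\<close>
  define d where "d = (\<lambda>j. count_list (take j r) True)"
  let ?S = "\<lambda>j. ts(yT := contents (bits (drop (d j * m) y)), aT := contents (bits (drop (d j * m) a)),
      zT := ones (j - d j), rT := contents (bits (drop j r)))"
  let ?Q = "FOR sT c2T (Cond rT (\<lambda>s. s = 3) DROP (PUSH zT 1) ;; POP rT)"
  have dle: "d j \<le> j" for j by (simp add: d_def count_take_le)
  have 1: "runs ?Q ts (s * ((m * 10 + 5) + 8) + 2) ((?S s)(sT := ones s, c2T := ones 0))"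
  proof (rule runs_FOR[where S = ?S])
    fix j u v
    let ?t = "(?S j)(sT := u, c2T := v)"
    let ?t' = "(?S (Suc j))(sT := u, c2T := v)"
    have dS: "d (Suc j) = (if j < length r \<and> r ! j then Suc (d j) else d j)"
      by (cases "j < length r") (auto simp: d_def take_Suc_conv_app_nth)
    \<comment> \<open>When the coins run out, the head reads a blank. It counts as a zero, just as
      \<open>count_list\<close> of the truncated \<open>take\<close> does.\<close>
    have hd: "?t rT 0 = 3 \<longleftrightarrow> j < length r \<and> r ! j"
      by (cases "j < length r") (auto simp: contents_head hd_map hd_drop_conv_nth bit_symbol_def)
    have a: "runs (Cond rT (\<lambda>s. s = 3) DROP (PUSH zT 1)) ?t ((m * 10 + 2) + 2)
        (?t'(rT := contents (bits (drop j r))))"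
    proof (rule runs_Cond)
      assume "?t rT 0 = 3"
      then have t: "d (Suc j) = Suc (d j)" using hd dS by simp
      show "runs DROP ?t (m * 10 + 2) (?t'(rT := contents (bits (drop j r))))"
        by (rule runs_conv[OF runs_DROP[of _ m "bits (drop (d j * m) y)" "bits (drop (d j * m) a)"]])
           (use assms(1,2) t in \<open>auto simp: fun_eq_iff drop_map\<close>)
    next
      assume "\<not> ?t rT 0 = 3"
      then have t: "d (Suc j) = d j" using hd dS by auto
      show "runs (PUSH zT 1) ?t (m * 10 + 2) (?t'(rT := contents (bits (drop j r))))"
        by (rule runs_conv[OF runs_PUSH_ones[of _ _ "j - d j"]])
           (use dle[of j] t in \<open>auto simp: fun_eq_iff Suc_diff_le\<close>)
    qed
    have b: "runs (POP rT) (?t'(rT := contents (bits (drop j r)))) 1 ?t'"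
      by (rule runs_conv[OF runs_POP[of _ _ "bits (drop j r)"]])
         (auto simp: fun_eq_iff map_tl[symmetric] drop_Suc tl_drop)
    show "runs (Cond rT (\<lambda>s. s = 3) DROP (PUSH zT 1) ;; POP rT) ?t (m * 10 + 5) ?t'"
      using runs_Seq[OF a b] by (rule runs_mono) simp
  qed (use assms in \<open>auto simp: d_def fun_eq_iff\<close>)
  have dc: "d s = c" by (simp add: d_def c_def)
  define t1 where "t1 = ts(yT := contents (bits (drop (c * m) y)), aT := contents (bits (drop (c * m) a)),
      zT := ones (s - c), rT := contents (bits (drop s r)))"
  have r1: "runs ?Q ts (s * ((m * 10 + 5) + 8) + 2) t1"
    by (rule runs_conv[OF 1]) (use assms in \<open>auto simp: t1_def dc fun_eq_iff\<close>)
  define t2 where "t2 = t1(yT := contents (bits (drop ((c + 1) * m) y)),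
      uT := contents (rev (bits (take m (drop (c * m) y))) @ us))"
  have r2: "runs (TAKE mT c3T yT uT) t1 (m * 12 + 2) t2"
    by (rule runs_conv[OF runs_TAKE[of _ _ m _ _ "bits (drop (c * m) y)" _ us]])
       (use assms in \<open>auto simp: t1_def t2_def drop_map take_map\<close>)
  define t3 where "t3 = t2(aT := contents (bits (drop ((c + 1) * m) a)),
      vT := contents (rev (bits (take m (drop (c * m) a))) @ vs))"
  have r3: "runs (TAKE mT c3T aT vT) t2 (m * 12 + 2) t3"
    by (rule runs_conv[OF runs_TAKE[of _ _ m _ _ "bits (drop (c * m) a)" _ vs]])
       (use assms in \<open>auto simp: t1_def t2_def t3_def drop_map take_map\<close>)
  define t4 where "t4 = t3(uT := contents (1 # rev (bits (take m (drop (c * m) y))) @ us))"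
  have r4: "runs (PUSH uT 1) t3 2 t4"
    by (rule runs_conv[OF runs_PUSH[of _ _ "rev (bits (take m (drop (c * m) y))) @ us"]])
       (auto simp: t2_def t3_def t4_def)
  define t5 where "t5 = t4(vT := contents (1 # rev (bits (take m (drop (c * m) a))) @ vs))"
  have r5: "runs (PUSH vT 1) t4 2 t5"
    by (rule runs_conv[OF runs_PUSH[of _ _ "rev (bits (take m (drop (c * m) a))) @ vs"]])
       (auto simp: t2_def t3_def t4_def t5_def)
  let ?U = "\<lambda>j. t5(zT := ones (s - c - j), yT := contents (bits (drop ((c + 1 + j) * m) y)),
     aT := contents (bits (drop ((c + 1 + j) * m) a)))"
  have L: "runs (Loop zT (\<lambda>s. s \<noteq> 0) (POP zT ;; DROP)) (?U 0) ((s - c) * ((1 + (m * 10 + 2)) + 2) + 1) (?U (s - c))"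
  proof (rule runs_Loop[where S = ?U])
    fix j assume j: "j < s - c"
    show "?U j zT 0 \<noteq> 0" using j by (simp add: ones_head)
    have a: "runs (POP zT) (?U j) 1 ((?U j)(zT := ones (s - c - Suc j)))"
      by (rule runs_conv[OF runs_POP_ones[of _ _ "s - c - j"]]) (auto simp: fun_eq_iff)
    have b: "runs DROP ((?U j)(zT := ones (s - c - Suc j))) (m * 10 + 2) (?U (Suc j))"
      by (rule runs_conv[OF runs_DROP[of _ m "bits (drop ((c + 1 + j) * m) y)" "bits (drop ((c + 1 + j) * m) a)"]])
         (use assms(1,2) in \<open>auto simp: t1_def t2_def t3_def t4_def t5_def fun_eq_iff drop_map algebra_simps\<close>)
    show "runs (POP zT ;; DROP) (?U j) (1 + (m * 10 + 2)) (?U (Suc j))"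
      by (rule runs_Seq[OF a b])
  qed (auto simp: ones_head)
  have "c \<le> s" using dle[of s] dc by simp
  have U0: "?U 0 = t5"
    by (auto simp: t1_def t2_def t3_def t4_def t5_def fun_eq_iff)
  have e: "(1 + (m * 10 + 2)) + 2 = m * 10 + 5" by simp
  have "(s - c) * ((1 + (m * 10 + 2)) + 2) + 1 \<le> s * (m * 10 + 5) + 1"
    unfolding e by (intro add_le_mono1 mult_le_mono1) simp
  then have r6: "runs (Loop zT (\<lambda>s. s \<noteq> 0) (POP zT ;; DROP)) t5 (s * (m * 10 + 5) + 1) (?U (s - c))"
    by (rule runs_mono[OF L[unfolded U0]])
  show ?thesis unfolding PICK_def
    by (rule runs_conv[OF runs_Seq[OF r1 runs_Seq[OF r2 runs_Seq[OF r3 runs_Seq[OF r4 runs_Seq[OF r5 r6]]]]]])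
       (use \<open>c \<le> s\<close> assms(5) in \<open>auto simp: t1_def t2_def t3_def t4_def t5_def fun_eq_iff algebra_simps\<close>)
qed

lemma runs_QUERY:
  assumes "ts mT = ones m" "ts sT = ones s" "ts lT = ones l" "ts kT = ones k"
    and "ts c1T = ones 0" "ts c2T = ones 0" "ts c3T = ones 0" "ts zT = ones 0"
    and "ts tmpT = contents []" "ts uT = contents []" "ts vT = contents []" "ts w = contents []"
    and "ts xT = contents (bits x)"
    and "ts yT = contents (bits y)" "ts aT = contents (bits a)" "ts rT = contents (bits r)"
    and w: "21 \<le> w"
  shows "runs (QUERY w) ts (14 * length x + k * (s * (20 * m + 18) + 32 * m + 27) + 16 * l + 30)
    (ts(yT := contents (bits (drop (k * (s + 1) * m) y)), aT := contents (bits (drop (k * (s + 1) * m) a)),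
        rT := contents (bits (drop (k * s + l) r)), w := contents (encode (query x k m s l y a r))))"
proof -
  let ?S = "\<lambda>j. ts(xT := contents (bits (drop j x)), tmpT := contents (rev (bits (take j x))),
     uT := contents (rev (bits (take j x))))"
  have "runs (Loop xT (\<lambda>s. s \<noteq> 0) (DUP xT tmpT uT)) (?S 0) (length x * (4 + 2) + 1) (?S (length x))"
  proof (rule runs_Loop[where S = ?S])
    fix j assume j: "j < length x"
    then have d: "drop j x = x ! j # drop (Suc j) x" by (simp add: Cons_nth_drop_Suc)
    show "?S j xT 0 \<noteq> 0" by (simp add: contents_head d)
    show "runs (DUP xT tmpT uT) (?S j) 4 (?S (Suc j))"
      by (rule runs_conv[OF runs_DUP[of _ _ "bit_symbol (x ! j)" "bits (drop (Suc j) x)" _ "rev (bits (take j x))" _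
            "rev (bits (take j x))"]])
         (use j d in \<open>auto simp: take_Suc_conv_app_nth fun_eq_iff\<close>)
  qed (auto simp: contents_head)
  moreover have "?S 0 = ts" using assms by (auto simp: fun_eq_iff)
  moreover define t1 where "t1 = ts(xT := contents [], tmpT := contents (rev (bits x)), uT := contents (rev (bits x)))"
  moreover have "?S (length x) = t1" by (simp add: t1_def)
  ultimately have r1: "runs (Loop xT (\<lambda>s. s \<noteq> 0) (DUP xT tmpT uT)) ts (length x * (4 + 2) + 1) t1"
    by metis
  define t2 where "t2 = ts(uT := contents (rev (bits x)))"
  have r2: "runs (MOVE tmpT xT) t1 (4 * length (rev (bits x)) + 1) t2"
    by (rule runs_conv[OF runs_MOVE[of _ _ "rev (bits x)" _ "[]"]])
       (use assms in \<open>auto simp: t1_def t2_def fun_eq_iff simp del: set_map\<close>)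
  define t3 where "t3 = ts(uT := contents (1 # rev (bits x)))"
  have r3: "runs (PUSH uT 1) t2 2 t3"
    by (rule runs_conv[OF runs_PUSH[of _ _ "rev (bits x)"]]) (auto simp: t2_def t3_def)
  define ys where "ys = (\<lambda>j. map (pick m s y r) [0..<j])"
  define as where "as = (\<lambda>j. map (pick m s a r) [0..<j])"
  let ?V = "\<lambda>j. ts(yT := contents (bits (drop (j * (s + 1) * m) y)), aT := contents (bits (drop (j * (s + 1) * m) a)),
     rT := contents (bits (drop (j * s) r)), uT := contents (rev (encode (x # ys j))), vT := contents (rev (encode (as j))))"
  have "runs (FOR kT c1T PICK) t3 (k * ((s * (20 * m + 18) + 24 * m + 11) + 8) + 2) ((?V k)(kT := ones k, c1T := ones 0))"
  proof (rule runs_FOR[where S = ?V])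
    fix j p q
    show "runs PICK ((?V j)(kT := p, c1T := q)) (s * (20 * m + 18) + 24 * m + 11) ((?V (Suc j))(kT := p, c1T := q))"
      by (rule runs_conv[OF runs_PICK[of _ m s "drop (j * (s + 1) * m) y" "drop (j * (s + 1) * m) a" "drop (j * s) r"
            "rev (encode (x # ys j))" "rev (encode (as j))"]])
         (use assms in \<open>auto simp: fun_eq_iff ys_def as_def pick_def algebra_simps\<close>)
  qed (use assms in \<open>auto simp: t3_def fun_eq_iff ys_def as_def\<close>)
  then have r4: "runs (FOR kT c1T PICK) t3 (k * ((s * (20 * m + 18) + 24 * m + 11) + 8) + 2) (?V k)"
    by (rule runs_conv) (use assms in \<open>auto simp: fun_eq_iff\<close>)
  define rr where "rr = take l (drop (k * s) r)"
  define t5 where "t5 = (?V k)(rT := contents (bits (drop (k * s + l) r)), tmpT := contents (rev (bits rr)))"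
  have r5: "runs (TAKE lT c3T rT tmpT) (?V k) (l * 12 + 2) t5"
    by (rule runs_conv[OF runs_TAKE[of _ _ l _ _ "bits (drop (k * s) r)" _ "[]"]])
       (use assms in \<open>auto simp: t5_def rr_def drop_map take_map algebra_simps\<close>)
  define t6 where "t6 = t5(w := contents [1])"
  have r6: "runs (PUSH w 1) t5 2 t6"
    by (rule runs_conv[OF runs_PUSH[of _ _ "[]"]]) (use assms in \<open>auto simp: t5_def t6_def\<close>)
  define t7 where "t7 = t6(tmpT := contents [], w := contents (encode [rr]))"
  have r7: "runs (MOVE tmpT w) t6 (4 * length (rev (bits rr)) + 1) t7"
    by (rule runs_conv[OF runs_MOVE[of _ _ "rev (bits rr)" _ "[1]"]])
       (use w in \<open>auto simp: t5_def t6_def t7_def simp del: set_map\<close>)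
  define t8 where "t8 = t7(vT := contents [], w := contents (encode (as k @ [rr])))"
  have r8: "runs (MOVE vT w) t7 (4 * length (rev (encode (as k))) + 1) t8"
    by (rule runs_conv[OF runs_MOVE[of _ _ "rev (encode (as k))" _ "encode [rr]"]])
       (use w in \<open>auto simp: t5_def t6_def t7_def t8_def simp del: set_map\<close>)
  define t9 where "t9 = t8(uT := contents [], w := contents (encode ((x # ys k) @ as k @ [rr])))"
  have r9: "runs (MOVE uT w) t8 (4 * length (rev (encode (x # ys k))) + 1) t9"
    by (rule runs_conv[OF runs_MOVE[of _ _ "rev (encode (x # ys k))" _ "encode (as k @ [rr])"]])
       (use w in \<open>auto simp: t5_def t6_def t7_def t8_def t9_def simp del: set_map encode_simps(2,3)\<close>, use w in simp)
  have le: "length (encode (map (pick m s z r) [0..<j])) \<le> j * (m + 1)" for z j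
    by (induction j) (auto simp: pick_def)
  have ly: "length (encode (x # ys k)) \<le> length x + 1 + k * (m + 1)" using le[of y k] by (simp add: ys_def)
  have la: "length (encode (as k)) \<le> k * (m + 1)" using le[of a k] by (simp add: as_def)
  have lr: "length rr \<le> l" by (simp add: rr_def)
  show ?thesis unfolding QUERY_def
  proof (rule runs_conv[OF runs_Seq[OF r1 runs_Seq[OF r2 runs_Seq[OF r3 runs_Seq[OF r4 runs_Seq[OF r5
        runs_Seq[OF r6 runs_Seq[OF r7 runs_Seq[OF r8 r9]]]]]]]]], goal_cases)
    case 1
    show ?case
      using assms w by (auto simp: t5_def t6_def t7_def t8_def t9_def fun_eq_iff query_def ys_def as_def rr_def
        simp del: encode_simps(2,3))
  next
    case 2
    show ?case using ly la lr by (simp add: algebra_simps del: encode_simps)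
  qed
qed

section \<open>The new verifier\<close>

definition computes :: "machine \<Rightarrow> nat poly \<Rightarrow> (bool list list \<Rightarrow> bool list) \<Rightarrow> bool" where
  "computes M p f \<longleftrightarrow> turing_machine M \<and>
     (\<forall>ws. \<exists>ts. (step M ^^ poly p (length (encode ws))) (initial_config M (encode ws)) = (num_states M, ts) \<and>
        fst (ts ! 1) = contents (bits (f ws)))"

lemma polytime_computes: "polytime f \<longleftrightarrow> (\<exists>M p. computes M p f)"
  by (auto simp: polytime_def computes_def)

lemma poly_nat_mono: "a \<le> b \<Longrightarrow> poly p a \<le> poly p (b :: nat)"
  by (induction p) (auto intro: add_mono mult_mono)

lemma runs_CALL_computes:
  assumes "computes M p f"
    and ts: "ts b = contents (encode ws)" "\<And>j. b < j \<Longrightarrow> j < b + num_tapes M + 3 \<Longrightarrow> ts j = contents []"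
    and dest: "ts dest = ones d" "dest < b \<or> b + num_tapes M + 3 \<le> dest"
  obtains ts' where "runs (CALL M b dest) ts (62 * poly p (length (encode ws)) + 16) ts'"
    "ts' dest = ones (d + count_list (f ws) True)"
    "\<And>j. j \<noteq> dest \<Longrightarrow> j < b \<or> b + num_tapes M + 3 \<le> j \<Longrightarrow> ts' j = ts j"
proof -
  obtain tps where "(step M ^^ poly p (length (encode ws))) (initial_config M (encode ws)) = (num_states M, tps)"
     "fst (tps ! 1) = contents (bits (f ws))"
    using assms(1) unfolding computes_def by blast
  from runs_CALL[OF _ this encode_symbols ts dest] assms(1) that show ?thesis
    unfolding computes_def by blast
qed

text \<open>A machine cannot write more symbols than its running time permits. This bounds
  \<open>k_of\<close> and \<open>j_of\<close> in the time analysis; the bound is read off from the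
  last clause of \<open>runs_CALL\<close>.\<close>

lemma computes_count:
  assumes "computes M p f"
  shows "count_list (f ws) True \<le> 3 * poly p (length (encode ws)) + 1"
proof -
  obtain tps where *: "(step M ^^ poly p (length (encode ws))) (initial_config M (encode ws)) = (num_states M, tps)"
     "fst (tps ! 1) = contents (bits (f ws))"
    using assms unfolding computes_def by blast
  have M: "turing_machine M" using assms by (simp add: computes_def)
  \<comment> \<open>The call is only a thought experiment about \<open>runs\<close> and not part of
    a well-formed program, so it may use tape 1 as its base and tape 0 as its counter.\<close>
  let ?ts = "\<lambda>j :: nat. if j = 1 then contents (encode ws) else contents []"
  have "\<exists>ts'. runs (CALL M 1 0) ?ts (62 * poly p (length (encode ws)) + 16) ts' \<and>
     ts' 0 = ones (0 + count_list (f ws) True) \<and>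
     (\<forall>j. j \<noteq> 0 \<longrightarrow> j < 1 \<or> 1 + num_tapes M + 3 \<le> j \<longrightarrow> ts' j = ?ts j) \<and>
     count_list (f ws) True \<le> 3 * poly p (length (encode ws)) + 1"
    by (rule runs_CALL[OF M * encode_symbols]) (auto simp: ones_def)
  then show ?thesis by blast
qed

definition majority :: "bool \<Rightarrow> bool \<Rightarrow> bool \<Rightarrow> bool" where
  "majority a b c \<longleftrightarrow> a \<and> b \<or> a \<and> c \<or> b \<and> c"

text \<open>A call leaves the tapes of the simulated machine and its clock with unknown contents.
  Hence every round works on fresh tapes: all tapes from \<open>b\<close> on are still blank.
  \<open>d\<close> is the number of rounds accepted so far.\<close>

definition query_ready where
  "query_ready x k m s l y a r d b ts \<longleftrightarrow>
    ts mT = ones m \<and> ts sT = ones s \<and> ts lT = ones l \<and> ts kT = ones k \<and>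
    ts c1T = ones 0 \<and> ts c2T = ones 0 \<and> ts c3T = ones 0 \<and> ts zT = ones 0 \<and>
    ts tmpT = contents [] \<and> ts uT = contents [] \<and> ts vT = contents [] \<and>
    ts xT = contents (bits x) \<and>
    ts yT = contents (bits y) \<and> ts aT = contents (bits a) \<and> ts rT = contents (bits r) \<and>
    ts accT = ones d \<and> (\<forall>j\<ge>b. ts j = contents []) \<and> ts 1 = contents []"

lemma length_encode_query:
  "length (encode (query x k m s l y a r)) \<le> length x + 2 * k * (m + 1) + l + 2"
proof -
  have le: "length (encode (map (pick m s z r) [0..<j])) \<le> j * (m + 1)" for z j
    by (induction j) (auto simp: pick_def)
  show ?thesis using le[of y k] le[of a k] by (simp add: query_def)
qed

definition round_time :: "nat poly \<Rightarrow> nat \<Rightarrow> nat \<Rightarrow> nat \<Rightarrow> nat \<Rightarrow> nat \<Rightarrow> nat" where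
  "round_time p n k m s l = 14 * n + k * (s * (20 * m + 18) + 32 * m + 27) + 16 * l + 30 +
     (62 * poly p (n + 2 * k * (m + 1) + l + 2) + 16)"

lemma runs_round:
  assumes "query_ready x k m s l y a r d b ts" "computes M p (\<lambda>ws. [V ws])" "21 \<le> b"
  obtains ts' where "runs (QUERY b ;; CALL M b accT) ts (round_time p (length x) k m s l) ts'"
    "query_ready x k m s l (drop (k * (s + 1) * m) y) (drop (k * (s + 1) * m) a) (drop (k * s + l) r)
       (d + of_bool (V (query x k m s l y a r))) (b + num_tapes M + 3) ts'"
proof -
  define Q where "Q = query x k m s l y a r"
  define t1 where "t1 = ts(yT := contents (bits (drop (k * (s + 1) * m) y)), aT := contents (bits (drop (k * (s + 1) * m) a)),
        rT := contents (bits (drop (k * s + l) r)), b := contents (encode Q))"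
  have 1: "runs (QUERY b) ts (14 * length x + k * (s * (20 * m + 18) + 32 * m + 27) + 16 * l + 30) t1"
    unfolding t1_def Q_def
    by (rule runs_QUERY) (use assms in \<open>simp_all add: query_ready_def\<close>)
  obtain t2 where 2: "runs (CALL M b accT) t1 (62 * poly p (length (encode Q)) + 16) t2"
    "t2 accT = ones (d + count_list [V Q] True)"
    "\<And>j. j \<noteq> accT \<Longrightarrow> j < b \<or> b + num_tapes M + 3 \<le> j \<Longrightarrow> t2 j = t1 j"
    by (rule runs_CALL_computes[OF assms(2), of t1 b Q accT d])
       (use assms(1,3) in \<open>auto simp: t1_def query_ready_def\<close>)
  have "62 * poly p (length (encode Q)) + 16 \<le> 62 * poly p (length x + 2 * k * (m + 1) + l + 2) + 16"
    using length_encode_query unfolding Q_def by (simp add: poly_nat_mono del: encode_simps)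
  from runs_Seq[OF 1 runs_mono[OF 2(1) this]] show ?thesis
    by (rule that[unfolded round_time_def])
      (use 2(2,3) assms(1,3) in \<open>auto simp: query_ready_def t1_def Q_def\<close>)
qed

section \<open>Quantities bounded by a polynomial in the input length\<close>

definition size_bounded :: "(bool list list \<Rightarrow> nat) \<Rightarrow> bool" where
  "size_bounded h \<longleftrightarrow> (\<exists>p :: nat poly. \<forall>ws. h ws \<le> poly p (length (encode ws)))"

lemma size_bounded_mono: "size_bounded h \<Longrightarrow> (\<And>ws. h' ws \<le> h ws) \<Longrightarrow> size_bounded h'"
  unfolding size_bounded_def by (meson order_trans)

lemma size_bounded_const: "size_bounded (\<lambda>_. c)"
  unfolding size_bounded_def by (rule exI[of _ "[:c:]"]) simp

lemma size_bounded_length: "size_bounded (\<lambda>ws. length (encode ws))"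
  unfolding size_bounded_def by (rule exI[of _ "[:0, 1:]"]) simp

lemma size_bounded_add:
  assumes "size_bounded h" "size_bounded h'"
  shows "size_bounded (\<lambda>ws. h ws + h' ws)"
proof -
  obtain p p' :: "nat poly" where "\<And>ws. h ws \<le> poly p (length (encode ws))" "\<And>ws. h' ws \<le> poly p' (length (encode ws))"
    using assms unfolding size_bounded_def by blast
  then show ?thesis unfolding size_bounded_def by (intro exI[of _ "p + p'"]) (simp add: add_mono)
qed

lemma size_bounded_mult:
  assumes "size_bounded h" "size_bounded h'"
  shows "size_bounded (\<lambda>ws. h ws * h' ws)"
proof -
  obtain p p' :: "nat poly" where "\<And>ws. h ws \<le> poly p (length (encode ws))" "\<And>ws. h' ws \<le> poly p' (length (encode ws))"
    using assms unfolding size_bounded_def by blast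
  then show ?thesis unfolding size_bounded_def by (intro exI[of _ "p * p'"]) (simp add: mult_le_mono)
qed

lemma size_bounded_poly:
  assumes "size_bounded h"
  shows "size_bounded (\<lambda>ws. poly p (h ws))"
proof -
  obtain p' :: "nat poly" where "\<And>ws. h ws \<le> poly p' (length (encode ws))"
    using assms unfolding size_bounded_def by blast
  then show ?thesis unfolding size_bounded_def by (intro exI[of _ "pcompose p p'"]) (simp add: poly_pcompose poly_nat_mono)
qed

lemmas size_bounded_intros = size_bounded_const size_bounded_length size_bounded_add size_bounded_mult size_bounded_poly

lemma size_bounded_horner: "size_bounded h \<Longrightarrow> size_bounded (\<lambda>ws. horner cs (h ws))"
  by (induction cs) (simp_all add: size_bounded_intros)

lemma size_bounded_peval_time: "size_bounded h \<Longrightarrow> size_bounded (\<lambda>ws. peval_time cs (h ws))"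
proof (induction cs)
  case Nil then show ?case by (simp add: size_bounded_const)
next
  case (Cons c cs)
  show ?case unfolding peval_time.simps
    by (intro size_bounded_intros size_bounded_horner Cons)
qed

lemma size_bounded_count:
  assumes "computes M p f" "size_bounded h"
  shows "size_bounded (\<lambda>ws. count_list (f [replicate (h ws) True]) True)"
proof (rule size_bounded_mono)
  show "size_bounded (\<lambda>ws. 3 * poly p (h ws + 1) + 1)" by (intro size_bounded_intros assms)
  show "count_list (f [replicate (h ws) True]) True \<le> 3 * poly p (h ws + 1) + 1" for ws
    using computes_count[OF assms(1), of "[replicate (h ws) True]"] by simp
qed

text \<open>\<open>V\<close> is the given verifier; \<open>f\<close> and \<open>g\<close> compute
  the old and the new number of provers in unary. \<open>q\<close> is the length of a record,
  \<open>s\<close> the number of coins that pick a record, \<open>l\<close> the number of coins of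
  \<open>V\<close>, and \<open>e\<close> the answer on the empty input.\<close>

locale am_machines =
  fixes V :: "bool list list \<Rightarrow> bool" and f g :: "bool list list \<Rightarrow> bool list"
    and MV Mf Mg :: machine and pV pf pg :: "nat poly"
    and q s l :: "nat poly" and e :: bool
  assumes V: "computes MV pV (\<lambda>ws. [V ws])" and f: "computes Mf pf f" and g: "computes Mg pg g"
begin

text \<open>The first 21 tapes are the named working tapes. Each of the five calls owns the tapes of
  its machine and three more, for the state and the two halves of the clock.\<close>

definition b1 :: nat where "b1 = 21"
definition b2 :: nat where "b2 = b1 + num_tapes Mf + 3"
definition b3 :: nat where "b3 = b2 + num_tapes Mg + 3"
definition b4 :: nat where "b4 = b3 + num_tapes MV + 3"
definition b5 :: nat where "b5 = b4 + num_tapes MV + 3"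
definition b6 :: nat where "b6 = b5 + num_tapes MV + 3"

text \<open>The tapes \<open>b1\<close> and \<open>b2\<close> receive the encoding of
  \<open>[replicate n True]\<close>: the separator 1 at the bottom and a bit symbol 3 on top of it
  for every bit of the input.\<close>

definition SETUP :: com where
  "SETUP = PUSH b1 1 ;; PUSH b2 1 ;;
     Loop xT (\<lambda>s. s \<noteq> 0) (XFER xT tmpT ;; PUSH nT 1 ;; PUSH b1 3 ;; PUSH b2 3) ;; MOVE tmpT xT ;;
     CALL Mf b1 kT ;; CALL Mg b2 skipT"

definition READ :: com where
  "READ = PARSE inT tmpT yT ;; POP skipT ;; FOR skipT c1T (SKIPC inT) ;; PARSE inT tmpT aT ;;
     FOR skipT c1T (SKIPC inT) ;; PARSE inT tmpT rT ;;
     PEVAL nT c1T eT mT (coeffs q) ;; PEVAL nT c1T eT sT (coeffs s) ;; PEVAL nT c1T eT lT (coeffs l)"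

definition DECIDE :: com where
  "DECIDE = (QUERY b3 ;; CALL MV b3 accT) ;; (QUERY b4 ;; CALL MV b4 accT) ;;
     (QUERY b5 ;; CALL MV b5 accT) ;; POP accT ;;
     Cond accT (\<lambda>s. s \<noteq> 0) (ACT 1 (\<lambda>_. (3, Stay))) (ACT 1 (\<lambda>_. (2, Stay)))"

definition MAIN :: com where
  "MAIN = PARSE inT tmpT xT ;;
     Cond xT (\<lambda>s. s = 0) (ACT 1 (\<lambda>_. (bit_symbol e, Stay))) (SETUP ;; READ ;; DECIDE)"

text \<open>This is the number that \<open>CALL\<close> delivers whatever the output looks like; on
  an output of the form \<open>replicate k True\<close> it is \<open>k\<close>.\<close>

definition k_of :: "nat \<Rightarrow> nat" where "k_of n = count_list (f [replicate n True]) True"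
definition j_of :: "nat \<Rightarrow> nat" where "j_of n = count_list (g [replicate n True]) True"

definition round_query :: "bool list \<Rightarrow> bool list \<Rightarrow> bool list \<Rightarrow> bool list \<Rightarrow> nat \<Rightarrow> bool list list" where
  "round_query x y a r i =
    (let n = length x; k = k_of n; m = poly q n; s = poly s n; l = poly l n; d = i * (k * (s + 1) * m) in
     query x k m s l (drop d y) (drop d a) (drop (i * (k * s + l)) r))"

definition accepts :: "bool list \<Rightarrow> bool list \<Rightarrow> bool list \<Rightarrow> bool list \<Rightarrow> bool" where
  "accepts x y a r = majority (V (round_query x y a r 0)) (V (round_query x y a r 1)) (V (round_query x y a r 2))"

text \<open>
  For the empty input there may be no prover at all, hence the hardwired answer \<open>e\<close>. Otherwise only
  the question and the answer of the first of the \<open>j_of n\<close> provers are used.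
\<close>

definition new_verifier :: "bool list list \<Rightarrow> bool" where
  "new_verifier ws =
    (let x = component ws; j = j_of (length x) - 1; ws1 = tl ws; ws2 = drop j (tl ws1); ws3 = drop j (tl ws2) in
     if x = [] then e else accepts x (component ws1) (component ws2) (component ws3))"

definition setup_time :: "nat \<Rightarrow> nat" where
  "setup_time n = 15 * n + 6 + (62 * poly pf (n + 1) + 16) + (62 * poly pg (n + 1) + 16)"

lemma runs_SETUP:
  assumes "ts xT = contents (bits x)" "\<And>j. j \<noteq> xT \<Longrightarrow> j \<noteq> inT \<Longrightarrow> ts j = contents []"
  obtains ts' where "runs SETUP ts (setup_time (length x)) ts'"
    "ts' kT = ones (k_of (length x))" "ts' skipT = ones (j_of (length x))" "ts' nT = ones (length x)"
    "ts' xT = ts xT" "ts' inT = ts inT"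
    "\<And>j. j < 21 \<or> b3 \<le> j \<Longrightarrow> j \<notin> {inT, xT, nT, kT, skipT} \<Longrightarrow> ts' j = contents []"
proof -
  let ?n = "length x"
  have bb: "21 \<le> b1" "b1 < b2" "b2 < b3" by (simp_all add: b1_def b2_def b3_def)
  have d0: "contents [] = ones 0" by (simp add: ones_def)
  define t1 where "t1 = ts(b1 := contents [1])"
  have r1: "runs (PUSH b1 1) ts 2 t1"
    by (rule runs_conv[OF runs_PUSH[of _ _ "[]"]]) (use assms bb in \<open>auto simp: t1_def\<close>)
  define t2 where "t2 = ts(b1 := contents [1], b2 := contents [1])"
  have r2: "runs (PUSH b2 1) t1 2 t2"
    by (rule runs_conv[OF runs_PUSH[of _ _ "[]"]]) (use assms bb in \<open>auto simp: t1_def t2_def\<close>)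
  let ?S = "\<lambda>j. ts(xT := contents (bits (drop j x)), tmpT := contents (rev (bits (take j x))), nT := ones j,
     b1 := contents (replicate j 3 @ [1]), b2 := contents (replicate j 3 @ [1]))"
  have L: "runs (Loop xT (\<lambda>s. s \<noteq> 0) (XFER xT tmpT ;; PUSH nT 1 ;; PUSH b1 3 ;; PUSH b2 3)) (?S 0)
     (?n * ((2 + (2 + (2 + 2))) + 2) + 1) (?S ?n)"
  proof (rule runs_Loop[where S = ?S])
    fix j assume j: "j < length x"
    then have d: "drop j x = x ! j # drop (Suc j) x" by (simp add: Cons_nth_drop_Suc)
    show "?S j xT 0 \<noteq> 0" using bb by (simp add: contents_head d)
    let ?A = "(?S j)(xT := contents (bits (drop (Suc j) x)), tmpT := contents (rev (bits (take (Suc j) x))))"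
    have a: "runs (XFER xT tmpT) (?S j) 2 ?A"
      by (rule runs_conv[OF runs_XFER[of _ _ "bit_symbol (x ! j)" "bits (drop (Suc j) x)" _ "rev (bits (take j x))"]])
         (use bb j d in \<open>auto simp: take_Suc_conv_app_nth\<close>)
    have b: "runs (PUSH nT 1) ?A 2
       (?A(nT := ones (Suc j)))"
      by (rule runs_conv[OF runs_PUSH_ones[of _ _ j]]) (use bb in auto)
    have c: "runs (PUSH b1 3) (?A(nT := ones (Suc j))) 2
       ((?S (Suc j))(b2 := contents (replicate j 3 @ [1])))"
      by (rule runs_conv[OF runs_PUSH[of _ _ "replicate j 3 @ [1]"]]) (use bb in \<open>auto simp: fun_eq_iff\<close>)
    have d: "runs (PUSH b2 3) ((?S (Suc j))(b2 := contents (replicate j 3 @ [1]))) 2 (?S (Suc j))"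
      by (rule runs_conv[OF runs_PUSH[of _ _ "replicate j 3 @ [1]"]]) (use bb in \<open>auto simp: fun_eq_iff\<close>)
    show "runs (XFER xT tmpT ;; PUSH nT 1 ;; PUSH b1 3 ;; PUSH b2 3) (?S j) (2 + (2 + (2 + 2))) (?S (Suc j))"
      by (rule runs_Seq[OF a runs_Seq[OF b runs_Seq[OF c d]]])
  qed (use bb in \<open>auto simp: contents_head\<close>)
  have S0: "?S 0 = t2" using assms bb by (auto simp: t2_def d0[symmetric] fun_eq_iff)
  define t3 where "t3 = ?S ?n"
  have r3: "runs (Loop xT (\<lambda>s. s \<noteq> 0) (XFER xT tmpT ;; PUSH nT 1 ;; PUSH b1 3 ;; PUSH b2 3)) t2 (10 * ?n + 1) t3"
    using L[unfolded S0, folded t3_def] by (rule runs_mono) simp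
  define w where "w = encode [replicate ?n True]"
  have w: "replicate ?n 3 @ [1] = w" by (simp add: w_def bit_symbol_def)
  define t4 where "t4 = ts(nT := ones ?n, b1 := contents w, b2 := contents w)"
  have r4: "runs (MOVE tmpT xT) t3 (4 * length (rev (bits x)) + 1) t4"
    by (rule runs_conv[OF runs_MOVE[of _ _ "rev (bits x)" _ "[]"]])
       (use assms bb w in \<open>auto simp: t3_def t4_def fun_eq_iff simp del: set_map\<close>)
  obtain t5 where r5: "runs (CALL Mf b1 kT) t4 (62 * poly pf (length w) + 16) t5"
    "t5 kT = ones (0 + count_list (f [replicate ?n True]) True)"
    "\<And>j. j \<noteq> kT \<Longrightarrow> j < b1 \<or> b1 + num_tapes Mf + 3 \<le> j \<Longrightarrow> t5 j = t4 j"
    unfolding w_def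
    by (rule runs_CALL_computes[OF f, of t4 b1 "[replicate ?n True]" kT 0])
       (use assms in \<open>auto simp: t4_def w_def b1_def b2_def d0[symmetric]\<close>)
  obtain t6 where r6: "runs (CALL Mg b2 skipT) t5 (62 * poly pg (length w) + 16) t6"
    "t6 skipT = ones (0 + count_list (g [replicate ?n True]) True)"
    "\<And>j. j \<noteq> skipT \<Longrightarrow> j < b2 \<or> b2 + num_tapes Mg + 3 \<le> j \<Longrightarrow> t6 j = t5 j"
    unfolding w_def
    by (rule runs_CALL_computes[OF g, of t5 b2 "[replicate ?n True]" skipT 0])
       (use assms r5(3) bb in \<open>auto simp: t4_def w_def b1_def b2_def d0[symmetric]\<close>)
  have lw: "length w = ?n + 1" by (simp add: w_def)
  have "runs SETUP ts (setup_time ?n) t6"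
    unfolding SETUP_def setup_time_def
    by (rule runs_mono[OF runs_Seq[OF r1 runs_Seq[OF r2 runs_Seq[OF r3 runs_Seq[OF r4 runs_Seq[OF r5(1) r6(1)]]]]]])
       (simp add: lw)
  then show ?thesis
  proof (rule that)
    have o: "t6 j = t4 j" if "j < 21 \<or> b3 \<le> j" "j \<noteq> kT" "j \<noteq> skipT" for j
    proof -
      have "t6 j = t5 j" using that r6(3)[of j] bb by (auto simp: b3_def)
      moreover have "t5 j = t4 j" using that r5(3)[of j] bb by (auto simp: b1_def b2_def)
      ultimately show ?thesis by simp
    qed
    show "t6 kT = ones (k_of ?n)" using r6(3)[of kT] r5(2) bb by (simp add: k_of_def)
    show "t6 skipT = ones (j_of ?n)" using r6(2) by (simp add: j_of_def)
    show "t6 nT = ones ?n" "t6 xT = ts xT" "t6 inT = ts inT"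
      using o[of nT] o[of xT] o[of inT] bb by (simp_all add: t4_def)
    show "t6 j = contents []" if "j < 21 \<or> b3 \<le> j" "j \<notin> {inT, xT, nT, kT, skipT}" for j
      using o[of j] that bb assms(2)[of j] by (auto simp: t4_def)
  qed
qed

definition read_time :: "nat \<Rightarrow> nat \<Rightarrow> nat \<Rightarrow> nat" where
  "read_time L j n = 24 * L + 10 + 2 * (j * (3 * L + 10) + 2) +
     peval_time (coeffs q) n + peval_time (coeffs s) n + peval_time (coeffs l) n"

lemma runs_READ:
  assumes "ts xT = contents (bits x)" "ts inT = contents (encode ws)" "ts kT = ones k" "ts skipT = ones j"
    "ts nT = ones n"
    "\<And>j. j < 21 \<or> b3 \<le> j \<Longrightarrow> j \<notin> {inT, xT, nT, kT, skipT} \<Longrightarrow> ts j = contents []"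
  obtains ts' where "runs READ ts (read_time (length (encode ws)) j n) ts'"
    "query_ready x k (poly q n) (poly s n) (poly l n)
       (component ws) (component (drop (j - 1) (tl ws)))
       (component (drop (j - 1) (tl (drop (j - 1) (tl ws))))) 0 b3 ts'"
proof -
  define ws2 ws3 where "ws2 = drop (j - 1) (tl ws)" and "ws3 = drop (j - 1) (tl ws2)"
  have d0: "contents [] = ones 0" by (simp add: ones_def)
  let ?L = "length (encode ws)"
  have l1: "length (encode (tl ws)) \<le> ?L" by (rule length_encode_tl)
  have l2: "length (encode ws2) \<le> ?L" using length_encode_drop[of "j - 1" "tl ws"] l1 by (simp add: ws2_def)
  have l3: "length (encode (tl ws2)) \<le> ?L" using length_encode_tl[of ws2] l2 by simp
  have l4: "length (encode ws3) \<le> ?L" using length_encode_drop[of "j - 1" "tl ws2"] l3 by (simp add: ws3_def)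
  note z = assms(6)
  have bb: "21 \<le> b3" by (simp add: b1_def b2_def b3_def)
  define t1 where "t1 = ts(inT := contents (encode (tl ws)), yT := contents (bits (component ws)))"
  have r1: "runs (PARSE inT tmpT yT) ts (8 * ?L + 3) t1"
    by (rule runs_conv[OF runs_PARSE[of _ _ ws _ _ "[]"]]) (use assms in \<open>auto simp: t1_def\<close>)
  define t2 where "t2 = t1(skipT := ones (j - 1))"
  have r2: "runs (POP skipT) t1 1 t2"
    by (rule runs_conv[OF runs_POP_ones[of _ _ j]]) (use assms in \<open>auto simp: t1_def t2_def\<close>)
  define t3 where "t3 = t2(inT := contents (encode ws2))"
  have r3: "runs (FOR skipT c1T (SKIPC inT)) t2 ((j - 1) * (3 * length (encode (tl ws)) + 10) + 2) t3"
    by (rule runs_conv[OF runs_FOR_SKIPC[of _ _ "tl ws" _ "j - 1"]])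
       (use z in \<open>auto simp: t1_def t2_def t3_def ws2_def d0\<close>)
  define t4 where "t4 = t3(inT := contents (encode (tl ws2)), aT := contents (bits (component ws2)))"
  have r4: "runs (PARSE inT tmpT aT) t3 (8 * length (encode ws2) + 3) t4"
    by (rule runs_conv[OF runs_PARSE[of _ _ ws2 _ _ "[]"]])
       (use z in \<open>auto simp: t1_def t2_def t3_def t4_def\<close>)
  define t5 where "t5 = t4(inT := contents (encode ws3))"
  have r5: "runs (FOR skipT c1T (SKIPC inT)) t4 ((j - 1) * (3 * length (encode (tl ws2)) + 10) + 2) t5"
    by (rule runs_conv[OF runs_FOR_SKIPC[of _ _ "tl ws2" _ "j - 1"]])
       (use z in \<open>auto simp: t1_def t2_def t3_def t4_def t5_def ws3_def d0\<close>)
  define t6 where "t6 = t5(inT := contents (encode (tl ws3)), rT := contents (bits (component ws3)))"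
  have r6: "runs (PARSE inT tmpT rT) t5 (8 * length (encode ws3) + 3) t6"
    by (rule runs_conv[OF runs_PARSE[of _ _ ws3 _ _ "[]"]])
       (use z in \<open>auto simp: t1_def t2_def t3_def t4_def t5_def t6_def\<close>)
  have t6z: "t6 nT = ones n" "t6 c1T = ones 0" "t6 eT = ones 0" "t6 mT = ones 0" "t6 sT = ones 0" "t6 lT = ones 0"
    using assms(5) z by (auto simp: t1_def t2_def t3_def t4_def t5_def t6_def d0)
  define t7 where "t7 = t6(mT := ones (poly q n))"
  have r7: "runs (PEVAL nT c1T eT mT (coeffs q)) t6 (peval_time (coeffs q) n) t7"
    by (rule runs_conv[OF runs_PEVAL[of _ _ n]]) (use t6z in \<open>auto simp: t7_def horner_coeffs\<close>)
  define t8 where "t8 = t7(sT := ones (poly s n))"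
  have r8: "runs (PEVAL nT c1T eT sT (coeffs s)) t7 (peval_time (coeffs s) n) t8"
    by (rule runs_conv[OF runs_PEVAL[of _ _ n]]) (use t6z in \<open>auto simp: t7_def t8_def horner_coeffs\<close>)
  define t9 where "t9 = t8(lT := ones (poly l n))"
  have r9: "runs (PEVAL nT c1T eT lT (coeffs l)) t8 (peval_time (coeffs l) n) t9"
    by (rule runs_conv[OF runs_PEVAL[of _ _ n]]) (use t6z in \<open>auto simp: t7_def t8_def t9_def horner_coeffs\<close>)
  have m1: "(j - 1) * (3 * length (encode (tl ws)) + 10) \<le> j * (3 * ?L + 10)"
    using l1 by (intro mult_le_mono) auto
  have m2: "(j - 1) * (3 * length (encode (tl ws2)) + 10) \<le> j * (3 * ?L + 10)"
    using l3 by (intro mult_le_mono) auto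
  have aux: "A \<le> J \<Longrightarrow> B \<le> J \<Longrightarrow> L2 \<le> L \<Longrightarrow> L3 \<le> L \<Longrightarrow>
      8 * L + 3 + (1 + (A + 2 + (8 * L2 + 3 + (B + 2 + (8 * L3 + 3 + (p1 + (p2 + p3))))))) \<le>
      24 * L + 10 + 2 * (J + 2) + p1 + p2 + p3" for A B J L L2 L3 p1 p2 p3 :: nat
    by simp
  have "runs READ ts (read_time ?L j n) t9"
    unfolding READ_def read_time_def
    by (rule runs_mono[OF runs_Seq[OF r1 runs_Seq[OF r2 runs_Seq[OF r3 runs_Seq[OF r4 runs_Seq[OF r5 runs_Seq[OF r6
       runs_Seq[OF r7 runs_Seq[OF r8 r9]]]]]]]] aux[OF m1 m2 l2 l4]])
  moreover have "query_ready x k (poly q n) (poly s n) (poly l n)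
       (component ws) (component ws2) (component ws3) 0 b3 t9"
    using assms bb by (auto simp: query_ready_def t1_def t2_def t3_def t4_def t5_def t6_def t7_def t8_def t9_def d0[symmetric])
  ultimately show ?thesis using that unfolding ws2_def ws3_def by blast
qed

lemma runs_DECIDE:
  assumes "query_ready x k m t c y a r 0 b3 ts"
    and "n = length x" "k = k_of n" "m = poly q n" "t = poly s n" "c = poly l n"
  obtains ts' where "runs DECIDE ts (3 * round_time pV n k m t c + 4) ts'"
    "ts' 1 = contents (bits [accepts x y a r])"
proof -
  let ?D = "k * (t + 1) * m" and ?R = "k * t + c"
  let ?T = "round_time pV n k m t c"
  define A where "A = (\<lambda>i. V (query x k m t c (drop (i * ?D) y) (drop (i * ?D) a) (drop (i * ?R) r)))"
  have bb: "21 \<le> b3" "21 \<le> b4" "21 \<le> b5" by (simp_all add: b1_def b2_def b3_def b4_def b5_def)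
  obtain t1 where 1: "runs (QUERY b3 ;; CALL MV b3 accT) ts ?T t1"
    "query_ready x k m t c (drop ?D y) (drop ?D a) (drop ?R r) (of_bool (A 0)) b4 t1"
    using runs_round[OF assms(1) V bb(1)] assms(2) unfolding A_def b4_def by auto
  obtain t2 where 2: "runs (QUERY b4 ;; CALL MV b4 accT) t1 ?T t2"
    "query_ready x k m t c (drop (2 * ?D) y) (drop (2 * ?D) a) (drop (2 * ?R) r) (of_bool (A 0) + of_bool (A 1)) b5 t2"
    using runs_round[OF 1(2) V bb(2)] assms(2) unfolding A_def b5_def drop_drop mult_2 mult_1 by metis
  obtain t3 where 3: "runs (QUERY b5 ;; CALL MV b5 accT) t2 ?T t3"
    "query_ready x k m t c (drop ?D (drop (2 * ?D) y)) (drop ?D (drop (2 * ?D) a)) (drop ?R (drop (2 * ?R) r))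
       (of_bool (A 0) + of_bool (A 1) + of_bool (A 2)) b6 t3"
    using runs_round[OF 2(2) V bb(3)] assms(2) unfolding A_def b6_def by metis
  define d :: nat where "d = of_bool (A 0) + of_bool (A 1) + of_bool (A 2)"
  have t3: "t3 accT = ones d" "t3 1 = contents []" using 3(2) by (simp_all add: query_ready_def d_def)
  define t4 where "t4 = t3(accT := ones (d - 1))"
  have 4: "runs (POP accT) t3 1 t4"
    by (rule runs_conv[OF runs_POP_ones[of _ _ d]]) (use t3 in \<open>auto simp: t4_def\<close>)
  \<comment> \<open>The preceding \<open>POP\<close> has removed one of the recorded acceptances, so
    something is left exactly if at least two rounds accepted. The subtraction is truncated, so no
    acceptance and a single one are treated alike.\<close>
  have acc: "accepts x y a r \<longleftrightarrow> d - 1 \<noteq> 0"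
    using assms(2-6) by (auto simp: accepts_def round_query_def majority_def d_def A_def Let_def)
  have w: "rel_act (z, Stay) (contents []) = contents [z]" for z
    by (auto simp: rel_act_def contents_def fun_eq_iff)
  define t5 where "t5 = t4(1 := contents (bits [accepts x y a r]))"
  have 5: "runs (Cond accT (\<lambda>s. s \<noteq> 0) (ACT 1 (\<lambda>_. (3, Stay))) (ACT 1 (\<lambda>_. (2, Stay)))) t4 (1 + 2) t5"
  proof (rule runs_Cond)
    assume "t4 accT 0 \<noteq> 0"
    then have "accepts x y a r" using acc by (auto simp: t4_def ones_head)
    then show "runs (ACT 1 (\<lambda>_. (3, Stay))) t4 1 t5"
      using t3(2) by (intro runs_conv[OF runs_ACT]) (auto simp: t4_def t5_def w bit_symbol_def)
  next
    assume "\<not> t4 accT 0 \<noteq> 0"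
    then have "\<not> accepts x y a r" using acc by (auto simp: t4_def ones_head split: if_splits)
    then show "runs (ACT 1 (\<lambda>_. (2, Stay))) t4 1 t5"
      using t3(2) by (intro runs_conv[OF runs_ACT]) (auto simp: t4_def t5_def w bit_symbol_def)
  qed
  have "runs DECIDE ts (3 * ?T + 4) t5"
    unfolding DECIDE_def
    by (rule runs_mono[OF runs_Seq[OF 1(1) runs_Seq[OF 2(1) runs_Seq[OF 3(1) runs_Seq[OF 4 5]]]]]) simp
  then show ?thesis by (rule that) (simp add: t5_def)
qed

definition total_time :: "nat \<Rightarrow> nat \<Rightarrow> nat" where
  "total_time L n = 8 * L + 3 + (setup_time n + (read_time L (j_of n) n +
     (3 * round_time pV n (k_of n) (poly q n) (poly s n) (poly l n) + 4)) + 1 + 2)"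

lemma runs_MAIN:
  obtains ts' where "runs MAIN (input_tapes (encode ws)) (total_time (length (encode ws)) (length (component ws))) ts'"
    "ts' 1 = contents (bits [new_verifier ws])"
proof -
  let ?ts = "input_tapes (encode ws)"
  let ?P = "Cond xT (\<lambda>s. s = 0) (ACT 1 (\<lambda>_. (bit_symbol e, Stay))) (SETUP ;; READ ;; DECIDE)"
  define x where "x = component ws"
  define t1 where "t1 = ?ts(inT := contents (encode (tl ws)), xT := contents (bits x))"
  let ?L = "length (encode ws)" and ?n = "length x"
  have 1: "runs (PARSE inT tmpT xT) ?ts (8 * ?L + 3) t1"
    by (rule runs_conv[OF runs_PARSE[of _ _ ws _ _ "[]"]]) (auto simp: input_tapes_def t1_def x_def)
  let ?T = "setup_time ?n + (read_time ?L (j_of ?n) ?n +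
     (3 * round_time pV ?n (k_of ?n) (poly q ?n) (poly s ?n) (poly l ?n) + 4)) + 1"
  have "\<exists>ts'. runs ?P t1 (?T + 2) ts' \<and>
      ts' 1 = contents (bits [new_verifier ws])"
  proof (cases "x = []")
    case True
    then have nv: "new_verifier ws = e" by (simp add: new_verifier_def x_def)
    let ?t = "t1(1 := contents (bits [new_verifier ws]))"
    have "runs ?P t1 (?T + 2) ?t"
    proof (rule runs_Cond)
      have w: "rel_act (z, Stay) (contents []) = contents [z]" for z
        by (auto simp: rel_act_def contents_def fun_eq_iff)
      show "runs (ACT 1 (\<lambda>_. (bit_symbol e, Stay))) t1 ?T ?t"
        by (rule runs_conv[OF runs_ACT]) (auto simp: t1_def input_tapes_def w nv)
    qed (use True in \<open>simp add: t1_def contents_head\<close>)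
    then show ?thesis by (intro exI[of _ ?t]) simp
  next
    case False
    obtain t2 where 2: "runs SETUP t1 (setup_time ?n) t2"
      "t2 kT = ones (k_of ?n)" "t2 skipT = ones (j_of ?n)" "t2 nT = ones ?n"
      "t2 xT = t1 xT" "t2 inT = t1 inT"
      "\<And>j. j < 21 \<or> b3 \<le> j \<Longrightarrow> j \<notin> {inT, xT, nT, kT, skipT} \<Longrightarrow> t2 j = contents []"
      by (rule runs_SETUP[of t1 x]) (auto simp: t1_def input_tapes_def)
    define ws2 ws3 where "ws2 = drop (j_of ?n - 1) (tl (tl ws))" and "ws3 = drop (j_of ?n - 1) (tl ws2)"
    have nv: "new_verifier ws = accepts x (component (tl ws)) (component ws2) (component ws3)"
      using False by (simp add: new_verifier_def x_def ws2_def ws3_def Let_def)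
    obtain t3 where 3: "runs READ t2 (read_time (length (encode (tl ws))) (j_of ?n) ?n) t3"
      "query_ready x (k_of ?n) (poly q ?n) (poly s ?n) (poly l ?n)
         (component (tl ws)) (component ws2) (component ws3) 0 b3 t3"
      using runs_READ[of t2 x "tl ws" "k_of ?n" "j_of ?n" ?n] 2(2-) unfolding ws2_def ws3_def
      by (auto simp: t1_def)
    obtain t4 where 4: "runs DECIDE t3 (3 * round_time pV ?n (k_of ?n) (poly q ?n) (poly s ?n) (poly l ?n) + 4) t4"
      "t4 1 = contents (bits [new_verifier ws])"
      by (rule runs_DECIDE[OF 3(2) refl refl refl refl refl, folded nv])
    have "read_time (length (encode (tl ws))) (j_of ?n) ?n \<le> read_time ?L (j_of ?n) ?n"
      using length_encode_tl[of ws] unfolding read_time_def by (intro add_mono mult_mono) auto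
    from runs_Seq[OF 2(1) runs_Seq[OF runs_mono[OF 3(1) this] 4(1)]]
    have r: "runs (SETUP ;; READ ;; DECIDE) t1 ?T t4" by (rule runs_mono) simp
    have "runs ?P t1 (?T + 2) t4"
    proof (rule runs_Cond)
      assume "t1 xT 0 = 0"
      with False show "runs (ACT 1 (\<lambda>_. (bit_symbol e, Stay))) t1 ?T t4"
        by (simp add: t1_def contents_head hd_map)
    qed (rule r)
    then show ?thesis using 4(2) by blast
  qed
  then obtain ts' where r: "runs ?P t1 (?T + 2) ts'"
      "ts' 1 = contents (bits [new_verifier ws])" by blast
  have "runs MAIN (input_tapes (encode ws)) (total_time ?L (length (component ws))) ts'"
    unfolding MAIN_def total_time_def
    by (rule runs_mono[OF runs_Seq[OF 1 r(1)]]) (simp add: x_def)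
  then show ?thesis using r(2) by (rule that)
qed

text \<open>A call stores the state of its machine as a tape symbol, the halting state
  \<open>num_states\<close> included, so the alphabet has to exceed every number of states as
  well.\<close>

definition alphabet :: nat where
  "alphabet = 4 + num_symbols Mf + num_states Mf + num_symbols Mg + num_states Mg + num_symbols MV + num_states MV"

lemma wf_MAIN: "wf_com b6 alphabet MAIN"
proof -
  have tm: "turing_machine Mf" "turing_machine Mg" "turing_machine MV"
    using V f g by (simp_all add: computes_def)
  have *: "21 \<le> b6" "21 \<le> b1" "21 \<le> b2" "21 \<le> b3" "21 \<le> b4" "21 \<le> b5"
    "b1 + num_tapes Mf + 2 < b6" "b2 + num_tapes Mg + 2 < b6" "b3 + num_tapes MV + 2 < b6"
    "b4 + num_tapes MV + 2 < b6" "b5 + num_tapes MV + 2 < b6"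
    by (simp_all add: b1_def b2_def b3_def b4_def b5_def b6_def)
  have a: "4 \<le> alphabet" "num_symbols Mf \<le> alphabet" "num_states Mf < alphabet"
    "num_symbols Mg \<le> alphabet" "num_states Mg < alphabet" "num_symbols MV \<le> alphabet" "num_states MV < alphabet"
    by (simp_all add: alphabet_def)
  have act: "wf_com b6 alphabet (ACT 1 (\<lambda>_. (z, Stay)))" if "z < 4" for z
    using that a(1) by (simp add: ACT_def)
  have "wf_com b6 alphabet SETUP" using * a tm by (simp add: SETUP_def)
  moreover have "wf_com b6 alphabet READ" using * a by (simp add: READ_def)
  moreover have "wf_com b6 alphabet DECIDE" using * a tm act[of 3] act[of 2] by (simp add: DECIDE_def)
  moreover have "wf_com b6 alphabet (ACT 1 (\<lambda>_. (bit_symbol e, Stay)))"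
    by (rule act) (simp add: bit_symbol_def)
  ultimately show ?thesis using * a by (simp add: MAIN_def)
qed

lemma polytime_new_verifier: "polytime_predicate new_verifier"
proof -
  let ?n = "\<lambda>ws. length (component ws)"
  have n: "size_bounded ?n"
    by (rule size_bounded_mono[OF size_bounded_length length_component])
  have k: "size_bounded (\<lambda>ws. k_of (?n ws))" unfolding k_of_def by (rule size_bounded_count[OF f n])
  have j: "size_bounded (\<lambda>ws. j_of (?n ws))" unfolding j_of_def by (rule size_bounded_count[OF g n])
  have "size_bounded (\<lambda>ws. total_time (length (encode ws)) (?n ws))"
    unfolding total_time_def setup_time_def read_time_def round_time_def
    by (intro size_bounded_intros size_bounded_peval_time n k j)
  then obtain p :: "nat poly" where p: "\<And>ws. total_time (length (encode ws)) (?n ws) \<le> poly p (length (encode ws))"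
    unfolding size_bounded_def by blast
  show ?thesis unfolding polytime_predicate_def
  proof (rule polytime_run[OF wf_MAIN, of p])
    show "2 \<le> b6" by (simp add: b1_def b2_def b3_def b4_def b5_def b6_def)
    show "4 \<le> alphabet" by (simp add: alphabet_def)
    fix ws
    obtain ts' where "runs MAIN (input_tapes (encode ws)) (total_time (length (encode ws)) (length (component ws))) ts'"
      "ts' 1 = contents (bits [new_verifier ws])" by (rule runs_MAIN)
    with p[of ws] show "\<exists>t ts. run MAIN (input_tapes (encode ws)) t ts \<and> t \<le> poly p (length (encode ws)) \<and>
       ts 1 = contents (bits [new_verifier ws])"
      unfolding runs_def by (meson order_trans)
  qed
qed

end

lemma polytime_const: "polytime (\<lambda>_. [b])"
proof (rule polytime_run[of 2 4 "ACT 1 (\<lambda>_. (bit_symbol b, Stay))" "[:1:]"])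
  show "wf_com 2 4 (ACT 1 (\<lambda>_. (bit_symbol b, Stay)))" by (simp add: ACT_def bit_symbol_def)
  have w: "rel_act (z, Stay) (contents []) = contents [z]" for z
    by (auto simp: rel_act_def contents_def fun_eq_iff)
  fix ws
  let ?ts = "input_tapes (encode ws)"
  have "runs (ACT 1 (\<lambda>_. (bit_symbol b, Stay))) ?ts 1 (?ts(1 := contents (bits [b])))"
    by (rule runs_conv[OF runs_ACT]) (auto simp: input_tapes_def w)
  then show "\<exists>t ts. run (ACT 1 (\<lambda>_. (bit_symbol b, Stay))) ?ts t ts \<and> t \<le> poly [:1:] (length (encode ws)) \<and>
      ts 1 = contents (bits [b])"
    unfolding runs_def by (elim exE conjE, intro exI conjI) (assumption, auto)
qed auto

lemma unary_polytime_1: "unary_polytime (\<lambda>_. 1)"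
  unfolding unary_polytime_def by (intro exI[of _ "\<lambda>_. [True]"]) (simp add: polytime_const)

section \<open>Finitely supported expectations\<close>

text \<open>This is the expectation only if the support is finite; otherwise the sum is the junk value 0.\<close>

definition ev :: "'a pmf \<Rightarrow> ('a \<Rightarrow> real) \<Rightarrow> real" where
  "ev p f = (\<Sum>x\<in>set_pmf p. pmf p x * f x)"

lemma ev_expectation: "finite (set_pmf p) \<Longrightarrow> ev p f = measure_pmf.expectation p f"
  by (subst integral_measure_pmf[of "set_pmf p"]) (auto simp: ev_def)

lemma ev_cong: "(\<And>x. x \<in> set_pmf p \<Longrightarrow> f x = g x) \<Longrightarrow> ev p f = ev p g"
  by (simp add: ev_def)

lemma ev_mono: "(\<And>x. x \<in> set_pmf p \<Longrightarrow> f x \<le> g x) \<Longrightarrow> ev p f \<le> ev p g"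
  unfolding ev_def by (intro sum_mono mult_left_mono) auto

lemma ev_const: "finite (set_pmf p) \<Longrightarrow> ev p (\<lambda>_. c) = c"
  by (simp add: ev_def sum_distrib_right[symmetric] sum_pmf_eq_1)

lemma ev_add: "ev p (\<lambda>x. f x + g x) = ev p f + ev p g"
  by (simp add: ev_def algebra_simps sum.distrib)

lemma ev_diff: "ev p (\<lambda>x. f x - g x) = ev p f - ev p g"
  by (simp add: ev_def algebra_simps sum_subtractf)

lemma ev_cmult: "ev p (\<lambda>x. c * f x) = c * ev p f"
  by (simp add: ev_def sum_distrib_left mult.left_commute)

lemma ev_multc: "ev p (\<lambda>x. f x * c) = ev p f * c"
  by (simp add: ev_def sum_distrib_right mult.assoc)

lemma ev_divide: "ev p (\<lambda>x. f x / c) = ev p f / c"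
  by (simp add: ev_def sum_divide_distrib)

lemma ev_sum: "ev p (\<lambda>x. \<Sum>i\<in>I. f i x) = (\<Sum>i\<in>I. ev p (f i))"
  unfolding ev_def sum_distrib_left by (rule sum.swap)

text \<open>The price of the junk value pays off here: sums over infinite sets are 0, so the
  exchange needs no assumption on the supports.\<close>

lemma ev_swap: "ev p (\<lambda>x. ev r (\<lambda>y. f x y)) = ev r (\<lambda>y. ev p (\<lambda>x. f x y))"
  unfolding ev_def sum_distrib_left by (subst sum.swap) (simp add: mult_ac)

lemma ev_abs: "\<bar>ev p f\<bar> \<le> ev p (\<lambda>x. \<bar>f x\<bar>)"
  unfolding ev_def by (rule order_trans[OF sum_abs]) (simp add: abs_mult)

lemma ev_return [simp]: "ev (return_pmf x) f = f x"
  by (simp add: ev_def)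

lemma ev_bind:
  assumes "finite (set_pmf p)" "\<And>x. x \<in> set_pmf p \<Longrightarrow> finite (set_pmf (g x))"
  shows "ev (bind_pmf p g) f = ev p (\<lambda>x. ev (g x) f)"
proof -
  have "ev (bind_pmf p g) f = measure_pmf.expectation (bind_pmf p g) f"
    using assms by (intro ev_expectation) auto
  also have "\<dots> = (\<Sum>x\<in>set_pmf p. pmf p x * measure_pmf.expectation (g x) f)"
    using assms by (subst pmf_expectation_bind[of "set_pmf p"]) auto
  also have "\<dots> = ev p (\<lambda>x. ev (g x) f)"
    unfolding ev_def[of p] by (intro sum.cong refl) (simp add: assms ev_expectation)
  finally show ?thesis .
qed

lemma ev_map: "finite (set_pmf p) \<Longrightarrow> ev (map_pmf g p) f = ev p (\<lambda>x. f (g x))"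
  by (simp add: map_pmf_def ev_bind)

lemma ev_pair:
  "finite (set_pmf p) \<Longrightarrow> finite (set_pmf r) \<Longrightarrow> ev (pair_pmf p r) f = ev p (\<lambda>x. ev r (\<lambda>y. f (x, y)))"
  by (simp add: pair_pmf_def ev_bind)

lemma ev_prob:
  fixes p :: "'a pmf"
  shows "finite (set_pmf p) \<Longrightarrow> measure_pmf.prob p A = ev p (\<lambda>x. of_bool (x \<in> A))"
proof -
  assume "finite (set_pmf p)"
  moreover have "(\<lambda>x. of_bool (x \<in> A)) = (indicator A :: 'a \<Rightarrow> real)" by (auto simp: indicator_def)
  ultimately show "measure_pmf.prob p A = ev p (\<lambda>x. of_bool (x \<in> A))" by (simp add: ev_expectation)
qed

lemma ev_pmf: "finite (set_pmf p) \<Longrightarrow> ev p (\<lambda>x. of_bool (x = a)) = pmf p a"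
  by (cases "a \<in> set_pmf p") (auto simp: ev_def of_bool_def if_distrib[of "(*) _"] set_pmf_eq intro!: sum.neutral cong: if_cong)

lemma ev_exists_ge:
  assumes "c \<le> ev p f" "finite (set_pmf p)"
  shows "\<exists>x\<in>set_pmf p. c \<le> f x"
proof (rule ccontr)
  assume "\<not> ?thesis"
  then have lt: "\<And>x. x \<in> set_pmf p \<Longrightarrow> f x < c" by force
  have "ev p f < ev p (\<lambda>_. c)"
    unfolding ev_def
    by (rule sum_strict_mono[OF assms(2) set_pmf_not_empty]) (use lt in \<open>auto simp: pmf_positive\<close>)
  with assms show False by (simp add: ev_const)
qed

lemma finite_replicate_pmf [simp]: "finite (set_pmf p) \<Longrightarrow> finite (set_pmf (replicate_pmf n p))"
  by (induction n) auto

lemma ev_replicate_Suc: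
  "finite (set_pmf p) \<Longrightarrow>
    ev (replicate_pmf (Suc n) p) f = ev p (\<lambda>x. ev (replicate_pmf n p) (\<lambda>xs. f (x # xs)))"
  by (simp add: ev_bind)

lemma ev_replicate_add:
  "finite (set_pmf p) \<Longrightarrow>
    ev (replicate_pmf (m + n) p) f =
      ev (replicate_pmf m p) (\<lambda>xs. ev (replicate_pmf n p) (\<lambda>ys. f (xs @ ys)))"
  by (simp add: replicate_pmf_distrib ev_bind)

lemma ev_replicate_nth:
  assumes "finite (set_pmf p)" "i < n"
  shows "ev (replicate_pmf n p) (\<lambda>xs. f (xs ! i)) = ev p f"
  using assms(2)
proof (induction n arbitrary: i)
  case (Suc n)
  then show ?case using assms(1)
    by (cases i) (simp_all add: ev_replicate_Suc ev_const del: replicate_pmf.simps)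
qed simp

lemma in_replicate_pmf: "xs \<in> set_pmf (replicate_pmf n p) \<longleftrightarrow> length xs = n \<and> set xs \<subseteq> set_pmf p"
  by (auto simp: set_replicate_pmf)

text \<open>Coordinates are independent, so one of them can be resampled without changing the law of
  the list. This isolates the coordinate of a single prover from those of the others.\<close>

lemma ev_replicate_update:
  assumes "finite (set_pmf p)" "i < n"
  shows "ev (replicate_pmf n p) f = ev p (\<lambda>u. ev (replicate_pmf n p) (\<lambda>xs. f (xs[i := u])))"
  using assms(2)
proof (induction n arbitrary: i f)
  case (Suc n)
  note fin = assms(1)
  show ?case
  proof (cases i)
    case 0
    then show ?thesis using fin by (simp add: ev_replicate_Suc ev_const del: replicate_pmf.simps)
  next
    case (Suc i')
    then have "i' < n" using Suc.prems by simp
    have "ev (replicate_pmf (Suc n) p) f =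
        ev p (\<lambda>x. ev p (\<lambda>u. ev (replicate_pmf n p) (\<lambda>xs. f (x # xs[i' := u]))))"
      unfolding ev_replicate_Suc[OF fin] by (intro ev_cong Suc.IH[OF \<open>i' < n\<close>])
    also have "\<dots> = ev p (\<lambda>u. ev p (\<lambda>x. ev (replicate_pmf n p) (\<lambda>xs. f (x # xs[i' := u]))))"
      by (rule ev_swap)
    finally show ?thesis unfolding ev_replicate_Suc[OF fin] Suc by simp
  qed
qed simp

section \<open>Concentration\<close>

text \<open>Hoeffding's lemma, stated with the oscillation of \<open>f\<close>, since this is what a
  bounded difference controls. The minimum of \<open>f\<close> supplies the left end of the
  interval.\<close>

lemma ev_exp_hoeffding:
  assumes fin: "finite (set_pmf p)" and l: "0 < (l :: real)"
    and c: "\<And>x y. x \<in> set_pmf p \<Longrightarrow> y \<in> set_pmf p \<Longrightarrow> \<bar>f x - f y\<bar> \<le> c"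
  shows "ev p (\<lambda>x. exp (l * (f x - ev p f))) \<le> exp (l\<^sup>2 * c\<^sup>2 / 8)"
proof -
  define a where "a = Min (f ` set_pmf p)"
  have am: "a \<in> f ` set_pmf p" unfolding a_def using fin set_pmf_not_empty by (intro Min_in) auto
  have al: "a \<le> f x" if "x \<in> set_pmf p" for x unfolding a_def using fin that by (intro Min_le) auto
  have au: "f x \<le> a + c" if "x \<in> set_pmf p" for x using am c[OF that] by fastforce
  interpret interval_bounded_random_variable "measure_pmf p" f a "a + c"
    by unfold_locales (auto simp: AE_measure_pmf_iff al au)
  have "ennreal (ev p (\<lambda>x. exp (l * (f x - ev p f)))) = (\<integral>\<^sup>+x. exp (l * (f x - measure_pmf.expectation p f)) \<partial>p)"
    using fin by (subst nn_integral_eq_integral) (auto simp: ev_expectation integrable_measure_pmf_finite)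
  also have "\<dots> \<le> ennreal (exp (l\<^sup>2 * c\<^sup>2 / 8))"
    using Hoeffdings_lemma_nn_integral[OF l] by simp
  finally show ?thesis by (simp add: ennreal_le_iff)
qed

text \<open>McDiarmid's inequality on the level of exponential moments. Splitting off the head
  \<open>x\<close> writes the deviation as \<open>f - g x\<close>, treated by induction with
  \<open>x\<close> fixed, plus \<open>g x\<close> minus its mean, treated by Hoeffding's lemma,
  since averaging over the tail preserves the bound \<open>c 0\<close>.\<close>

lemma ev_exp_bounded_differences:
  assumes fin: "finite (set_pmf p)" and l: "0 < (l :: real)"
    and "\<And>xs i y. length xs = n \<Longrightarrow> set xs \<subseteq> set_pmf p \<Longrightarrow> i < n \<Longrightarrow> y \<in> set_pmf p \<Longrightarrow>
           \<bar>f (xs[i := y]) - f xs\<bar> \<le> c i"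
  shows "ev (replicate_pmf n p) (\<lambda>xs. exp (l * (f xs - ev (replicate_pmf n p) f))) \<le>
    exp (l\<^sup>2 * (\<Sum>i<n. (c i)\<^sup>2) / 8)"
  using assms(3)
proof (induction n arbitrary: f c)
  case 0
  then show ?case by simp
next
  case (Suc n)
  define g where "g = (\<lambda>x. ev (replicate_pmf n p) (\<lambda>xs. f (x # xs)))"
  define s where "s = (\<Sum>i<n. (c (Suc i))\<^sup>2)"
  have E: "ev (replicate_pmf (Suc n) p) f = ev p g" by (simp add: ev_replicate_Suc fin g_def del: replicate_pmf.simps)
  have 1: "ev (replicate_pmf n p) (\<lambda>xs. exp (l * (f (x # xs) - g x))) \<le> exp (l\<^sup>2 * s / 8)"
    if "x \<in> set_pmf p" for x
    unfolding g_def s_def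
  proof (rule Suc.IH)
    fix xs i y assume *: "length xs = n" "set xs \<subseteq> set_pmf p" "i < n" "y \<in> set_pmf p"
    show "\<bar>f (x # xs[i := y]) - f (x # xs)\<bar> \<le> c (Suc i)"
      using Suc.prems[of "x # xs" "Suc i" y] * that by simp
  qed
  have 2: "ev p (\<lambda>x. exp (l * (g x - ev p g))) \<le> exp (l\<^sup>2 * (c 0)\<^sup>2 / 8)"
  proof (rule ev_exp_hoeffding[OF fin l])
    fix x y assume xy: "x \<in> set_pmf p" "y \<in> set_pmf p"
    have d: "\<bar>f (x # xs) - f (y # xs)\<bar> \<le> c 0" if "xs \<in> set_pmf (replicate_pmf n p)" for xs
      using Suc.prems[of "y # xs" 0 x] that xy by (simp add: in_replicate_pmf)
    have "g x - g y \<le> ev (replicate_pmf n p) (\<lambda>_. c 0)" "g y - g x \<le> ev (replicate_pmf n p) (\<lambda>_. c 0)"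
      unfolding g_def ev_diff[symmetric] by (intro ev_mono; use d in \<open>force simp: abs_le_iff\<close>)+
    then show "\<bar>g x - g y\<bar> \<le> c 0" using fin by (simp add: ev_const)
  qed
  have "ev (replicate_pmf (Suc n) p) (\<lambda>xs. exp (l * (f xs - ev p g))) =
     ev p (\<lambda>x. exp (l * (g x - ev p g)) * ev (replicate_pmf n p) (\<lambda>xs. exp (l * (f (x # xs) - g x))))"
    unfolding ev_replicate_Suc[OF fin] ev_cmult[symmetric]
    by (intro ev_cong) (simp add: exp_add[symmetric] algebra_simps)
  also have "\<dots> \<le> ev p (\<lambda>x. exp (l * (g x - ev p g)) * exp (l\<^sup>2 * s / 8))"
    by (intro ev_mono mult_left_mono 1) auto
  also have "\<dots> \<le> exp (l\<^sup>2 * (c 0)\<^sup>2 / 8) * exp (l\<^sup>2 * s / 8)"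
    unfolding ev_multc by (intro mult_right_mono 2) auto
  also have "\<dots> = exp (l\<^sup>2 * (\<Sum>i<Suc n. (c i)\<^sup>2) / 8)"
    unfolding sum.lessThan_Suc_shift s_def by (simp add: exp_add[symmetric] field_simps)
  finally show ?case unfolding E .
qed

text \<open>The union bound in expectation: the maximum of finitely many variables with subgaussian
  exponential moments grows only with the logarithm of their number. The index \<open>c\<close> that
  dominates \<open>M\<close> may vary with \<open>x\<close>.\<close>

lemma ev_max_le:
  assumes fin: "finite (set_pmf p)" and C: "finite C" "C \<noteq> {}" and l: "0 < (l :: real)"
    and mgf: "\<And>c. c \<in> C \<Longrightarrow> ev p (\<lambda>x. exp (l * X c x)) \<le> exp (l\<^sup>2 * v)"
    and M: "\<And>x. x \<in> set_pmf p \<Longrightarrow> \<exists>c\<in>C. M x \<le> X c x"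
  shows "ev p M \<le> (ln (card C) + l\<^sup>2 * v) / l"
proof -
  \<comment> \<open>Instead of Jensen's inequality, the tangent bound
    \<open>1 + z \<le> exp z\<close> is used at \<open>z = l * M x - u\<close>; \<open>u\<close>
    normalises the sum of the exponential moments to at most 1.\<close>
  define u where "u = ln (card C) + l\<^sup>2 * v"
  have card: "0 < card C" using C by (simp add: card_gt_0_iff)
  have "l * M x - u + 1 \<le> exp (- u) * (\<Sum>c\<in>C. exp (l * X c x))" if x: "x \<in> set_pmf p" for x
  proof -
    obtain c where c: "c \<in> C" "M x \<le> X c x" using M[OF x] by blast
    have "l * M x - u + 1 \<le> exp (l * M x - u)" using exp_ge_add_one_self[of "l * M x - u"] by linarith
    also have "\<dots> \<le> exp (- u) * exp (l * X c x)"
      using c(2) l by (simp add: exp_add[symmetric])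
    also have "\<dots> \<le> exp (- u) * (\<Sum>c\<in>C. exp (l * X c x))"
      using c(1) C(1) by (intro mult_left_mono member_le_sum) auto
    finally show ?thesis .
  qed
  then have "ev p (\<lambda>x. l * M x - u + 1) \<le> ev p (\<lambda>x. exp (- u) * (\<Sum>c\<in>C. exp (l * X c x)))"
    by (rule ev_mono)
  also have "\<dots> \<le> exp (- u) * (\<Sum>c\<in>C. exp (l\<^sup>2 * v))"
    unfolding ev_cmult ev_sum by (intro mult_left_mono sum_mono mgf) auto
  also have "\<dots> = exp (- u) * exp u"
    using card by (simp add: u_def exp_add)
  also have "\<dots> = 1" by (simp add: exp_minus)
  finally have "l * ev p M - u + 1 \<le> 1"
    using fin by (simp add: ev_add ev_diff ev_cmult ev_const)
  then show ?thesis using l by (simp add: u_def field_simps)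
qed

section \<open>A small net of near-optimal strategies\<close>

definition select :: "nat \<Rightarrow> (nat \<Rightarrow> nat \<Rightarrow> 'a) \<Rightarrow> nat list \<Rightarrow> 'a list" where
  "select k S c = map (\<lambda>j. S j (c ! j)) [0..<k]"

lemma length_select [simp]: "length (select k S c) = k"
  by (simp add: select_def)

lemma select_update:
  "length c = k \<Longrightarrow> j < k \<Longrightarrow> select k S (c[j := u]) = (select k S c)[j := S j u]"
  by (rule nth_equalityI) (auto simp: select_def nth_list_update)

definition blocks :: "nat \<Rightarrow> 'a list \<Rightarrow> nat \<Rightarrow> nat \<Rightarrow> 'a" where
  "blocks s xs j u = xs ! (j * s + u)"

lemma block_index_less: "j < k \<Longrightarrow> u < s \<Longrightarrow> j * s + u < k * (s :: nat)"
proof -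
  assume "j < k" "u < s"
  then have "j * s + u < Suc j * s" "Suc j * s \<le> k * s" by (simp, intro mult_le_mono1) simp
  then show ?thesis by linarith
qed

text \<open>Fixed positions in distinct blocks carry independent samples from \<open>D\<close>.
  Averaged over the blocks, a fixed strategy therefore has exactly its value in the original game,
  whatever the law of the picks.\<close>

lemma ev_select_blocks:
  assumes fin: "finite (set_pmf D)" and "length c = k" "set c \<subseteq> {..<s}"
  shows "ev (replicate_pmf (k * s) D) (\<lambda>xs. f (select k (blocks s xs) c)) = ev (replicate_pmf k D) f"
  using assms(2,3)
proof (induction k arbitrary: c f)
  case 0
  then show ?case by (simp add: select_def)
next
  case (Suc k)
  then obtain u c' where c: "c = u # c'" "length c' = k" "set c' \<subseteq> {..<s}" "u < s" by (cases c) auto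
  have "select (Suc k) (blocks s (xs @ ys)) c = (xs ! u) # select k (blocks s ys) c'" if "length xs = s" for xs ys :: "'a list"
    unfolding select_def c(1) upt_conv_Cons[OF zero_less_Suc] map_Suc_upt[symmetric]
    using that c(4) by (auto simp: blocks_def nth_append)
  then have "ev (replicate_pmf (Suc k * s) D) (\<lambda>xs. f (select (Suc k) (blocks s xs) c)) =
     ev (replicate_pmf s D) (\<lambda>xs. ev (replicate_pmf (k * s) D) (\<lambda>ys. f ((xs ! u) # select k (blocks s ys) c')))"
    unfolding mult_Suc ev_replicate_add[OF fin] by (intro ev_cong) (simp add: in_replicate_pmf)
  also have "\<dots> = ev (replicate_pmf s D) (\<lambda>xs. ev (replicate_pmf k D) (\<lambda>ys. f ((xs ! u) # ys)))"
    by (intro ev_cong Suc.IH c)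
  also have "\<dots> = ev (replicate_pmf (Suc k) D) f"
    unfolding ev_replicate_Suc[OF fin] by (rule ev_replicate_nth[OF fin c(4)])
  finally show ?case .
qed

text \<open>Uniform convergence over the finite set \<open>A\<close>: in expectation, no empirical
  mean of \<open>t\<close> samples exceeds its true mean by much, and the empirical mean of a fixed
  \<open>a\<close> is unbiased. So the maximiser \<open>G zs\<close> of the empirical mean nearly
  attains the true value of every \<open>a\<close>.\<close>

lemma ev_best_response:
  fixes H :: "'a \<Rightarrow> 'z \<Rightarrow> real"
  assumes fin: "finite (set_pmf Z)" and A: "finite A" "A \<noteq> {}" and t: "0 < t" and l: "0 < (l :: real)"
    and H: "\<And>a z. 0 \<le> H a z" "\<And>a z. H a z \<le> 1"
    and G: "\<And>zs. G zs \<in> A" "\<And>zs a. length zs = t \<Longrightarrow> a \<in> A \<Longrightarrow> (\<Sum>i<t. H a (zs ! i)) \<le> (\<Sum>i<t. H (G zs) (zs ! i))"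
    and a: "a \<in> A"
  shows "ev Z (H a) - (ln (card A) + l\<^sup>2 / (8 * real t)) / l \<le> ev (replicate_pmf t Z) (\<lambda>zs. ev Z (H (G zs)))"
proof -
  let ?R = "replicate_pmf t Z"
  define est where "est = (\<lambda>b zs. (\<Sum>i<t. H b (zs ! i)) / t)"
  have E: "ev ?R (est b) = ev Z (H b)" for b
    using t fin by (simp add: est_def[abs_def] ev_divide ev_sum ev_replicate_nth)
  have "ev ?R (\<lambda>zs. est (G zs) zs - ev Z (H (G zs))) \<le> (ln (card A) + l\<^sup>2 * (1 / (8 * real t))) / l"
  proof (rule ev_max_le[OF _ A l])
    show "finite (set_pmf ?R)" using fin by simp
    show "\<exists>b\<in>A. est (G zs) zs - ev Z (H (G zs)) \<le> est b zs - ev Z (H b)" for zs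
      using G(1) by blast
    fix b assume "b \<in> A"
    \<comment> \<open>Each of the \<open>t\<close> samples changes the empirical mean by at most
      \<open>1 / t\<close>, so the squares add up to \<open>1 / t\<close>.\<close>
    have "ev ?R (\<lambda>zs. exp (l * (est b zs - ev ?R (est b)))) \<le> exp (l\<^sup>2 * (\<Sum>i<t. (1 / t)\<^sup>2) / 8)"
    proof (rule ev_exp_bounded_differences[OF fin l])
      fix xs :: "'z list" and i y assume *: "length xs = t" "i < t"
      have "(\<Sum>i'<t. H b (xs[i := y] ! i')) - (\<Sum>i'<t. H b (xs ! i')) = (\<Sum>i'<t. if i' = i then H b y - H b (xs ! i) else 0)"
        unfolding sum_subtractf[symmetric] using * by (intro sum.cong) (auto simp: nth_list_update)
      also have "\<dots> = H b y - H b (xs ! i)" using * by simp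
      finally have "est b (xs[i := y]) - est b xs = (H b y - H b (xs ! i)) / t"
        by (simp add: est_def diff_divide_distrib[symmetric])
      moreover have "\<bar>H b y - H b (xs ! i)\<bar> \<le> 1" using H[of b y] H[of b "xs ! i"] by linarith
      ultimately show "\<bar>est b (xs[i := y]) - est b xs\<bar> \<le> 1 / t"
        by (simp add: abs_divide divide_right_mono)
    qed
    then show "ev ?R (\<lambda>zs. exp (l * (est b zs - ev Z (H b)))) \<le> exp (l\<^sup>2 * (1 / (8 * real t)))"
      using t by (simp add: E power2_eq_square mult.commute)
  qed
  moreover have "ev ?R (est a) \<le> ev ?R (\<lambda>zs. est (G zs) zs)"
    by (rule ev_mono) (use G(2) a in \<open>auto simp: est_def in_replicate_pmf intro!: divide_right_mono\<close>)
  ultimately show ?thesis by (simp add: ev_diff E)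
qed

text \<open>\<open>D\<close> is the law of one question, \<open>A\<close> the set of answers,
  \<open>I\<close> the law of the picked position in a block, and \<open>U\<close> stands for the
  acceptance probability over the coins of the original verifier.\<close>

locale sampled_game =
  fixes k :: nat and D :: "'y pmf" and A :: "'a set" and I :: "nat pmf" and U :: "'y list \<Rightarrow> 'a list \<Rightarrow> real"
  assumes fin_D: "finite (set_pmf D)" and fin_A: "finite A" and A_ne: "A \<noteq> {}" and fin_I: "finite (set_pmf I)"
    and U0: "\<And>ys as. 0 \<le> U ys as" and U1: "\<And>ys as. U ys as \<le> 1"
begin

text \<open>\<open>S\<close> is a table of questions and \<open>B\<close> a table of answers to its
  entries. A table \<open>B\<close> computed from all of \<open>S\<close> is Merlin; one whose entry
  at \<open>j\<close>, \<open>u\<close> depends only on \<open>j\<close> and \<open>S j u\<close>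
  amounts to \<open>k\<close> separate provers.\<close>

definition payoff :: "(nat \<Rightarrow> nat \<Rightarrow> 'y) \<Rightarrow> (nat \<Rightarrow> nat \<Rightarrow> 'a) \<Rightarrow> real" where
  "payoff S B = ev (replicate_pmf k I) (\<lambda>c. U (select k S c) (select k B c))"

lemma payoff_cong:
  assumes "\<And>j u. j < k \<Longrightarrow> u \<in> set_pmf I \<Longrightarrow> S j u = S' j u" "\<And>j u. j < k \<Longrightarrow> u \<in> set_pmf I \<Longrightarrow> B j u = B' j u"
  shows "payoff S B = payoff S' B'"
  unfolding payoff_def
proof (rule ev_cong)
  fix c assume "c \<in> set_pmf (replicate_pmf k I)"
  then have "c ! j \<in> set_pmf I" if "j < k" for j using that by (auto simp: in_replicate_pmf)
  then have "select k S c = select k S' c" "select k B c = select k B' c"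
    using assms by (auto simp: select_def)
  then show "U (select k S c) (select k B c) = U (select k S' c) (select k B' c)" by simp
qed

type_synonym ('p, 'q) advice = "('p list \<times> 'q list) list"

definition score :: "nat \<Rightarrow> ('y, 'a) advice \<Rightarrow> 'y \<Rightarrow> 'a \<Rightarrow> real" where
  "score j adv y a = (\<Sum>i<length adv. U ((fst (adv ! i))[j := y]) ((snd (adv ! i))[j := a]))"

definition best :: "nat \<Rightarrow> ('y, 'a) advice \<Rightarrow> 'y \<Rightarrow> 'a" where
  "best j adv y = (SOME a. a \<in> A \<and> (\<forall>b\<in>A. score j adv y b \<le> score j adv y a))"

lemma best: "best j adv y \<in> A" "b \<in> A \<Longrightarrow> score j adv y b \<le> score j adv y (best j adv y)"
proof -
  have "\<exists>a. a \<in> A \<and> (\<forall>b\<in>A. score j adv y b \<le> score j adv y a)"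
  proof -
    have "Max (score j adv y ` A) \<in> score j adv y ` A" using fin_A A_ne by (intro Max_in) auto
    then obtain a where "a \<in> A" "score j adv y a = Max (score j adv y ` A)" by force
    then show ?thesis using fin_A by (intro exI[of _ a]) auto
  qed
  from someI_ex[OF this] show "best j adv y \<in> A" "b \<in> A \<Longrightarrow> score j adv y b \<le> score j adv y (best j adv y)"
    unfolding best_def by blast+
qed

definition advices :: "nat \<Rightarrow> ('y, 'a) advice set" where
  "advices t = {adv. set adv \<subseteq> {ys. set ys \<subseteq> set_pmf D \<and> length ys = k} \<times> {as. set as \<subseteq> A \<and> length as = k} \<and> length adv = t}"

text \<open>
  One prover can be replaced by a best response to a short list of sampled opponent moves. Such a
  response is described by the sample alone, whatever the sampled questions \<open>S\<close> are.
\<close>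

lemma replace_prover:
  assumes j: "j < k" and t: "0 < t" and l: "0 < (l :: real)"
    and S: "\<And>i u. i < k \<Longrightarrow> u \<in> set_pmf I \<Longrightarrow> S i u \<in> set_pmf D" and B: "\<And>i u. i < k \<Longrightarrow> u \<in> set_pmf I \<Longrightarrow> B i u \<in> A"
  shows "\<exists>adv\<in>advices t. payoff S B - (ln (card A) + l\<^sup>2 / (8 * real t)) / l \<le> payoff S (B(j := \<lambda>u. best j adv (S j u)))"
proof -
  define R where "R = replicate_pmf k I"
  define H where "H = (\<lambda>y a c. U ((select k S c)[j := y]) ((select k B c)[j := a]))"
  define adv where "adv = (\<lambda>zs. map (\<lambda>c. (select k S c, select k B c)) zs)"
  define d where "d = (ln (card A) + l\<^sup>2 / (8 * real t)) / l"
  have fin_R: "finite (set_pmf R)" using fin_I by (simp add: R_def)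
  \<comment> \<open>The entry \<open>j\<close> of both lists in \<open>H\<close> is overwritten, so
    \<open>c\<close> only fixes the moves of the other provers and becomes independent of the pick
    \<open>u\<close> of prover \<open>j\<close>.\<close>
  have resample: "payoff S (B(j := b)) = ev I (\<lambda>u. ev R (H (S j u) (b u)))" for b
  proof -
    have "select k (B(j := b)) (c[j := u]) = (select k B c)[j := b u]" if "length c = k" for c u
      by (rule nth_equalityI) (use that j in \<open>auto simp: select_def nth_list_update\<close>)
    then show ?thesis
      unfolding payoff_def R_def H_def
      by (subst ev_replicate_update[OF fin_I j], intro ev_cong)
         (use j in \<open>simp add: select_update in_replicate_pmf\<close>)
  qed
  have step: "ev R (H (S j u) (B j u)) - d \<le> ev (replicate_pmf t R) (\<lambda>zs. ev R (H (S j u) (best j (adv zs) (S j u))))"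
    if "u \<in> set_pmf I" for u
    unfolding d_def
  proof (rule ev_best_response[OF fin_R fin_A A_ne t l])
    show "B j u \<in> A" using B j that by simp
    fix zs :: "nat list list" and a assume "length zs = t" "a \<in> A"
    then show "(\<Sum>i<t. H (S j u) a (zs ! i)) \<le> (\<Sum>i<t. H (S j u) (best j (adv zs) (S j u)) (zs ! i))"
      using best(2)[of a j "adv zs" "S j u"] by (simp add: score_def adv_def H_def)
  qed (simp_all add: H_def U0 U1 best)
  have "payoff S B - d = ev I (\<lambda>u. ev R (H (S j u) (B j u)) - d)"
    using resample[of "B j"] fin_I by (simp add: ev_diff ev_const)
  also have "\<dots> \<le> ev I (\<lambda>u. ev (replicate_pmf t R) (\<lambda>zs. ev R (H (S j u) (best j (adv zs) (S j u)))))"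
    by (rule ev_mono) (rule step)
  also have "\<dots> = ev (replicate_pmf t R) (\<lambda>zs. payoff S (B(j := \<lambda>u. best j (adv zs) (S j u))))"
    unfolding resample by (rule ev_swap)
  \<comment> \<open>The bound holds on average over the samples, so some sample attains it; fixing
    it makes the new prover deterministic.\<close>
  finally obtain zs where zs: "zs \<in> set_pmf (replicate_pmf t R)"
    "payoff S B - d \<le> payoff S (B(j := \<lambda>u. best j (adv zs) (S j u)))"
    using ev_exists_ge finite_replicate_pmf[OF fin_R] by blast
  have "adv zs \<in> advices t"
    using zs(1) S B by (auto simp: advices_def adv_def in_replicate_pmf R_def select_def subset_iff)
  then show ?thesis using zs(2) unfolding d_def by blast
qed

text \<open>Later samples are drawn against opponents some of whom have already been replaced. An
  advice records their moves and not their strategies, so its size does not grow from one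
  replacement to the next, and the losses just add up.\<close>

lemma replace_provers:
  assumes t: "0 < t" and l: "0 < (l :: real)"
    and S: "\<And>i u. i < k \<Longrightarrow> u \<in> set_pmf I \<Longrightarrow> S i u \<in> set_pmf D" and B: "\<And>i u. i < k \<Longrightarrow> u \<in> set_pmf I \<Longrightarrow> B i u \<in> A"
    and "n \<le> k"
  shows "\<exists>advs. length advs = n \<and> set advs \<subseteq> advices t \<and>
     payoff S B - n * ((ln (card A) + l\<^sup>2 / (8 * real t)) / l) \<le>
       payoff S (\<lambda>j u. if j < n then best j (advs ! j) (S j u) else B j u)"
  using \<open>n \<le> k\<close>
proof (induction n)
  case 0
  then show ?case by simp
next
  case (Suc n)
  define d where "d = (ln (card A) + l\<^sup>2 / (8 * real t)) / l"
  from Suc obtain advs where advs: "length advs = n" "set advs \<subseteq> advices t"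
    "payoff S B - n * d \<le> payoff S (\<lambda>j u. if j < n then best j (advs ! j) (S j u) else B j u)"
    unfolding d_def by auto
  let ?B = "\<lambda>j u. if j < n then best j (advs ! j) (S j u) else B j u"
  have "\<exists>adv\<in>advices t. payoff S ?B - d \<le> payoff S (?B(n := \<lambda>u. best n adv (S n u)))"
    unfolding d_def by (rule replace_prover) (use Suc.prems t l S B in \<open>auto simp: best\<close>)
  then obtain adv where adv: "adv \<in> advices t" "payoff S ?B - d \<le> payoff S (?B(n := \<lambda>u. best n adv (S n u)))"
    by blast
  have "?B(n := \<lambda>u. best n adv (S n u)) =
      (\<lambda>j u. if j < Suc n then best j ((advs @ [adv]) ! j) (S j u) else B j u)"
    using advs(1) by (auto simp: fun_eq_iff nth_append less_Suc_eq)
  with adv advs show ?case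
    unfolding d_def[symmetric] by (intro exI[of _ "advs @ [adv]"]) (auto simp: algebra_simps)
qed

definition net :: "nat \<Rightarrow> (nat \<Rightarrow> 'y \<Rightarrow> 'a) set" where
  "net t = (\<lambda>advs j y. best j (advs ! j) y) ` {advs. set advs \<subseteq> advices t \<and> length advs = k}"

lemma finite_net: "finite (net t)"
  unfolding net_def advices_def
  by (intro finite_imageI finite_lists_length_eq finite_cartesian_product fin_D fin_A)

text \<open>An advice consists of \<open>t\<close> lists of \<open>k\<close> questions and
  \<open>k\<close> answers, and there is one advice for each of the \<open>k\<close> provers. With
  \<open>m\<close>-bit questions and answers the logarithm is polynomial.\<close>

lemma card_net: "card (net t) \<le> ((card (set_pmf D) ^ k * card A ^ k) ^ t) ^ k"
proof -
  have f: "finite (advices t)"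
    unfolding advices_def by (intro finite_lists_length_eq finite_cartesian_product fin_D fin_A)
  have "card (net t) \<le> card {advs. set advs \<subseteq> advices t \<and> length advs = k}"
    unfolding net_def by (intro card_image_le finite_lists_length_eq f)
  also have "\<dots> = card (advices t) ^ k" by (rule card_lists_length_eq[OF f])
  also have "card (advices t) = (card (set_pmf D) ^ k * card A ^ k) ^ t"
    unfolding advices_def
    by (subst card_lists_length_eq)
       (auto intro!: finite_cartesian_product finite_lists_length_eq fin_D fin_A
         simp: card_cartesian_product card_lists_length_eq[OF fin_D] card_lists_length_eq[OF fin_A])
  finally show ?thesis .
qed

lemma net_range: "F \<in> net t \<Longrightarrow> F j y \<in> A"
  by (auto simp: net_def best)

lemma net_payoff:
  assumes "0 < t" "0 < (l :: real)"
    and "\<And>i u. i < k \<Longrightarrow> u \<in> set_pmf I \<Longrightarrow> S i u \<in> set_pmf D" "\<And>i u. i < k \<Longrightarrow> u \<in> set_pmf I \<Longrightarrow> B i u \<in> A"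
  shows "\<exists>F\<in>net t. payoff S B - k * ((ln (card A) + l\<^sup>2 / (8 * real t)) / l) \<le> payoff S (\<lambda>j u. F j (S j u))"
proof -
  have "\<exists>advs. length advs = k \<and> set advs \<subseteq> advices t \<and>
     payoff S B - k * ((ln (card A) + l\<^sup>2 / (8 * real t)) / l) \<le>
       payoff S (\<lambda>j u. if j < k then best j (advs ! j) (S j u) else B j u)"
    by (rule replace_provers) (use assms in auto)
  then obtain advs where advs: "length advs = k" "set advs \<subseteq> advices t"
     "payoff S B - k * ((ln (card A) + l\<^sup>2 / (8 * real t)) / l) \<le>
       payoff S (\<lambda>j u. if j < k then best j (advs ! j) (S j u) else B j u)"
    by blast
  have "payoff S (\<lambda>j u. if j < k then best j (advs ! j) (S j u) else B j u) =
     payoff S (\<lambda>j u. best j (advs ! j) (S j u))"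
    by (rule payoff_cong) auto
  with advs show ?thesis by (auto simp: net_def)
qed

lemma payoff_strategy:
  "payoff S (\<lambda>j u. F j (S j u)) =
     ev (replicate_pmf k I) (\<lambda>c. U (select k S c) (map (\<lambda>j. F j (select k S c ! j)) [0..<k]))"
  unfolding payoff_def by (intro ev_cong arg_cong2[of _ _ _ _ U]) (auto simp: select_def)

text \<open>Record \<open>i\<close> matters only if the pick in block \<open>i div s\<close> hits
  position \<open>i mod s\<close>, and then by at most 1. So its influence is a point probability of
  \<open>I\<close>, and the sum of the squares is \<open>k\<close> times the collision probability
  of \<open>I\<close>. This is all that is ever required of the law of the picks.\<close>

lemma payoff_bounded_differences:
  assumes Sl: "length Sl = k * s" "i < k * s" and I: "set_pmf I \<subseteq> {..<s}"
  shows "\<bar>payoff (blocks s (Sl[i := y])) (\<lambda>j u. F j (blocks s (Sl[i := y]) j u)) -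
     payoff (blocks s Sl) (\<lambda>j u. F j (blocks s Sl j u))\<bar> \<le> pmf I (i mod s)"
proof -
  have s: "0 < s" using I set_pmf_not_empty[of I] by (cases s) auto
  have j: "i div s < k" using Sl(2) by (simp add: less_mult_imp_div_less)
  define h where "h = (\<lambda>ys. U ys (map (\<lambda>j. F j (ys ! j)) [0..<k]))"
  have h: "\<bar>h ys - h ys'\<bar> \<le> 1" for ys ys' using U0 U1 unfolding h_def by (smt (verit))
  have "\<bar>h (select k (blocks s (Sl[i := y])) c) - h (select k (blocks s Sl) c)\<bar> \<le> of_bool (c ! (i div s) = i mod s)"
    if c: "c \<in> set_pmf (replicate_pmf k I)" for c
  proof (cases "c ! (i div s) = i mod s")
    case False
    have "select k (blocks s (Sl[i := y])) c = select k (blocks s Sl) c"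
      unfolding select_def blocks_def
    proof (rule map_cong[OF refl])
      fix j' assume "j' \<in> set [0..<k]"
      then have "c ! j' < s" using c I by (auto simp: in_replicate_pmf subset_iff)
      then have "j' * s + c ! j' \<noteq> i" using False s by auto
      then show "Sl[i := y] ! (j' * s + c ! j') = Sl ! (j' * s + c ! j')" by simp
    qed
    then show ?thesis by simp
  qed (use h in simp)
  then have "ev (replicate_pmf k I) (\<lambda>c. \<bar>h (select k (blocks s (Sl[i := y])) c) - h (select k (blocks s Sl) c)\<bar>) \<le>
     ev (replicate_pmf k I) (\<lambda>c. of_bool (c ! (i div s) = i mod s))"
    by (rule ev_mono)
  also have "\<dots> = pmf I (i mod s)"
    using ev_replicate_nth[OF fin_I j, of "\<lambda>u. of_bool (u = i mod s)"] by (simp add: ev_pmf fin_I)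
  finally have b: "ev (replicate_pmf k I) (\<lambda>c. \<bar>h (select k (blocks s (Sl[i := y])) c) - h (select k (blocks s Sl) c)\<bar>) \<le>
      pmf I (i mod s)" .
  have e: "payoff (blocks s xs) (\<lambda>j u. F j (blocks s xs j u)) =
      ev (replicate_pmf k I) (\<lambda>c. h (select k (blocks s xs) c))" for xs
    unfolding payoff_strategy h_def ..
  show ?thesis unfolding e ev_diff[symmetric] by (rule order_trans[OF ev_abs b])
qed

text \<open>\<open>B Sl\<close> is an arbitrary Merlin who sees all blocks. The first error term
  pays for passing to the net, the second for the maximum over the net, which may be taken because
  the net is the same for all blocks. \<open>l\<close> and \<open>l'\<close> are free parameters
  that balance the two parts of each term.\<close>

theorem sampled_value:
  assumes I: "set_pmf I \<subseteq> {..<s}" and t: "0 < t" and l: "0 < (l :: real)" "0 < (l' :: real)"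
    and val: "\<And>F. (\<And>j y. F j y \<in> A) \<Longrightarrow>
      ev (replicate_pmf k D) (\<lambda>ys. U ys (map (\<lambda>j. F j (ys ! j)) [0..<k])) \<le> v"
    and B: "\<And>Sl j u. length Sl = k * s \<Longrightarrow> j < k \<Longrightarrow> u \<in> set_pmf I \<Longrightarrow> B Sl j u \<in> A"
  shows "ev (replicate_pmf (k * s) D) (\<lambda>Sl. payoff (blocks s Sl) (B Sl)) \<le>
    v + k * ((ln (card A) + l\<^sup>2 / (8 * real t)) / l) +
    (ln (card (net t)) + l'\<^sup>2 * (k * (\<Sum>u<s. (pmf I u)\<^sup>2) / 8)) / l'"
proof -
  let ?R = "replicate_pmf (k * s) D"
  define d where "d = k * ((ln (card A) + l\<^sup>2 / (8 * real t)) / l)"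
  define X where "X = (\<lambda>F Sl. payoff (blocks s Sl) (\<lambda>j u. F j (blocks s Sl j u)))"
  have Xv: "ev ?R (X F) \<le> v" if "F \<in> net t" for F
  proof -
    have "ev ?R (X F) = ev (replicate_pmf k I) (\<lambda>c. ev ?R (\<lambda>Sl. U (select k (blocks s Sl) c)
        (map (\<lambda>j. F j (select k (blocks s Sl) c ! j)) [0..<k])))"
      unfolding X_def payoff_strategy by (rule ev_swap)
    also have "\<dots> = ev (replicate_pmf k I) (\<lambda>c. ev (replicate_pmf k D) (\<lambda>ys. U ys (map (\<lambda>j. F j (ys ! j)) [0..<k])))"
    proof (rule ev_cong)
      fix c assume "c \<in> set_pmf (replicate_pmf k I)"
      then show "ev ?R (\<lambda>Sl. U (select k (blocks s Sl) c) (map (\<lambda>j. F j (select k (blocks s Sl) c ! j)) [0..<k])) =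
          ev (replicate_pmf k D) (\<lambda>ys. U ys (map (\<lambda>j. F j (ys ! j)) [0..<k]))"
        using I by (intro ev_select_blocks[OF fin_D]) (auto simp: in_replicate_pmf)
    qed
    also have "\<dots> \<le> v" using val[of F] net_range[OF that] fin_I by (simp add: ev_const)
    finally show ?thesis .
  qed
  \<comment> \<open>\<open>net_payoff\<close> produces an element of the net for any tables of
    questions and answers, so arbitrary constant tables show that it is inhabited.\<close>
  have ne: "net t \<noteq> {}"
    using net_payoff[OF t l(1), of "\<lambda>_ _. SOME y. y \<in> set_pmf D" "\<lambda>_ _. SOME a. a \<in> A"]
      some_in_eq[of "set_pmf D"] some_in_eq[of A] set_pmf_not_empty[of D] A_ne by auto
  have "ev ?R (\<lambda>Sl. payoff (blocks s Sl) (B Sl) - d - v) \<le>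
     (ln (card (net t)) + l'\<^sup>2 * (k * (\<Sum>u<s. (pmf I u)\<^sup>2) / 8)) / l'"
  proof (rule ev_max_le[where X = "\<lambda>F Sl. X F Sl - ev ?R (X F)", OF _ finite_net ne l(2)])
    show "finite (set_pmf ?R)" using fin_D by simp
    fix Sl assume Sl: "Sl \<in> set_pmf ?R"
    have "\<exists>F\<in>net t. payoff (blocks s Sl) (B Sl) - k * ((ln (card A) + l\<^sup>2 / (8 * real t)) / l) \<le>
        payoff (blocks s Sl) (\<lambda>j u. F j (blocks s Sl j u))"
    proof (rule net_payoff[OF t l(1)])
      fix j u assume *: "j < k" "u \<in> set_pmf I"
      then show "B Sl j u \<in> A" using Sl by (intro B) (auto simp: in_replicate_pmf)
      from * have "j * s + u < k * s" using I block_index_less by blast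
      then show "blocks s Sl j u \<in> set_pmf D" using Sl by (auto simp: blocks_def in_replicate_pmf subset_iff)
    qed
    then obtain F where F: "F \<in> net t" "payoff (blocks s Sl) (B Sl) - d \<le> X F Sl" unfolding d_def X_def by blast
    show "\<exists>F\<in>net t. payoff (blocks s Sl) (B Sl) - d - v \<le> X F Sl - ev ?R (X F)"
      using F Xv[OF F(1)] by (intro bexI[of _ F]) auto
  next
    fix F assume "F \<in> net t"
    have "ev ?R (\<lambda>Sl. exp (l' * (X F Sl - ev ?R (X F)))) \<le> exp (l'\<^sup>2 * (\<Sum>i<k * s. (pmf I (i mod s))\<^sup>2) / 8)"
      by (rule ev_exp_bounded_differences[OF fin_D l(2)])
         (simp add: X_def payoff_bounded_differences[OF _ _ I])
    \<comment> \<open>The positions are grouped into \<open>k\<close> runs of length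
      \<open>s\<close>, and each run contributes one collision probability.\<close>
    also have "(\<Sum>i<k * s. (pmf I (i mod s))\<^sup>2) = k * (\<Sum>u<s. (pmf I u)\<^sup>2)"
    proof -
      have inner: "(\<Sum>i\<in>{j * s..<j * s + s}. (pmf I (i mod s))\<^sup>2) = (\<Sum>u<s. (pmf I u)\<^sup>2)" for j
        using sum.shift_bounds_nat_ivl[of "\<lambda>i. (pmf I (i mod s))\<^sup>2" 0 "j * s" s]
        by (simp add: add.commute atLeast0LessThan)
      have "(\<Sum>i<k * s. (pmf I (i mod s))\<^sup>2) = (\<Sum>j<k. \<Sum>i\<in>{j * s..<j * s + s}. (pmf I (i mod s))\<^sup>2)"
        by (rule sum.nat_group[symmetric])
      then show ?thesis by (simp add: inner)
    qed
    finally show "ev ?R (\<lambda>Sl. exp (l' * (X F Sl - ev ?R (X F)))) \<le> exp (l'\<^sup>2 * (k * (\<Sum>u<s. (pmf I u)\<^sup>2) / 8))"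
      by simp
  qed
  then show ?thesis using fin_D by (simp add: ev_diff ev_const d_def)
qed

end

section \<open>Collision probability of the binomial distribution\<close>

lemma central_binomial_Suc: "(n + 1) * (2 * n + 2 choose (n + 1)) = 2 * (2 * n + 1) * (2 * n choose n)"
proof -
  have 1: "(n + 1) * (2 * n + 2 choose (n + 1)) = (2 * n + 2) * (2 * n + 1 choose n)"
    using Suc_times_binomial[of n "2 * n + 1"] by simp
  have 2: "(n + 1) * (2 * n + 1 choose (n + 1)) = (2 * n + 1) * (2 * n choose n)"
    using Suc_times_binomial[of n "2 * n"] by simp
  have 3: "2 * n + 1 choose (n + 1) = 2 * n + 1 choose n"
    using binomial_symmetric[of n "2 * n + 1"] by simp
  have "(n + 1) * (2 * n + 2 choose (n + 1)) = 2 * ((n + 1) * (2 * n + 1 choose (n + 1)))"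
    unfolding 1 3 by simp
  then show ?thesis unfolding 2 by simp
qed

text \<open>With \<open>a n\<close> the scaled coefficient, the ratio of successive terms is
  \<open>(2 n + 1) / (2 n + 2)\<close>. Since \<open>(2 n + 1) * (2 n + 3)\<close> is at most the
  square of \<open>2 n + 2\<close>, the product of \<open>2 n + 1\<close> and the square of
  \<open>a n\<close> never increases, and it starts at 1.\<close>

lemma central_binomial_upper_bound: "real (2 * n choose n) / 4 ^ n * sqrt (2 * n + 1) \<le> 1"
proof -
  define a where "a = (\<lambda>n. real (2 * n choose n) / 4 ^ n)"
  have rec: "a (Suc n) * (2 * real n + 2) = a n * (2 * real n + 1)" for n
  proof -
    have "real (n + 1) * real (2 * n + 2 choose (n + 1)) = real (2 * (2 * n + 1)) * real (2 * n choose n)"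
      unfolding of_nat_mult[symmetric] central_binomial_Suc ..
    then have r: "real (2 * n + 2 choose (n + 1)) * (2 * real n + 2) = (2 * real n + 1) * (4 * real (2 * n choose n))"
      by (simp add: algebra_simps del: binomial_Suc_Suc)
    have "a (Suc n) * (2 * real n + 2) = real (2 * n + 2 choose (n + 1)) * (2 * real n + 2) / (4 * 4 ^ n)"
      by (simp add: a_def del: binomial_Suc_Suc)
    then show ?thesis unfolding r by (simp add: a_def)
  qed
  have "(a n)\<^sup>2 * (2 * real n + 1) \<le> 1"
  proof (induction n)
    case 0 then show ?case by (simp add: a_def)
  next
    case (Suc n)
    have "(2 * real n + 1) * (2 * real n + 3) \<le> (2 * real n + 2)\<^sup>2" by (simp add: power2_eq_square algebra_simps)
    then have "(a n)\<^sup>2 * (2 * real n + 1) * ((2 * real n + 1) * (2 * real n + 3)) \<le> 1 * (2 * real n + 2)\<^sup>2"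
      using Suc by (intro mult_mono) auto
    moreover have "(a n)\<^sup>2 * (2 * real n + 1) * ((2 * real n + 1) * (2 * real n + 3)) =
        (a (Suc n) * (2 * real n + 2))\<^sup>2 * (2 * real n + 3)"
      unfolding rec by (simp add: power2_eq_square algebra_simps)
    moreover have "\<dots> = (a (Suc n))\<^sup>2 * (2 * real (Suc n) + 1) * (2 * real n + 2)\<^sup>2"
    proof -
      have "2 * real (Suc n) + 1 = 2 * real n + 3" by simp
      then show ?thesis by (simp only: power_mult_distrib mult_ac)
    qed
    ultimately show ?case by (simp add: mult_le_cancel_right)
  qed
  then have "(a n * sqrt (2 * real n + 1))\<^sup>2 \<le> 1\<^sup>2" by (simp add: power_mult_distrib)
  then have "a n * sqrt (2 * real n + 1) \<le> 1" by (rule power2_le_imp_le) simp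
  then show ?thesis by (simp add: a_def add.commute)
qed

text \<open>By Vandermonde's identity the collision probability is the central binomial coefficient
  over \<open>4 ^ n\<close>. The decay of order \<open>1 / sqrt n\<close>, compared with
  \<open>1 / n\<close> for uniform picks, only costs a square in the sample size.\<close>

lemma binomial_collision:
  "(\<Sum>u<n + 1. (pmf (binomial_pmf n (1 / 2)) u)\<^sup>2) * sqrt (2 * n + 1) \<le> 1"
proof -
  have "(\<Sum>u<n + 1. (pmf (binomial_pmf n (1 / 2)) u)\<^sup>2) = (\<Sum>u\<le>n. (real (n choose u) / 2 ^ n)\<^sup>2)"
  proof (intro sum.cong)
    fix u assume "u \<in> {..n}"
    then have "(1 / 2 :: real) ^ u * (1 - 1 / 2) ^ (n - u) = 1 / 2 ^ n"
      by (simp add: power_add[symmetric] power_divide)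
    then show "(pmf (binomial_pmf n (1 / 2)) u)\<^sup>2 = (real (n choose u) / 2 ^ n)\<^sup>2" by (simp add: mult.assoc)
  qed auto
  also have "\<dots> = real (\<Sum>u\<le>n. (n choose u)\<^sup>2) / 4 ^ n"
    by (simp add: power_divide sum_divide_distrib power_mult[symmetric] power2_eq_square flip: power_mult_distrib)
  also have "(\<Sum>u\<le>n. (n choose u)\<^sup>2) = 2 * n choose n" by (rule choose_square_sum)
  finally show ?thesis using central_binomial_upper_bound[of n] by simp
qed

section \<open>Uniform bit strings\<close>

definition uniform :: "nat \<Rightarrow> bool list pmf" where
  "uniform n = pmf_of_set (bitstrings n)"

lemma bitstrings_alt: "bitstrings n = {xs. set xs \<subseteq> UNIV \<and> length xs = n}"
  by (simp add: bitstrings_def)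

lemma finite_bitstrings [simp]: "finite (bitstrings n)"
  unfolding bitstrings_alt by (rule finite_lists_length_eq) simp

lemma card_bitstrings [simp]: "card (bitstrings n) = 2 ^ n"
  unfolding bitstrings_alt by (subst card_lists_length_eq) auto

lemma bitstrings_ne [simp]: "bitstrings n \<noteq> {}"
  using card_bitstrings[of n] by (metis card.empty power_not_zero zero_neq_numeral)

lemma set_uniform [simp]: "set_pmf (uniform n) = bitstrings n"
  by (simp add: uniform_def)

lemma ev_uniform: "ev (uniform n) f = (\<Sum>w\<in>bitstrings n. f w) / 2 ^ n"
  by (simp add: ev_def uniform_def sum_divide_distrib)

lemma ev_uniform_add:
  "ev (uniform (a + b)) f = ev (uniform a) (\<lambda>x. ev (uniform b) (\<lambda>y. f (x @ y)))"
proof -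
  have "bij_betw (\<lambda>(x, y). x @ y) (bitstrings a \<times> bitstrings b) (bitstrings (a + b))"
    by (rule bij_betw_byWitness[where f' = "\<lambda>w. (take a w, drop a w)"]) (auto simp: bitstrings_def)
  from sum.reindex_bij_betw[OF this, of f]
  have "(\<Sum>w\<in>bitstrings (a + b). f w) = (\<Sum>x\<in>bitstrings a. \<Sum>y\<in>bitstrings b. f (x @ y))"
    by (simp add: sum.cartesian_product split_beta)
  then show ?thesis by (simp add: ev_uniform power_add sum_divide_distrib[symmetric])
qed

lemma ev_uniform_const [simp]: "ev (uniform n) (\<lambda>_. c) = c"
  by (simp add: ev_const)

text \<open>Disjoint parts of a uniform string are independent. The surplus beyond
  \<open>3 * a\<close> is padding, present because questions and coins are longer than what the
  rounds read.\<close>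

lemma ev_uniform_three:
  assumes "3 * a \<le> n"
  shows "ev (uniform n) (\<lambda>w. f (take a w) (take a (drop a w)) (take a (drop (2 * a) w))) =
    ev (uniform a) (\<lambda>x. ev (uniform a) (\<lambda>y. ev (uniform a) (\<lambda>z. f x y z)))"
proof -
  let ?g = "\<lambda>w. f (take a w) (take a (drop a w)) (take a (drop (2 * a) w))"
  have "ev (uniform (a + (a + (a + (n - 3 * a))))) ?g =
      ev (uniform a) (\<lambda>x. ev (uniform a) (\<lambda>y. ev (uniform a) (\<lambda>z. f x y z)))"
    unfolding ev_uniform_add by (intro ev_cong) (auto simp: bitstrings_def intro!: ev_cong)
  then show ?thesis using assms by simp
qed

definition chop :: "nat \<Rightarrow> nat \<Rightarrow> 'a list \<Rightarrow> 'a list list" where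
  "chop n m w = map (\<lambda>i. take m (drop (i * m) w)) [0..<n]"

lemma length_chop [simp]: "length (chop n m w) = n"
  by (simp add: chop_def)

lemma chop_Suc: "length x = m \<Longrightarrow> chop (Suc n) m (x @ y) = x # chop n m y"
  unfolding chop_def upt_conv_Cons[OF zero_less_Suc] map_Suc_upt[symmetric] by simp

lemma chop_take: "chop n m (take (n * m) w) = chop n m w"
  unfolding chop_def
proof (rule map_cong[OF refl])
  fix i assume "i \<in> set [0..<n]"
  then have "Suc i * m \<le> n * m" by (intro mult_le_mono1) simp
  then have "m \<le> n * m - i * m" by simp
  then show "take m (drop (i * m) (take (n * m) w)) = take m (drop (i * m) w)"
    by (simp add: drop_take min_def)
qed

lemma chop_bitstrings:
  assumes "i < n" "n * m \<le> length w"
  shows "chop n m w ! i \<in> bitstrings m"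
proof -
  have "Suc i * m \<le> n * m" using assms(1) by (intro mult_le_mono1) simp
  then show ?thesis using assms by (simp add: chop_def bitstrings_def)
qed

lemma ev_chop: "ev (uniform (n * m)) (\<lambda>w. f (chop n m w)) = ev (replicate_pmf n (uniform m)) f"
proof (induction n arbitrary: f)
  case 0
  then show ?case by (simp add: ev_uniform bitstrings_def chop_def)
next
  case (Suc n)
  have "ev (uniform (Suc n * m)) (\<lambda>w. f (chop (Suc n) m w)) =
      ev (uniform m) (\<lambda>x. ev (uniform (n * m)) (\<lambda>y. f (x # chop n m y)))"
    unfolding mult_Suc ev_uniform_add by (intro ev_cong) (simp add: bitstrings_def chop_Suc)
  also have "\<dots> = ev (replicate_pmf (Suc n) (uniform m)) f"
    by (subst ev_replicate_Suc) (auto intro!: ev_cong Suc)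
  finally show ?case .
qed

lemma ev_replicate_map:
  assumes "finite (set_pmf p)"
  shows "ev (replicate_pmf n p) (\<lambda>xs. f (map g xs)) = ev (replicate_pmf n (map_pmf g p)) f"
proof (induction n arbitrary: f)
  case (Suc n)
  have "ev (replicate_pmf n p) (\<lambda>xs. f (g x # map g xs)) = ev (replicate_pmf n (map_pmf g p)) (\<lambda>xs. f (g x # xs))" for x
    by (rule Suc)
  then show ?case using assms by (simp add: ev_replicate_Suc ev_map del: replicate_pmf.simps)
qed simp

lemma ev_popcount: "ev (uniform n) (\<lambda>w. f (count_list w True)) = ev (binomial_pmf n (1 / 2)) f"
proof -
  have "ev (uniform n) h = ev (replicate_pmf n (bernoulli_pmf (1 / 2))) h" for h
  proof (induction n arbitrary: h)
    case 0 then show ?case by (simp add: ev_uniform bitstrings_def)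
  next
    case (Suc n)
    have b1: "bitstrings (Suc 0) = {[True], [False]}" by (auto simp: bitstrings_def length_Suc_conv)
    have "ev (uniform (1 + n)) h = (ev (uniform n) (\<lambda>w. h (True # w)) + ev (uniform n) (\<lambda>w. h (False # w))) / 2"
      unfolding ev_uniform_add by (simp add: ev_uniform[of "Suc 0"] b1)
    then show ?case unfolding ev_replicate_Suc[OF finite] Suc
      by (simp add: ev_def[of "bernoulli_pmf (1 / 2)"] set_pmf_bernoulli UNIV_bool algebra_simps)
  qed
  moreover have "count_list w True = length (filter id w)" for w by (induction w) auto
  ultimately show ?thesis by (simp add: binomial_pmf_altdef ev_map o_def)
qed

lemma popcount_pmf: "map_pmf (\<lambda>w. count_list w True) (uniform n) = binomial_pmf n (1 / 2)"
proof (rule pmf_eqI)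
  fix i
  have "pmf (map_pmf (\<lambda>w. count_list w True) (uniform n)) i = ev (uniform n) (\<lambda>w. of_bool (count_list w True = i))"
    by (simp add: ev_pmf[symmetric] ev_map)
  also have "\<dots> = pmf (binomial_pmf n (1 / 2)) i"
    by (simp add: ev_popcount[of n "\<lambda>c. of_bool (c = i)"] ev_pmf)
  finally show "pmf (map_pmf (\<lambda>w. count_list w True) (uniform n)) i = pmf (binomial_pmf n (1 / 2)) i" .
qed

section \<open>Choice of parameters\<close>

text \<open>
  The constants make each of the four error terms of the sampling theorem at most \<open>1 / 96\<close>. In total
  the value rises from \<open>1 / 3\<close> to at most \<open>3 / 8\<close>, and three rounds with a majority vote
  bring \<open>3 / 8\<close> back below \<open>1 / 3\<close>.
\<close>

definition advice_size :: "nat \<Rightarrow> nat \<Rightarrow> nat" where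
  "advice_size K m = 1152 * K\<^sup>2 * (m + 1)"

text \<open>The factor 1152 is \<open>96 * 96 / 8\<close>, where the 8 stems from Hoeffding's lemma.
  The inner expression exceeds the logarithm of the size of the net, and the outer square
  compensates the square root in \<open>binomial_collision\<close>.\<close>

definition sample_size :: "nat \<Rightarrow> nat \<Rightarrow> nat" where
  "sample_size K m = (1152 * (2 * K\<^sup>2 * advice_size K m * m + 1) * K)\<^sup>2"

lemma sampled_value_bits:
  fixes U :: "bool list list \<Rightarrow> bool list list \<Rightarrow> real" and m :: nat
  assumes "1 \<le> k" "k \<le> K" and U: "\<And>ys as. 0 \<le> U ys as" "\<And>ys as. U ys as \<le> 1"
    and val: "\<And>F. (\<And>j y. F j y \<in> bitstrings m) \<Longrightarrow>
      ev (replicate_pmf k (uniform m)) (\<lambda>ys. U ys (map (\<lambda>j. F j (ys ! j)) [0..<k])) \<le> 1 / 3"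
    and B: "\<And>Sl j u. length Sl = k * (sample_size K m + 1) \<Longrightarrow> j < k \<Longrightarrow> u \<le> sample_size K m \<Longrightarrow>
      B Sl j u \<in> bitstrings m"
  shows "ev (replicate_pmf (k * (sample_size K m + 1)) (uniform m))
     (\<lambda>Sl. sampled_game.payoff k (binomial_pmf (sample_size K m) (1 / 2)) U (blocks (sample_size K m + 1) Sl) (B Sl)) \<le> 3 / 8"
proof -
  define T where "T = sample_size K m"
  define I where "I = binomial_pmf T (1 / 2)"
  define t where "t = advice_size K m"
  define N where "N = 2 * K\<^sup>2 * t * m"
  have TN: "T = (1152 * (N + 1) * K)\<^sup>2" by (simp add: T_def N_def t_def sample_size_def)
  have K: "1 \<le> K" using assms by simp
  have I: "set_pmf I \<subseteq> {..<T + 1}"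
    unfolding I_def by (rule order_trans[OF set_pmf_binomial_eq[THEN equalityD1]]) auto
  interpret sampled_game k "uniform m" "bitstrings m" I U
    by unfold_locales (use U in \<open>auto simp: I_def\<close>)
  \<comment> \<open>\<open>l\<close> is large against \<open>K\<close> times the logarithm of the
    number of answers, and \<open>l'\<close> against the logarithm of the size of the net. The error
    parts that grow with \<open>l\<close> and \<open>l'\<close> are in turn absorbed by the advice
    size \<open>t\<close> and the sample size \<open>T\<close>.\<close>
  define l :: real where "l = 96 * K * (m + 1)"
  define l' :: real where "l' = 96 * (N + 1)"
  define W where "W = (\<Sum>u<T + 1. (pmf I u)\<^sup>2)"
  have l: "0 < l" "0 < l'" unfolding l_def l'_def of_nat_0_less_iff using K by simp_all
  have t: "0 < t" using K by (simp add: t_def advice_size_def)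
  define M where "M = real m + 1"
  have M: "0 < M" and Kp: "0 < real K" using K by (simp_all add: M_def)
  have lM: "l = 96 * real K * M" and tM: "real t = 1152 * (real K)\<^sup>2 * M"
    by (simp_all add: M_def l_def t_def advice_size_def algebra_simps)
  have main: "ev (replicate_pmf (k * (T + 1)) (uniform m)) (\<lambda>Sl. payoff (blocks (T + 1) Sl) (B Sl)) \<le>
    1 / 3 + k * ((ln (card (bitstrings m)) + l\<^sup>2 / (8 * real t)) / l) +
    (ln (card (net t)) + l'\<^sup>2 * (k * W / 8)) / l'"
    unfolding W_def
    by (rule sampled_value[OF I t l val]) (use B I in \<open>auto simp: T_def[symmetric] less_Suc_eq_le subset_iff\<close>)
  have ln2: "ln (2 :: real) \<le> 1" using ln_le_minus_one[of "2 :: real"] by simp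
  have kK: "real k \<le> real K" using assms by simp
  have "ln (card (bitstrings m)) \<le> real m" using ln2 by (simp add: ln_realpow mult_left_le)
  then have "k * (ln (card (bitstrings m)) / l) \<le> K * (M / l)"
    using l kK by (intro mult_mono divide_right_mono) (auto simp: M_def)
  also have "\<dots> = 1 / 96" using M Kp by (simp add: lM field_simps)
  finally have e1: "k * (ln (card (bitstrings m)) / l) \<le> 1 / 96" .
  have "k * (l\<^sup>2 / (8 * real t) / l) \<le> K * (l\<^sup>2 / (8 * real t) / l)"
    using l kK by (intro mult_right_mono) auto
  also have "\<dots> = 1 / 96"
    using M Kp by (simp add: lM tM field_simps power2_eq_square)
  finally have e2: "k * (l\<^sup>2 / (8 * real t) / l) \<le> 1 / 96" .
  have "ln (card (net t)) \<le> N"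
  \<comment> \<open>An empty net is covered by the convention \<open>ln 0 = 0\<close>.\<close>
  proof (cases "card (net t) = 0")
    case False
    have "card (net t) \<le> ((card (set_pmf (uniform m)) ^ k * card (bitstrings m) ^ k) ^ t) ^ k" by (rule card_net)
    also have "\<dots> = 2 ^ (2 * m * k * t * k)" by (simp add: power_mult[symmetric] power_add[symmetric] mult_ac)
    finally have "real (card (net t)) \<le> 2 ^ (2 * m * k * t * k)" by (metis of_nat_le_iff of_nat_numeral of_nat_power)
    then have "ln (card (net t)) \<le> ln (2 ^ (2 * m * k * t * k))" using False by (subst ln_le_cancel_iff) auto
    also have "\<dots> = real (2 * m * k * t * k) * ln 2" by (simp add: ln_realpow)
    also have "\<dots> \<le> real (2 * m * k * t * k)" using ln2 by (simp add: mult_left_le)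
    also have "2 * m * k * t * k \<le> N"
      unfolding N_def power2_eq_square using mult_le_mono[OF assms(2) assms(2)]
      by (simp add: mult_ac mult_le_mono)
    finally show ?thesis by simp
  qed simp
  then have "ln (card (net t)) / l' \<le> (N + 1) / l'" using l by (intro divide_right_mono) auto
  also have "\<dots> = 1 / 96" by (simp add: l'_def field_simps)
  finally have e3: "ln (card (net t)) / l' \<le> 1 / 96" .
  have W0: "0 \<le> W" unfolding W_def by (intro sum_nonneg) auto
  \<comment> \<open>\<open>T\<close> is the square of the factor on the left, so that factor is at
    most \<open>sqrt (2 * T + 1)\<close>.\<close>
  have "W * (1152 * (N + 1) * K) \<le> W * sqrt (2 * T + 1)"
    by (intro mult_left_mono W0 real_le_rsqrt) (simp add: TN)
  also have "\<dots> \<le> 1" unfolding W_def I_def by (rule binomial_collision)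
  finally have W1: "W * (1152 * (N + 1) * K) \<le> 1" .
  have "l'\<^sup>2 * (k * W / 8) / l' \<le> l'\<^sup>2 * (K * W / 8) / l'"
    using l kK W0 by (intro divide_right_mono mult_left_mono mult_right_mono) auto
  also have "\<dots> = W * (1152 * (N + 1) * K) / 96"
    using l(2) by (simp add: power2_eq_square l'_def field_simps)
  also have "\<dots> \<le> 1 / 96" using W1 by simp
  finally have e4: "l'\<^sup>2 * (k * W / 8) / l' \<le> 1 / 96" .
  have "1 / 3 + k * ((ln (card (bitstrings m)) + l\<^sup>2 / (8 * real t)) / l) + (ln (card (net t)) + l'\<^sup>2 * (k * W / 8)) / l' =
     1 / 3 + (k * (ln (card (bitstrings m)) / l) + k * (l\<^sup>2 / (8 * real t) / l)) +
     (ln (card (net t)) / l' + l'\<^sup>2 * (k * W / 8) / l')"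
    by (simp add: add_divide_distrib distrib_left)
  also have "\<dots> \<le> 3 / 8" using e1 e2 e3 e4 by linarith
  finally show ?thesis using main unfolding T_def I_def by linarith
qed

section \<open>The sampled protocol\<close>

text \<open>The probability that at least two of three independent events with probabilities
  \<open>a\<close>, \<open>b\<close>, \<open>c\<close> occur. It is affine in each variable, so it
  commutes with independent expectations.\<close>

definition maj3 :: "real \<Rightarrow> real \<Rightarrow> real \<Rightarrow> real" where
  "maj3 a b c = a * b + a * c + b * c - 2 * a * b * c"

lemma of_bool_majority: "of_bool (majority a b c) = maj3 (of_bool a) (of_bool b) (of_bool c)"
  by (cases a; cases b; cases c) (simp_all add: majority_def maj3_def)

lemma ev_maj3:
  assumes "finite (set_pmf p)"
  shows "ev p (\<lambda>x. ev p (\<lambda>y. ev p (\<lambda>z. maj3 (f x) (g y) (h z)))) = maj3 (ev p f) (ev p g) (ev p h)"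
  using assms by (simp add: maj3_def ev_add ev_diff ev_cmult ev_multc ev_const)

text \<open>The slope in \<open>a\<close> is the probability that exactly one of the other two
  events occurs, that is, that the first vote is decisive.\<close>

lemma maj3_mono1:
  assumes "a \<le> a'" "0 \<le> b" "b \<le> 1" "0 \<le> c" "c \<le> 1"
  shows "maj3 a b c \<le> maj3 a' b c"
proof -
  have "0 \<le> b * (1 - c) + c * (1 - b)" using assms by simp
  then have "0 \<le> (a' - a) * (b * (1 - c) + c * (1 - b))" using assms(1) by simp
  then show ?thesis by (simp add: maj3_def algebra_simps)
qed

lemma maj3_commute: "maj3 a b c = maj3 b a c" "maj3 a b c = maj3 c b a"
  by (simp_all add: maj3_def algebra_simps)

lemma maj3_mono:
  assumes "0 \<le> a" "a \<le> a'" "a' \<le> 1" "0 \<le> b" "b \<le> b'" "b' \<le> 1" "0 \<le> c" "c \<le> c'" "c' \<le> 1"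
  shows "maj3 a b c \<le> maj3 a' b' c'"
proof -
  have "maj3 a b c \<le> maj3 a' b c" by (rule maj3_mono1) (use assms in auto)
  also have "\<dots> = maj3 b a' c" by (rule maj3_commute)
  also have "\<dots> \<le> maj3 b' a' c" by (rule maj3_mono1) (use assms in auto)
  also have "\<dots> = maj3 c a' b'" by (rule maj3_commute)
  also have "\<dots> \<le> maj3 c' a' b'" by (rule maj3_mono1) (use assms in auto)
  also have "\<dots> = maj3 a' b' c'" by (simp add: maj3_def algebra_simps)
  finally show ?thesis .
qed

section \<open>Rounds of the verifier as payoffs of the sampled game\<close>

lemma map_pick:
  "map (pick m s y r) [0..<k] =
    select k (blocks (s + 1) (chop (k * (s + 1)) m y)) (map (\<lambda>b. count_list b True) (chop k s r))"
proof -
  have "pick m s y r j = blocks (s + 1) (chop (k * (s + 1)) m y) j (map (\<lambda>b. count_list b True) (chop k s r) ! j)"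
    if j: "j < k" for j
  proof -
    have c: "count_list (take s (drop (j * s) r)) True < s + 1" using count_take_le[of s _ True] by (simp add: less_Suc_eq_le)
    have "j * (s + 1) + count_list (take s (drop (j * s) r)) True < k * (s + 1)"
      by (rule block_index_less[OF j c])
    then show ?thesis using j unfolding pick_def blocks_def by (simp add: chop_def)
  qed
  then show ?thesis by (simp add: select_def)
qed

lemma query_eq:
  "query x k m s l y a r =
    (let c = map (\<lambda>b. count_list b True) (chop k s r) in
     x # select k (blocks (s + 1) (chop (k * (s + 1)) m y)) c @
     select k (blocks (s + 1) (chop (k * (s + 1)) m a)) c @ [take l (drop (k * s) r)])"
  unfolding query_def map_pick Let_def ..

definition coin_value :: "(bool list list \<Rightarrow> bool) \<Rightarrow> bool list \<Rightarrow> nat \<Rightarrow> bool list list \<Rightarrow> bool list list \<Rightarrow> real" where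
  "coin_value V x l ys as = ev (uniform l) (\<lambda>r. of_bool (V (x # ys @ as @ [r])))"

lemma coin_value_range: "0 \<le> coin_value V x l ys as" "coin_value V x l ys as \<le> 1"
proof -
  have "ev (uniform l) (\<lambda>_. 0) \<le> coin_value V x l ys as" "coin_value V x l ys as \<le> ev (uniform l) (\<lambda>_. 1)"
    unfolding coin_value_def by (intro ev_mono; simp)+
  then show "0 \<le> coin_value V x l ys as" "coin_value V x l ys as \<le> 1" by simp_all
qed

lemma accept_prob_coin_value:
  assumes "length bs = k"
  shows "accept_prob V x m l bs =
    ev (replicate_pmf k (uniform m)) (\<lambda>ys. coin_value V x l ys (map2 (\<lambda>b y. b y) bs ys))"
proof -
  have f: "finite (set_pmf (replicate_pmf k (uniform m)))" by simp
  show ?thesis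
    unfolding accept_prob_def assms uniform_def[symmetric]
    by (subst ev_prob) (simp_all add: f ev_pair coin_value_def)
qed

lemma sampled_game_coin_value:
  "sampled_game (uniform m) (bitstrings m) (binomial_pmf s (1 / 2)) (coin_value V x l)"
  by unfold_locales (auto simp: coin_value_range set_pmf_binomial_eq)

abbreviation round_payoff where
  "round_payoff V x k m s l Ys As \<equiv>
     sampled_game.payoff k (binomial_pmf s (1 / 2)) (coin_value V x l) (blocks (s + 1) Ys) (blocks (s + 1) As)"

text \<open>The first \<open>k * s\<close> coins yield one binomial position for each block and
  become the picks of \<open>payoff\<close>; the other \<open>l\<close> are the coins of the
  original verifier and are averaged out in \<open>coin_value\<close>.\<close>

lemma ev_query:
  "ev (uniform (k * s + l)) (\<lambda>r. of_bool (V (query x k m s l y a r))) =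
     round_payoff V x k m s l (chop (k * (s + 1)) m y) (chop (k * (s + 1)) m a)"
proof -
  interpret sampled_game k "uniform m" "bitstrings m" "binomial_pmf s (1 / 2)" "coin_value V x l"
    by (rule sampled_game_coin_value)
  let ?Y = "blocks (s + 1) (chop (k * (s + 1)) m y)" and ?A = "blocks (s + 1) (chop (k * (s + 1)) m a)"
  let ?f = "\<lambda>c. coin_value V x l (select k ?Y c) (select k ?A c)"
  have "ev (uniform (k * s + l)) (\<lambda>r. of_bool (V (query x k m s l y a r))) =
     ev (uniform (k * s)) (\<lambda>r. ?f (map (\<lambda>b. count_list b True) (chop k s r)))"
    unfolding ev_uniform_add
  proof (rule ev_cong)
    fix r assume "r \<in> set_pmf (uniform (k * s))"
    then have r: "length r = k * s" by (simp add: bitstrings_def)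
    have "chop k s (r @ r') = chop k s r" for r'
      using chop_take[of k s "r @ r'"] r by simp
    then show "ev (uniform l) (\<lambda>r'. of_bool (V (query x k m s l y a (r @ r')))) =
      ?f (map (\<lambda>b. count_list b True) (chop k s r))"
      unfolding query_eq coin_value_def Let_def by (intro ev_cong) (simp add: r bitstrings_def)
  qed
  also have "\<dots> = ev (replicate_pmf k (uniform s)) (\<lambda>bs. ?f (map (\<lambda>b. count_list b True) bs))"
    by (rule ev_chop)
  also have "\<dots> = payoff ?Y ?A"
    unfolding payoff_def by (subst popcount_pmf[symmetric], rule ev_replicate_map) simp
  finally show ?thesis .
qed

text \<open>Rounds read disjoint stretches of the coin string; this makes them independent once the
  questions and answers are fixed.\<close>

lemma query_take:
  "query x k m s l y a (take (k * s + l) r) = query x k m s l y a r"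
proof -
  have "take (k * s) (take (k * s + l) r) = take (k * s) r" by simp
  then have "chop k s (take (k * s + l) r) = chop k s r" using chop_take[of k s] by metis
  then show ?thesis unfolding query_eq by (simp add: drop_take)
qed

lemma ev_three_rounds:
  assumes "3 * (k * s + l) \<le> n"
  shows "ev (uniform n) (\<lambda>r. of_bool (majority
      (V (query x k m s l y0 a0 r)) (V (query x k m s l y1 a1 (drop (k * s + l) r)))
      (V (query x k m s l y2 a2 (drop (2 * (k * s + l)) r))))) =
    maj3 (round_payoff V x k m s l (chop (k * (s + 1)) m y0) (chop (k * (s + 1)) m a0))
      (round_payoff V x k m s l (chop (k * (s + 1)) m y1) (chop (k * (s + 1)) m a1))
      (round_payoff V x k m s l (chop (k * (s + 1)) m y2) (chop (k * (s + 1)) m a2))"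
proof -
  let ?q = "\<lambda>y a r. of_bool (V (query x k m s l y a r)) :: real"
  have "ev (uniform n) (\<lambda>r. of_bool (majority
      (V (query x k m s l y0 a0 r)) (V (query x k m s l y1 a1 (drop (k * s + l) r)))
      (V (query x k m s l y2 a2 (drop (2 * (k * s + l)) r))))) =
    ev (uniform n) (\<lambda>r. maj3 (?q y0 a0 (take (k * s + l) r)) (?q y1 a1 (take (k * s + l) (drop (k * s + l) r)))
      (?q y2 a2 (take (k * s + l) (drop (2 * (k * s + l)) r))))"
    unfolding of_bool_majority query_take ..
  also have "\<dots> = maj3 (ev (uniform (k * s + l)) (?q y0 a0)) (ev (uniform (k * s + l)) (?q y1 a1))
     (ev (uniform (k * s + l)) (?q y2 a2))"
    by (subst ev_uniform_three[OF assms]) (simp add: ev_maj3)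
  finally show ?thesis unfolding ev_query .
qed

section \<open>Value of the three-round protocol against a single Merlin\<close>

definition rounds :: "nat \<Rightarrow> (bool list \<Rightarrow> bool list \<Rightarrow> real) \<Rightarrow> bool list \<Rightarrow> bool list \<Rightarrow> real" where
  "rounds d g y a = maj3 (g y a) (g (drop d y) (drop d a)) (g (drop (2 * d) y) (drop (2 * d) a))"

lemma ev_rounds:
  assumes "3 * (N * m) \<le> n"
  shows "ev (uniform n) (\<lambda>y. rounds (N * m) (\<lambda>y _. f (chop N m y)) y (b y)) =
    maj3 (ev (replicate_pmf N (uniform m)) f) (ev (replicate_pmf N (uniform m)) f) (ev (replicate_pmf N (uniform m)) f)"
proof -
  have "ev (uniform n) (\<lambda>y. rounds (N * m) (\<lambda>y _. f (chop N m y)) y (b y)) =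
     ev (uniform n) (\<lambda>y. maj3 (f (chop N m (take (N * m) y))) (f (chop N m (take (N * m) (drop (N * m) y))))
        (f (chop N m (take (N * m) (drop (2 * (N * m)) y)))))"
    unfolding chop_take rounds_def ..
  also have "\<dots> = maj3 (ev (uniform (N * m)) (\<lambda>w. f (chop N m w))) (ev (uniform (N * m)) (\<lambda>w. f (chop N m w)))
     (ev (uniform (N * m)) (\<lambda>w. f (chop N m w)))"
    by (subst ev_uniform_three[OF assms]) (simp add: ev_maj3)
  finally show ?thesis unfolding ev_chop .
qed

definition protocol_value where
  "protocol_value V x k m s l Q C \<beta> =
    ev (uniform Q) (\<lambda>y. ev (uniform C) (\<lambda>r. of_bool (majority
      (V (query x k m s l y (\<beta> y) r))
      (V (query x k m s l (drop (k * (s + 1) * m) y) (drop (k * (s + 1) * m) (\<beta> y)) (drop (k * s + l) r)))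
      (V (query x k m s l (drop (2 * (k * (s + 1) * m)) y) (drop (2 * (k * (s + 1) * m)) (\<beta> y)) (drop (2 * (k * s + l)) r))))))"

lemma protocol_value_eq:
  assumes "3 * (k * s + l) \<le> C"
  shows "protocol_value V x k m s l Q C \<beta> =
    ev (uniform Q) (\<lambda>y. rounds (k * (s + 1) * m)
      (\<lambda>y a. round_payoff V x k m s l (chop (k * (s + 1)) m y) (chop (k * (s + 1)) m a)) y (\<beta> y))"
  unfolding protocol_value_def rounds_def by (intro ev_cong ev_three_rounds assms)

text \<open>Merlin sees the questions of all three rounds and may correlate his answers. But
  \<open>maj3\<close> is monotone on probabilities, so for each question string he does no better
  than by answering every round optimally on its own. Optimal answers depend only on the questions
  of their round, so the three optimal payoffs are independent, each with mean at most
  \<open>3 / 8\<close>.\<close>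

lemma soundness:
  assumes "1 \<le> k" "k \<le> K" and s: "s = sample_size K m"
    and C: "3 * (k * s + l) \<le> C" and Q: "3 * (k * (s + 1) * m) \<le> Q"
    and val: "\<And>bs. bs \<in> strategies k m \<Longrightarrow> accept_prob V x m l bs \<le> 1 / 3"
    and \<beta>: "\<And>y. y \<in> bitstrings Q \<Longrightarrow> \<beta> y \<in> bitstrings Q"
  shows "protocol_value V x k m s l Q C \<beta> \<le> 1 / 3"
proof -
  interpret sampled_game k "uniform m" "bitstrings m" "binomial_pmf s (1 / 2)" "coin_value V x l"
    by (rule sampled_game_coin_value)
  define N where "N = k * (s + 1)"
  define AA where "AA = {As. set As \<subseteq> bitstrings m \<and> length As = N}"
  define p where "p = (\<lambda>Ys As. payoff (blocks (s + 1) Ys) (blocks (s + 1) As))"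
  have p: "0 \<le> p Ys As" "p Ys As \<le> 1" for Ys As
  proof -
    have fin: "finite (set_pmf (replicate_pmf k (binomial_pmf s (1 / 2))))" using fin_I by simp
    have "ev (replicate_pmf k (binomial_pmf s (1 / 2))) (\<lambda>_. 0) \<le> p Ys As"
      "p Ys As \<le> ev (replicate_pmf k (binomial_pmf s (1 / 2))) (\<lambda>_. 1)"
      unfolding p_def payoff_def by (intro ev_mono coin_value_range)+
    then show "0 \<le> p Ys As" "p Ys As \<le> 1" by (simp_all add: ev_const[OF fin])
  qed
  have AA: "finite AA" "AA \<noteq> {}"
  proof -
    show "finite AA" unfolding AA_def by (rule finite_lists_length_eq) simp
    obtain w where "w \<in> bitstrings m" using bitstrings_ne by blast
    then have "replicate N w \<in> AA" by (auto simp: AA_def)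
    then show "AA \<noteq> {}" by blast
  qed
  have "\<exists>As. As \<in> AA \<and> (\<forall>Bs\<in>AA. p Ys Bs \<le> p Ys As)" for Ys
  proof -
    have "Max (p Ys ` AA) \<in> p Ys ` AA" using AA by (intro Max_in) auto
    then obtain As where "As \<in> AA" "p Ys As = Max (p Ys ` AA)" by force
    then show ?thesis using AA(1) by (intro exI[of _ As]) auto
  qed
  \<comment> \<open>\<open>M Ys\<close> is an optimal table of answers to the questions
    \<open>Ys\<close> of one round.\<close>
  then obtain M where M: "\<And>Ys. M Ys \<in> AA" "\<And>Ys Bs. Bs \<in> AA \<Longrightarrow> p Ys Bs \<le> p Ys (M Ys)" by metis
  define e where "e = ev (replicate_pmf N (uniform m)) (\<lambda>Ys. p Ys (M Ys))"
  have e: "e \<le> 3 / 8"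
    unfolding e_def N_def p_def s
  proof (rule sampled_value_bits[OF assms(1,2)])
    show "0 \<le> coin_value V x l ys as" "coin_value V x l ys as \<le> 1" for ys as by (rule coin_value_range)+
    fix F :: "nat \<Rightarrow> bool list \<Rightarrow> bool list" assume F: "\<And>j y. F j y \<in> bitstrings m"
    have "map F [0..<k] \<in> strategies k m" using F by (auto simp: strategies_def)
    from val[OF this] show "ev (replicate_pmf k (uniform m)) (\<lambda>ys. coin_value V x l ys (map (\<lambda>j. F j (ys ! j)) [0..<k])) \<le> 1 / 3"
    proof (subst (asm) accept_prob_coin_value)
      assume *: "ev (replicate_pmf k (uniform m)) (\<lambda>ys. coin_value V x l ys (map2 (\<lambda>b y. b y) (map F [0..<k]) ys)) \<le> 1 / 3"
      have "ev (replicate_pmf k (uniform m)) (\<lambda>ys. coin_value V x l ys (map2 (\<lambda>b y. b y) (map F [0..<k]) ys)) =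
        ev (replicate_pmf k (uniform m)) (\<lambda>ys. coin_value V x l ys (map (\<lambda>j. F j (ys ! j)) [0..<k]))"
        by (intro ev_cong arg_cong2[of _ _ _ _ "coin_value V x l"] nth_equalityI) (auto simp: in_replicate_pmf)
      with * show ?thesis by simp
    qed simp
  next
    fix Sl j u assume "j < k" "u \<le> sample_size K m"
    then have "j * (s + 1) + u < N" unfolding N_def by (intro block_index_less) (auto simp: s)
    then show "blocks (sample_size K m + 1) (M Sl) j u \<in> bitstrings m"
      using M(1)[of Sl] by (auto simp: blocks_def AA_def s[symmetric] subset_iff)
  qed
  have e0: "0 \<le> e"
    using ev_mono[of "replicate_pmf N (uniform m)" "\<lambda>_. 0" "\<lambda>Ys. p Ys (M Ys)"] p(1)
    unfolding e_def by (simp add: ev_const)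
  have ch: "chop N m (drop d (\<beta> y)) \<in> AA" if "y \<in> bitstrings Q" "d + N * m \<le> Q" for y d
  proof -
    have "length (\<beta> y) = Q" using \<beta>[OF that(1)] by (simp add: bitstrings_def)
    then have "chop N m (drop d (\<beta> y)) ! i \<in> bitstrings m" if "i < N" for i
      using that \<open>d + N * m \<le> Q\<close> by (intro chop_bitstrings) auto
    then show ?thesis by (auto simp: AA_def in_set_conv_nth)
  qed
  have Q': "3 * (N * m) \<le> Q" using Q by (simp add: N_def)
  have "protocol_value V x k m s l Q C \<beta> = ev (uniform Q) (\<lambda>y. rounds (N * m) (\<lambda>y a. p (chop N m y) (chop N m a)) y (\<beta> y))"
    unfolding protocol_value_eq[OF C] p_def N_def ..
  also have "\<dots> \<le> ev (uniform Q) (\<lambda>y. rounds (N * m) (\<lambda>y _. p (chop N m y) (M (chop N m y))) y (\<beta> y))"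
  proof (rule ev_mono)
    fix y assume "y \<in> set_pmf (uniform Q)"
    then have y: "y \<in> bitstrings Q" by simp
    have "chop N m (\<beta> y) \<in> AA" using ch[OF y, of 0] Q' by simp
    moreover have "chop N m (drop (N * m) (\<beta> y)) \<in> AA" "chop N m (drop (2 * (N * m)) (\<beta> y)) \<in> AA"
      using ch[OF y, of "N * m"] ch[OF y, of "2 * (N * m)"] Q' by simp_all
    ultimately show "rounds (N * m) (\<lambda>y a. p (chop N m y) (chop N m a)) y (\<beta> y) \<le>
        rounds (N * m) (\<lambda>y _. p (chop N m y) (M (chop N m y))) y (\<beta> y)"
      unfolding rounds_def
      by (intro maj3_mono p M(2))
  qed
  also have "\<dots> = maj3 e e e" unfolding e_def by (rule ev_rounds[OF Q'])
  \<comment> \<open>The right-hand side is \<open>81 / 256\<close>, just below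
    \<open>1 / 3\<close>.\<close>
  also have "\<dots> \<le> maj3 (3 / 8) (3 / 8) (3 / 8)" using e e0 by (intro maj3_mono) auto
  also have "\<dots> \<le> 1 / 3" by (simp add: maj3_def)
  finally show ?thesis .
qed

lemma take_drop_concat:
  assumes "\<And>x. x \<in> set xs \<Longrightarrow> length x = m" "i < length xs"
  shows "take m (drop (i * m) (concat xs @ zs)) = xs ! i"
  using assms
proof (induction xs arbitrary: i)
  case (Cons x xs)
  then show ?case by (cases i) auto
qed simp

lemma completeness:
  assumes C: "3 * (k * s + l) \<le> C" and Q: "3 * (k * (s + 1) * m) \<le> Q"
    and bs: "bs \<in> strategies k m" and acc: "2 / 3 \<le> accept_prob V x m l bs"
  shows "\<exists>\<beta>. (\<forall>y\<in>bitstrings Q. \<beta> y \<in> bitstrings Q) \<and> 2 / 3 \<le> protocol_value V x k m s l Q C \<beta>"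
proof -
  interpret sampled_game k "uniform m" "bitstrings m" "binomial_pmf s (1 / 2)" "coin_value V x l"
    by (rule sampled_game_coin_value)
  define N where "N = k * (s + 1)"
  have Q': "3 * (N * m) \<le> Q" using Q by (simp add: N_def)
  \<comment> \<open>Record \<open>i\<close> of the whole string is record \<open>i mod N\<close> of
    its round; dividing by the block length gives the prover whose strategy answers it.\<close>
  define R where "R = (\<lambda>y. map (\<lambda>i. (bs ! (i mod N div (s + 1))) (take m (drop (i * m) y))) [0..<3 * N])"
  \<comment> \<open>Answers must be as long as questions, so the unread rest is filled with
    zeros.\<close>
  define \<beta> where "\<beta> = (\<lambda>y. concat (R y) @ replicate (Q - 3 * (N * m)) False)"
  have lb: "length bs = k" and bb: "\<And>j w. j < k \<Longrightarrow> w \<in> bitstrings m \<Longrightarrow> (bs ! j) w \<in> bitstrings m"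
    using bs by (auto simp: strategies_def subset_iff Pi_iff)
  have Rlen: "length w = m" if y: "y \<in> bitstrings Q" and w: "w \<in> set (R y)" for y w
  proof -
    obtain i where i: "i < 3 * N" "w = (bs ! (i mod N div (s + 1))) (take m (drop (i * m) y))"
      using w by (auto simp: R_def)
    have "0 < N" using i(1) by simp
    then have "i mod N < k * (s + 1)" by (simp add: N_def)
    then have jk: "i mod N div (s + 1) < k" by (rule less_mult_imp_div_less)
    have "Suc i * m \<le> 3 * N * m" using i(1) by (intro mult_le_mono1) simp
    then have "i * m + m \<le> Q" using Q' by simp
    then have "take m (drop (i * m) y) \<in> bitstrings m" using y by (simp add: bitstrings_def)
    with jk have "w \<in> bitstrings m" unfolding i(2) by (rule bb)
    then show ?thesis by (simp add: bitstrings_def)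
  qed
  have \<beta>: "\<beta> y \<in> bitstrings Q" if "y \<in> bitstrings Q" for y
  proof -
    have e: "map length (R y) = map (\<lambda>_. m) (R y)" by (rule map_cong[OF refl]) (rule Rlen[OF that])
    have "length (concat (R y)) = length (R y) * m" unfolding length_concat e by (simp add: sum_list_triv)
    then have "length (concat (R y)) = 3 * N * m" by (simp add: R_def)
    then show ?thesis using Q' by (simp add: \<beta>_def bitstrings_def)
  qed
  define F where "F = (\<lambda>j. bs ! j)"
  define f where "f = (\<lambda>Ys. payoff (blocks (s + 1) Ys) (\<lambda>j u. F j (blocks (s + 1) Ys j u)))"
  have pay: "payoff (blocks (s + 1) (chop N m (drop (i * (N * m)) y))) (blocks (s + 1) (chop N m (drop (i * (N * m)) (\<beta> y)))) =
      f (chop N m (drop (i * (N * m)) y))" if y: "y \<in> bitstrings Q" and i: "i < 3" for y i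
    unfolding f_def
  proof (rule payoff_cong)
    fix j u assume j: "j < k" and u: "u \<in> set_pmf (binomial_pmf s (1 / 2))"
    have us: "u < s + 1" using u by (auto simp: set_pmf_binomial_eq split: if_splits)
    define b where "b = j * (s + 1) + u"
    have b: "b < N" unfolding b_def N_def by (rule block_index_less[OF j us])
    have bd: "b div (s + 1) = j"
      unfolding b_def by (rule div_nat_eqI) (use us in \<open>auto simp: algebra_simps\<close>)
    have lt: "i * N + b < 3 * N"
    proof -
      have "i * N + b < Suc i * N" "Suc i * N \<le> 3 * N" using b i by (simp, intro mult_le_mono1) simp
      then show ?thesis by linarith
    qed
    have bm: "(i * N + b) mod N = b" using b by simp
    have "take m (drop ((i * N + b) * m) (\<beta> y)) = R y ! (i * N + b)"
      unfolding \<beta>_def by (rule take_drop_concat[OF Rlen[OF y]]) (use lt in \<open>simp_all add: R_def\<close>)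
    also have "\<dots> = (bs ! ((i * N + b) mod N div (s + 1))) (take m (drop ((i * N + b) * m) y))"
      unfolding R_def using lt by (subst nth_map) (simp_all only: length_upt nth_upt add_0 diff_zero)
    finally have e: "take m (drop ((i * N + b) * m) (\<beta> y)) = (bs ! j) (take m (drop ((i * N + b) * m) y))"
      unfolding bm bd .
    have idx: "blocks (s + 1) (chop N m w) j u = take m (drop (b * m) w)" for w :: "bool list"
      unfolding blocks_def b_def[symmetric] chop_def using b by simp
    have pos: "b * m + i * (N * m) = (i * N + b) * m" by (simp add: algebra_simps)
    show "blocks (s + 1) (chop N m (drop (i * (N * m)) (\<beta> y))) j u =
       F j (blocks (s + 1) (chop N m (drop (i * (N * m)) y)) j u)"
      using e by (simp only: idx F_def drop_drop pos)
  qed simp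
  define e where "e = ev (replicate_pmf N (uniform m)) f"
  have "e = ev (replicate_pmf k (binomial_pmf s (1 / 2))) (\<lambda>c. ev (replicate_pmf N (uniform m)) (\<lambda>Ys.
      coin_value V x l (select k (blocks (s + 1) Ys) c) (map (\<lambda>j. F j (select k (blocks (s + 1) Ys) c ! j)) [0..<k])))"
    unfolding e_def f_def payoff_strategy by (rule ev_swap)
  also have "\<dots> = ev (replicate_pmf k (binomial_pmf s (1 / 2))) (\<lambda>c. ev (replicate_pmf k (uniform m)) (\<lambda>ys.
      coin_value V x l ys (map (\<lambda>j. F j (ys ! j)) [0..<k])))"
  proof (rule ev_cong)
    fix c assume "c \<in> set_pmf (replicate_pmf k (binomial_pmf s (1 / 2)))"
    then have "length c = k" "set c \<subseteq> {..<s + 1}"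
      by (auto simp: in_replicate_pmf set_pmf_binomial_eq)
    then show "ev (replicate_pmf N (uniform m)) (\<lambda>Ys. coin_value V x l (select k (blocks (s + 1) Ys) c)
        (map (\<lambda>j. F j (select k (blocks (s + 1) Ys) c ! j)) [0..<k])) =
      ev (replicate_pmf k (uniform m)) (\<lambda>ys. coin_value V x l ys (map (\<lambda>j. F j (ys ! j)) [0..<k]))"
      unfolding N_def by (intro ev_select_blocks) auto
  qed
  also have "\<dots> = ev (replicate_pmf k (uniform m)) (\<lambda>ys. coin_value V x l ys (map (\<lambda>j. F j (ys ! j)) [0..<k]))"
    using fin_I by (simp add: ev_const)
  also have "\<dots> = accept_prob V x m l bs"
    unfolding accept_prob_coin_value[OF lb]
    by (intro ev_cong arg_cong2[of _ _ _ _ "coin_value V x l"] nth_equalityI) (auto simp: in_replicate_pmf lb F_def)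
  finally have ea: "e = accept_prob V x m l bs" .
  then have e: "2 / 3 \<le> e" using acc by simp
  have "protocol_value V x k m s l Q C \<beta> = ev (uniform Q) (\<lambda>y. rounds (N * m) (\<lambda>y _. f (chop N m y)) y (\<beta> y))"
    unfolding protocol_value_eq[OF C]
  proof (rule ev_cong)
    fix y assume "y \<in> set_pmf (uniform Q)"
    then have y: "y \<in> bitstrings Q" by simp
    show "rounds (k * (s + 1) * m) (\<lambda>y a. payoff (blocks (s + 1) (chop (k * (s + 1)) m y))
        (blocks (s + 1) (chop (k * (s + 1)) m a))) y (\<beta> y) = rounds (N * m) (\<lambda>y _. f (chop N m y)) y (\<beta> y)"
      unfolding N_def[symmetric] rounds_def using pay[OF y, of 0] pay[OF y, of 1] pay[OF y, of 2] by simp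
  qed
  also have "\<dots> = maj3 e e e" unfolding e_def by (rule ev_rounds[OF Q'])
  finally have v: "protocol_value V x k m s l Q C \<beta> = maj3 e e e" .
  have e1: "e \<le> 1"
  proof -
    have "e = ev (replicate_pmf k (uniform m)) (\<lambda>ys. coin_value V x l ys (map2 (\<lambda>b y. b y) bs ys))"
      unfolding ea by (rule accept_prob_coin_value[OF lb])
    also have "\<dots> \<le> ev (replicate_pmf k (uniform m)) (\<lambda>_. 1)" by (rule ev_mono) (rule coin_value_range)
    finally show ?thesis by (simp add: ev_const)
  qed
  \<comment> \<open>The value is \<open>20 / 27\<close>: a majority vote raises probabilities above
    one half.\<close>
  have "2 / 3 \<le> maj3 (2 / 3) (2 / 3) (2 / 3)" by (simp add: maj3_def)
  also have "\<dots> \<le> maj3 e e e" using e e1 by (intro maj3_mono) auto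
  finally show ?thesis using \<beta> v by (intro exI[of _ \<beta>]) auto
qed

section \<open>Comparison of the classes for two numbers of provers\<close>

lemma AM_provers_mono:
  assumes k: "\<And>n. 1 \<le> n \<Longrightarrow> 1 \<le> k n" "polynomially_bounded k" "unary_polytime k"
    and k': "\<And>n. 1 \<le> n \<Longrightarrow> 1 \<le> k' n" "unary_polytime k'"
  shows "AM_provers k \<subseteq> AM_provers k'"
proof
  fix L assume "L \<in> AM_provers k"
  then obtain q c :: "nat poly" and V where V: "polytime_predicate V"
    and comp: "\<And>x. x \<in> L \<Longrightarrow> \<exists>bs\<in>strategies (k (length x)) (poly q (length x)).
       2 / 3 \<le> accept_prob V x (poly q (length x)) (poly c (length x)) bs"
    and snd: "\<And>x bs. x \<notin> L \<Longrightarrow> bs \<in> strategies (k (length x)) (poly q (length x)) \<Longrightarrow>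
       accept_prob V x (poly q (length x)) (poly c (length x)) bs \<le> 1 / 3"
    unfolding AM_provers_def Let_def by blast
  obtain p where p: "\<And>n. k n \<le> poly p n" using k(2) unfolding polynomially_bounded_def by blast
  \<comment> \<open>\<open>k\<close> itself need not be a polynomial, so lengths are computed from a
    polynomial upper bound. The verifier runs with the exact \<open>k n\<close> and reads only a
    part of the questions and coins provided.\<close>
  define K where "K = p + [:1:]"
  define t where "t = [:1152:] * K\<^sup>2 * (q + [:1:])"
  define s where "s = ([:1152:] * ([:2:] * K\<^sup>2 * t * q + [:1:]) * K)\<^sup>2"
  define Q where "Q = [:3:] * (K * (s + [:1:]) * q)"
  define C where "C = [:3:] * (K * s + c)"
  have K: "k n \<le> poly K n" for n using p[of n] by (simp add: K_def)
  have s: "poly s n = sample_size (poly K n) (poly q n)" for n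
    by (simp add: s_def t_def sample_size_def advice_size_def power2_eq_square algebra_simps)
  obtain MV pV where MV: "computes MV pV (\<lambda>ws. [V ws])"
    using V unfolding polytime_predicate_def polytime_computes by blast
  obtain f Mf pf where f': "computes Mf pf f" "\<And>n. f [replicate n True] = replicate (k n) True"
    using k(3) unfolding unary_polytime_def polytime_computes by blast
  obtain g Mg pg where g': "computes Mg pg g" "\<And>n. g [replicate n True] = replicate (k' n) True"
    using k'(2) unfolding unary_polytime_def polytime_computes by blast
  define hard where "hard \<longleftrightarrow> [] \<in> L"
  interpret am_machines V f g MV Mf Mg pV pf pg q s c hard
    by unfold_locales (fact MV f'(1) g'(1))+
  have cr: "count_list (replicate n True) True = n" for n by (induction n) auto
  have kof: "k_of n = k n" and jof: "j_of n = k' n" for n by (simp_all add: k_of_def j_of_def f' g' cr)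
  have protocol: "accept_prob new_verifier x (poly Q n) (poly C n) bs =
      protocol_value V x (k n) (poly q n) (poly s n) (poly c n) (poly Q n) (poly C n) (bs ! 0)"
    if x: "x \<noteq> []" and n: "n = length x" and bs: "length bs = k' n" for x n and bs :: "(bool list \<Rightarrow> bool list) list"
  proof -
    have k1: "0 < k' n" using k'(1)[of n] x n by (cases x) auto
    have "new_verifier (x # ys @ map2 (\<lambda>b y. b y) bs ys @ [r]) = accepts x (ys ! 0) ((bs ! 0) (ys ! 0)) r"
      if ys: "length ys = k' n" for ys r
    proof -
      obtain y ys' where y: "ys = y # ys'" "length ys' = k' n - 1" using ys k1 by (cases ys) auto
      obtain b bs' where b: "bs = b # bs'" "length bs' = k' n - 1" using bs k1 by (cases bs) auto
      show ?thesis unfolding new_verifier_def Let_def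
        using x by (simp add: component_def y b jof flip: n)
    qed
    then have "accept_prob new_verifier x (poly Q n) (poly C n) bs =
       ev (replicate_pmf (k' n) (uniform (poly Q n))) (\<lambda>ys. (\<lambda>y. ev (uniform (poly C n)) (\<lambda>r. of_bool (accepts x y ((bs ! 0) y) r))) (ys ! 0))"
      unfolding accept_prob_coin_value[OF bs] coin_value_def by (intro ev_cong) (simp add: in_replicate_pmf)
    also have "\<dots> = ev (uniform (poly Q n)) (\<lambda>y. ev (uniform (poly C n)) (\<lambda>r. of_bool (accepts x y ((bs ! 0) y) r)))"
      by (rule ev_replicate_nth[OF _ k1]) simp
    also have "\<dots> = protocol_value V x (k n) (poly q n) (poly s n) (poly c n) (poly Q n) (poly C n) (bs ! 0)"
      unfolding protocol_value_def accepts_def round_query_def Let_def n[symmetric] kof by (simp add: mult.assoc)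
    finally show ?thesis .
  qed
  have bounds: "3 * (k n * poly s n + poly c n) \<le> poly C n" "3 * (k n * (poly s n + 1) * poly q n) \<le> poly Q n" for n
  proof -
    show "3 * (k n * poly s n + poly c n) \<le> poly C n"
      using mult_le_mono1[OF K, of n "poly s n"] by (simp add: C_def)
    have "poly Q n = 3 * (poly K n * (poly s n + 1) * poly q n)" by (simp add: Q_def)
    then show "3 * (k n * (poly s n + 1) * poly q n) \<le> poly Q n"
      by (simp only: mult_le_mono K order_refl)
  qed
  have empty: "accept_prob new_verifier [] m l bs = of_bool hard" for m l bs
  proof -
    have "new_verifier ([] # ws) \<longleftrightarrow> hard" for ws by (simp add: new_verifier_def component_def)
    then show ?thesis by (simp add: accept_prob_coin_value[OF refl] coin_value_def ev_const)
  qed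
  have "(x \<in> L \<longrightarrow> (\<exists>bs\<in>strategies (k' (length x)) (poly Q (length x)).
        2 / 3 \<le> accept_prob new_verifier x (poly Q (length x)) (poly C (length x)) bs)) \<and>
      (x \<notin> L \<longrightarrow> (\<forall>bs\<in>strategies (k' (length x)) (poly Q (length x)).
        accept_prob new_verifier x (poly Q (length x)) (poly C (length x)) bs \<le> 1 / 3))" for x
  proof (cases "x = []")
    case True
    \<comment> \<open>The verdict on the empty input ignores the strategies, so identity maps do,
      even if there is no prover at all.\<close>
    have "replicate (k' 0) (\<lambda>y. y) \<in> strategies (k' 0) (poly Q 0)" by (auto simp: strategies_def)
    then show ?thesis unfolding True list.size(3) empty hard_def[symmetric] by (auto simp: of_bool_def)
  next
    case False
    define n where "n = length x"
    have k1: "1 \<le> k n" "1 \<le> k' n" using k(1)[of n] k'(1)[of n] False by (auto simp: n_def Suc_le_eq)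
    show ?thesis unfolding n_def[symmetric]
    proof (intro conjI impI ballI)
      assume "x \<in> L"
      then obtain bs where "bs \<in> strategies (k n) (poly q n)" "2 / 3 \<le> accept_prob V x (poly q n) (poly c n) bs"
        using comp unfolding n_def by blast
      from completeness[OF bounds this] obtain \<beta> where \<beta>: "\<And>y. y \<in> bitstrings (poly Q n) \<Longrightarrow> \<beta> y \<in> bitstrings (poly Q n)"
        "2 / 3 \<le> protocol_value V x (k n) (poly q n) (poly s n) (poly c n) (poly Q n) (poly C n) \<beta>" by blast
      \<comment> \<open>Only the first answer is read, so the other provers may play the same
        strategy.\<close>
      have "replicate (k' n) \<beta> \<in> strategies (k' n) (poly Q n)" using \<beta>(1) by (auto simp: strategies_def)
      moreover have "2 / 3 \<le> accept_prob new_verifier x (poly Q n) (poly C n) (replicate (k' n) \<beta>)"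
        using protocol[OF False n_def, of "replicate (k' n) \<beta>"] \<beta>(2) k1 by simp
      ultimately show "\<exists>bs\<in>strategies (k' n) (poly Q n). 2 / 3 \<le> accept_prob new_verifier x (poly Q n) (poly C n) bs"
        by blast
    next
      fix bs assume "x \<notin> L" and bs: "bs \<in> strategies (k' n) (poly Q n)"
      have lb: "length bs = k' n" using bs by (simp add: strategies_def)
      have "bs ! 0 \<in> set bs" using lb k1 by simp
      then have \<beta>: "(bs ! 0) y \<in> bitstrings (poly Q n)" if "y \<in> bitstrings (poly Q n)" for y
        using bs that by (auto simp: strategies_def Pi_iff)
      have "protocol_value V x (k n) (poly q n) (poly s n) (poly c n) (poly Q n) (poly C n) (bs ! 0) \<le> 1 / 3"
        by (rule soundness[OF k1(1) K s bounds]) (use snd[OF \<open>x \<notin> L\<close>] \<beta> in \<open>auto simp: n_def\<close>)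
      then show "accept_prob new_verifier x (poly Q n) (poly C n) bs \<le> 1 / 3"
        using protocol[OF False n_def lb] by simp
    qed
  qed
  then show "L \<in> AM_provers k'"
    unfolding AM_provers_def Let_def using polytime_new_verifier by blast
qed

lemma polynomially_bounded_1: "polynomially_bounded (\<lambda>_. 1)"
  unfolding polynomially_bounded_def by (intro exI[of _ "[:1:]"]) simp

theorem theorem53:
  fixes k :: "nat \<Rightarrow> nat"
  assumes "\<And>n. n \<ge> 1 \<Longrightarrow> k n \<ge> 1"
    and "polynomially_bounded k"
    and "unary_polytime k"
  shows "AM_provers k = AM"
  unfolding AM_def
proof
  show "AM_provers k \<subseteq> AM_provers (\<lambda>_. 1)"
    by (rule AM_provers_mono) (use assms unary_polytime_1 in auto)
  show "AM_provers (\<lambda>_. 1) \<subseteq> AM_provers k"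
    by (rule AM_provers_mono) (use assms unary_polytime_1 polynomially_bounded_1 in auto)
qed

end
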